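(* Let $\Sigma$ be a finite CW complex of dimension $d$ with $n$ facets, with cut lattice $\mathcal{C}=\operatorname{im}_{\mathbb{Z}}\partial_d^*\subseteq\mathbb{Z}^n$ and flow lattice $\mathcal{F}=\ker_{\mathbb{Z}}\partial_d\subseteq\mathbb{Z}^n$. Then there is a short exact sequence $$0\to\operatorname{tor}(\tilde H_{d-1}(\Sigma;\mathbb{Z}))\to\mathbb{Z}^n/(\mathcal{C}\oplus\mathcal{F})\to\mathcal{F}^\sharp/\mathcal{F}\to0.$$ Moreover, for every acyclization $\Omega$ of $\Sigma$, the cocritical group $K^*(\Sigma)$ defined using $\Omega$ is isomorphic to $\mathcal{F}^\sharp/\mathcal{F}$ (in particular it does not depend on the choice of $\Omega$).
   Context: $\Sigma$ is a finite CW complex with the convention that it has a unique cell of dimension $-1$ (so cellular homology is reduced homology $\tilde H_*$); $d$-cells are called facets. Cells are oriented, with cellular boundary maps $\partial_i$ and coboundary maps $\partial_i^*$ (transposes), and $C_d(\Sigma;\mathbb{Z})\cong\mathbb{Z}^n$ carries the standard inner product with facets orthonormal. For a lattice $\mathcal{L}\subseteq\mathbb{R}^n$, $\mathcal{L}^\sharp=\{v\in\mathcal{L}\otimes\mathbb{R}:\langle v,w\rangle\in\mathbb{Z}\ \forall w\in\mathcal{L}\}$; $\operatorname{tor}$ denotes torsion subgroup. An acyclization of $\Sigma$ is a $(d+1)$-dimensional CW complex $\Omega$ with $d$-skeleton $\Omega_{(d)}=\Sigma$ and $\tilde H_{d+1}(\Omega;\mathbb{Z})=\tilde H_d(\Omega;\mathbb{Z})=0$.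 The cocritical group (with respect to $\Omega$) is $K^*(\Sigma)=C_{d+1}(\Omega;\mathbb{Z})/\operatorname{im}(\partial_{d+1}^*\partial_{d+1})$, where $\partial_{d+1}=\partial_{d+1}(\Omega)$. *)

theory Defs
  imports "HOL-Homology.Homology" "Jordan_Normal_Form.Matrix_Kernel"
begin

section \<open>Finite CW complexes\<close>

definition disc :: "nat \<Rightarrow> (nat \<Rightarrow> real) topology" where
  "disc m = subtopology (Euclidean_space m) {x. (\<Sum>i<m. (x i)\<^sup>2) \<le> 1}"

definition disc_interior :: "nat \<Rightarrow> (nat \<Rightarrow> real) set" where
  "disc_interior m = {x \<in> topspace (Euclidean_space m). (\<Sum>i<m. (x i)\<^sup>2) < 1}"

definition disc_boundary :: "nat \<Rightarrow> (nat \<Rightarrow> real) set" where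
  "disc_boundary m = {x \<in> topspace (Euclidean_space m). (\<Sum>i<m. (x i)\<^sup>2) = 1}"

text \<open>The cells of dimension \<open>m\<close> are numbered \<open>0, \<dots>, cw_count X m - 1\<close>, and
  \<open>cw_char X m k\<close> is the characteristic map of the \<open>k\<close>-th of them. The orientation of a cell is
  carried by its characteristic map: precomposing with a reflection of the disc reverses it.\<close>

record 'a cw_complex =
  cw_space :: "'a topology"
  cw_count :: "nat \<Rightarrow> nat"
  cw_char :: "nat \<Rightarrow> nat \<Rightarrow> (nat \<Rightarrow> real) \<Rightarrow> 'a"

definition open_cell :: "'a cw_complex \<Rightarrow> nat \<Rightarrow> nat \<Rightarrow> 'a set" where
  "open_cell X m k = cw_char X m k ` disc_interior m"

definition skeleton :: "'a cw_complex \<Rightarrow> int \<Rightarrow> 'a set" where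
  "skeleton X i = (\<Union>m\<in>{m. int m \<le> i}. \<Union>k<cw_count X m. open_cell X m k)"

text \<open>For finitely many cells the weak topology condition is automatic, since the closed cells
  are compact and the space is Hausdorff.\<close>

definition finite_cw_complex :: "'a cw_complex \<Rightarrow> bool" where
  "finite_cw_complex X \<longleftrightarrow>
     Hausdorff_space (cw_space X) \<and>
     finite {m. cw_count X m > 0} \<and>
     (\<forall>m. \<forall>k<cw_count X m.
        continuous_map (disc m) (cw_space X) (cw_char X m k) \<and>
        embedding_map (subtopology (disc m) (disc_interior m)) (cw_space X) (cw_char X m k) \<and>
        cw_char X m k ` disc_boundary m \<subseteq> skeleton X (int m - 1)) \<and>
     (\<forall>m. \<forall>k<cw_count X m. \<forall>m'. \<forall>k'<cw_count X m'.
        (m, k) \<noteq> (m', k') \<longrightarrow> open_cell X m k \<inter> open_cell X m' k' = {}) \<and>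
     (\<Union>m. \<Union>k<cw_count X m. open_cell X m k) = topspace (cw_space X)"

text \<open>By convention there is exactly one cell of dimension \<open>-1\<close>.\<close>

definition num_cells :: "'a cw_complex \<Rightarrow> int \<Rightarrow> nat" where
  "num_cells X i = (if i \<ge> 0 then cw_count X (nat i) else if i = -1 then 1 else 0)"

definition cw_dim :: "'a cw_complex \<Rightarrow> int" where
  "cw_dim X = Max {i. num_cells X i > 0}"

text \<open>\<open>is_skeleton X Y i\<close>: \<open>X\<close> is the \<open>i\<close>-skeleton of \<open>Y\<close>, including
  the cells, their numbering and their orientations.\<close>

definition is_skeleton :: "'a cw_complex \<Rightarrow> 'a cw_complex \<Rightarrow> int \<Rightarrow> bool" where
  "is_skeleton X Y i \<longleftrightarrow>
     cw_space X = subtopology (cw_space Y) (skeleton Y i) \<and>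
     (\<forall>m. cw_count X m = (if int m \<le> i then cw_count Y m else 0)) \<and>
     (\<forall>m. \<forall>k<cw_count X m. \<forall>x\<in>topspace (disc m). cw_char X m k x = cw_char Y m k x)"


section \<open>The reduced cellular chain complex\<close>

text \<open>One generator of \<open>H\<^sub>m(D\<^sup>m, S\<^sup>m\<^sup>-\<^sup>1) \<cong> \<int>\<close> is fixed in each dimension.\<close>

definition disc_class :: "nat \<Rightarrow> (nat \<Rightarrow> real) chain set" where
  "disc_class m = (SOME g. g \<in> carrier (relative_homology_group (int m) (disc m) (disc_boundary m)) \<and>
     generate (relative_homology_group (int m) (disc m) (disc_boundary m)) {g} =
     carrier (relative_homology_group (int m) (disc m) (disc_boundary m)))"

definition cell_chain_group :: "'a cw_complex \<Rightarrow> int \<Rightarrow> 'a chain set monoid" where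
  "cell_chain_group X i =
     relative_homology_group i (subtopology (cw_space X) (skeleton X i)) (skeleton X (i - 1))"

definition cell_class :: "'a cw_complex \<Rightarrow> int \<Rightarrow> nat \<Rightarrow> 'a chain set" where
  "cell_class X i k =
     hom_induced i (disc (nat i)) (disc_boundary (nat i))
       (subtopology (cw_space X) (skeleton X i)) (skeleton X (i - 1))
       (cw_char X (nat i) k) (disc_class (nat i))"

text \<open>The matrix of the cellular boundary map \<open>\<partial>\<^sub>i\<close>. For \<open>i \<ge> 1\<close> it is the matrix of
  \<open>H\<^sub>i(X\<^sub>i, X\<^sub>i\<^sub>-\<^sub>1) \<rightarrow> H\<^sub>i\<^sub>-\<^sub>1(X\<^sub>i\<^sub>-\<^sub>1, X\<^sub>i\<^sub>-\<^sub>2)\<close> with respect to the bases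
  given by the cells; \<open>\<partial>\<^sub>0\<close> is the augmentation, sending each vertex to the
  \<open>-1\<close>-cell.\<close>

definition cell_boundary :: "'a cw_complex \<Rightarrow> int \<Rightarrow> int mat" where
  "cell_boundary X i =
     (if i \<ge> 1 then
        (THE A. A \<in> carrier_mat (num_cells X (i - 1)) (num_cells X i) \<and>
           (\<forall>k<num_cells X i.
              hom_relboundary i (subtopology (cw_space X) (skeleton X i))
                (skeleton X (i - 1)) (skeleton X (i - 2)) (cell_class X i k) =
              finprod (cell_chain_group X (i - 1))
                (\<lambda>j. cell_class X (i - 1) j [^]\<^bsub>cell_chain_group X (i - 1)\<^esub> (A $$ (j, k)))
                {..<num_cells X (i - 1)}))
      else if i = 0 then mat 1 (num_cells X 0) (\<lambda>_. 1)
      else 0\<^sub>m (num_cells X (i - 1)) (num_cells X i))"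

definition vec_group :: "nat \<Rightarrow> 'b::comm_ring_1 vec set \<Rightarrow> 'b vec monoid" where
  "vec_group n L = \<lparr>carrier = L, monoid.mult = (+), one = 0\<^sub>v n\<rparr>"

definition mat_image :: "'b::comm_ring_1 mat \<Rightarrow> 'b vec set" where
  "mat_image A = (\<lambda>v. A *\<^sub>v v) ` carrier_vec (dim_col A)"

definition reduced_cellular_homology :: "'a cw_complex \<Rightarrow> int \<Rightarrow> int vec set monoid" where
  "reduced_cellular_homology X i =
     vec_group (num_cells X i) (mat_kernel (cell_boundary X i)) Mod mat_image (cell_boundary X (i + 1))"


section \<open>Lattices, torsion, acyclizations\<close>

definition cut_lattice :: "'a cw_complex \<Rightarrow> int vec set" where
  "cut_lattice X = mat_image (transpose_mat (cell_boundary X (cw_dim X)))"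

definition flow_lattice :: "'a cw_complex \<Rightarrow> int vec set" where
  "flow_lattice X = mat_kernel (cell_boundary X (cw_dim X))"

definition real_lattice :: "int vec set \<Rightarrow> real vec set" where
  "real_lattice L = map_vec of_int ` L"

text \<open>For \<open>L \<subseteq> \<real>\<^sup>n\<close>, \<open>L \<otimes> \<real>\<close> is the real span of \<open>L\<close>.\<close>

definition dual_lattice :: "nat \<Rightarrow> real vec set \<Rightarrow> real vec set" where
  "dual_lattice n L =
     {v \<in> LinearCombinations.module.span class_ring (module_vec TYPE(real) n) L.
        \<forall>w\<in>L. scalar_prod v w \<in> \<int>}"

definition discriminant_group :: "nat \<Rightarrow> real vec set \<Rightarrow> real vec set monoid" where
  "discriminant_group n L = vec_group n (dual_lattice n L) Mod L"

definition torsion_subgroup :: "('b, 'c) monoid_scheme \<Rightarrow> ('b, 'c) monoid_scheme" where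
  "torsion_subgroup G =
     G\<lparr>carrier := {x \<in> carrier G. \<exists>m::nat. m > 0 \<and> x [^]\<^bsub>G\<^esub> m = \<one>\<^bsub>G\<^esub>}\<rparr>"

text \<open>\<open>0 \<rightarrow> A \<rightarrow> B \<rightarrow> C \<rightarrow> 0\<close>. The library's \<open>short_exact_sequence\<close> requires all groups to
  have the same element type.\<close>

definition short_exact ::
  "('a, 'u) monoid_scheme \<Rightarrow> ('a \<Rightarrow> 'b) \<Rightarrow> ('b, 'v) monoid_scheme \<Rightarrow> ('b \<Rightarrow> 'c) \<Rightarrow>
   ('c, 'w) monoid_scheme \<Rightarrow> bool" where
  "short_exact A f B g C \<longleftrightarrow> group A \<and> group B \<and> group C \<and>
     f \<in> mon A B \<and> g \<in> epi B C \<and> f ` carrier A = Coset.kernel B C g"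

text \<open>Finiteness of \<open>Y\<close> is no restriction: \<open>H\<^sub>d\<^sub>+\<^sub>1(Y) = 0\<close> bounds the number of
  top-dimensional cells by the rank of \<open>C\<^sub>d\<close>.\<close>

definition acyclization :: "'a cw_complex \<Rightarrow> 'a cw_complex \<Rightarrow> bool" where
  "acyclization Y X \<longleftrightarrow>
     finite_cw_complex Y \<and> cw_dim Y = cw_dim X + 1 \<and> is_skeleton X Y (cw_dim X) \<and>
     trivial_group (reduced_cellular_homology Y (cw_dim X + 1)) \<and>
     trivial_group (reduced_cellular_homology Y (cw_dim X))"

definition cocritical_group :: "'a cw_complex \<Rightarrow> 'a cw_complex \<Rightarrow> int vec set monoid" where
  "cocritical_group X Y =
     (let A = cell_boundary Y (cw_dim X + 1); m = num_cells Y (cw_dim X + 1)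
      in vec_group m (carrier_vec m) Mod mat_image (transpose_mat A * A))"

end

theory Submission
  imports Defs
begin

text \<open>The group \<open>H\<^sub>i(X\<^sub>i, X\<^sub>i\<^sub>-\<^sub>1)\<close> is free on the characteristic maps of the \<open>i\<close>-cells: cells are attached
  one at a time, and the characteristic map of a single cell induces an isomorphism of relative homology
  groups by puncturing the cell, excising the base and comparing open cells. This makes the boundary matrices
  meaningful and gives \<open>\<partial>\<^sub>i\<^sub>-\<^sub>1 \<partial>\<^sub>i = 0\<close>; the rest is linear algebra over \<open>D = \<partial>\<^sub>d\<close>.

  Orthogonal projection onto \<open>\<F> \<otimes> \<real>\<close> maps \<open>\<int>\<^sup>n\<close> onto \<open>\<F>\<^sup>\<sharp>\<close>, because \<open>\<F> = ker D\<close> is a direct summand of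
  \<open>\<int>\<^sup>n\<close>. Modulo \<open>\<C> \<oplus> \<F>\<close> the kernel is the torsion of the cokernel of \<open>D\<^sup>T\<close>. By a diagonal form of \<open>D\<close> this
  is isomorphic to the torsion of the cokernel of \<open>D\<close>, which is the torsion of \<open>H\<^sub>d\<^sub>-\<^sub>1\<close>. For an acyclization
  with boundary matrix \<open>A\<close>, the map \<open>A : \<int>\<^sup>k \<rightarrow> \<F>\<close> is an isomorphism, and \<open>u \<mapsto> A\<^sup>T u\<close> carries \<open>\<F>\<^sup>\<sharp>\<close> onto \<open>\<int>\<^sup>k\<close>
  and \<open>\<F>\<close> onto the image of \<open>A\<^sup>T A\<close>.\<close>

section \<open>Attaching a cell\<close>

text \<open>The boundary matrices of positive degree are given by a definite description, so nothing
  can be said about them before the cells are known to form a basis. A characteristic map is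
  guaranteed injective only on the open disc; hence the comparison with the disc is made away from
  the boundary, after puncturing has thickened the base to an open set that excision can handle.

  On the algebraic side, the integer vectors that project to zero are those orthogonal to
  \<open>\<F>\<close>, and they form the saturation of \<open>\<C>\<close>: a fixed multiple of each
  lies in \<open>\<C>\<close>. This is where torsion enters. Passing from the cokernel of
  \<open>D\<close> to homology is harmless, because \<open>k x\<close> in the kernel of the next
  boundary matrix puts \<open>x\<close> there too. The normal form asserts only that every nonzero
  entry is alone in its row and column; the transposed 0/1 pattern of such a matrix intertwines it
  with its transpose. All of \<open>M\<close>, \<open>N\<close>, \<open>U\<close>, \<open>V\<close>,
  \<open>E\<close>, \<open>W\<close> come from this one normal form, and the group theory afterwards
  rests on the identities between them.\<close>

definition sqnorm :: "nat \<Rightarrow> (nat \<Rightarrow> real) \<Rightarrow> real" where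
  "sqnorm m x = (\<Sum>i<m. (x i)\<^sup>2)"

lemma sqnorm_nonneg [simp]: "0 \<le> sqnorm m x"
  by (simp add: sqnorm_def sum_nonneg)

lemma sqnorm_scale: "sqnorm m (\<lambda>i. c * x i) = c\<^sup>2 * sqnorm m x"
  by (simp add: sqnorm_def power_mult_distrib sum_distrib_left)

lemma sqnorm_zero [simp]: "sqnorm m (\<lambda>i. 0) = 0"
  by (simp add: sqnorm_def)

lemma continuous_on_sqnorm [continuous_intros]: "continuous_on S (sqnorm m)"
proof -
  have "continuous_on S (\<lambda>x::nat\<Rightarrow>real. x i)" for i
    by (rule continuous_on_subset[OF continuous_on_product_coordinates]) simp
  then show ?thesis
    unfolding sqnorm_def by (intro continuous_intros)
qed

lemma topspace_disc: "topspace (disc m) = {x. (\<forall>i\<ge>m. x i = 0) \<and> sqnorm m x \<le> 1}"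
  by (auto simp: disc_def topspace_Euclidean_space sqnorm_def)

lemma disc_eq_top_of_set: "disc m = top_of_set {x. (\<forall>i\<ge>m. x i = 0) \<and> sqnorm m x \<le> 1}"
  by (simp add: disc_def Euclidean_space_def subtopology_subtopology euclidean_product_topology
      Collect_conj_eq sqnorm_def Int_commute)

lemma disc_interior_eq: "disc_interior m = {x. (\<forall>i\<ge>m. x i = 0) \<and> sqnorm m x < 1}"
  by (auto simp: disc_interior_def topspace_Euclidean_space sqnorm_def)

lemma disc_boundary_eq: "disc_boundary m = {x. (\<forall>i\<ge>m. x i = 0) \<and> sqnorm m x = 1}"
  by (auto simp: disc_boundary_def topspace_Euclidean_space sqnorm_def)

lemma disc_Un: "disc_interior m \<union> disc_boundary m = topspace (disc m)"
  by (auto simp: disc_interior_eq disc_boundary_eq topspace_disc)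

lemma disc_Int: "disc_interior m \<inter> disc_boundary m = {}"
  by (auto simp: disc_interior_eq disc_boundary_eq)

lemma sqnorm_eq_0_iff: "(\<forall>i\<ge>m. x i = 0) \<Longrightarrow> sqnorm m x = 0 \<longleftrightarrow> x = (\<lambda>i. 0)"
  by (auto simp: sqnorm_def sum_nonneg_eq_0_iff fun_eq_iff) (metis lessThan_iff not_le)

lemma Hausdorff_disc: "Hausdorff_space (disc m)"
  unfolding disc_eq_top_of_set by (simp add: Hausdorff_space_subtopology)

text \<open>The disc sits in an infinite product of lines, so compactness comes from Tychonoff: it
  is a closed subset of a product of intervals whose factors beyond coordinate \<open>m\<close> are
  the single point 0.\<close>

lemma compact_disc: "compact_space (disc m)"
proof -
  let ?D = "{x::nat\<Rightarrow>real. (\<forall>i\<ge>m. x i = 0) \<and> sqnorm m x \<le> 1}"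
  let ?K = "PiE UNIV (\<lambda>i. if i < m then {-1..1} else {0::real})"
  have "compactin (powertop_real UNIV) ?K"
    unfolding compactin_PiE by simp
  then have K: "compact ?K"
    by (metis compactin_euclidean_iff euclidean_product_topology)
  have sub: "?D \<subseteq> ?K"
  proof
    fix x assume x: "x \<in> ?D"
    have "\<bar>x i\<bar> \<le> 1" if "i < m" for i
    proof -
      have "(x i)\<^sup>2 \<le> sqnorm m x"
        unfolding sqnorm_def by (rule member_le_sum) (use that in auto)
      then have "(x i)\<^sup>2 \<le> 1" using x by auto
      then show ?thesis by (simp add: abs_square_le_1)
    qed
    then show "x \<in> ?K" using x by (auto simp: abs_le_iff minus_le_iff)
  qed
  have "closed {x::nat\<Rightarrow>real. x i = 0}" for i
    by (rule closed_Collect_eq) (auto simp: continuous_on_product_coordinates)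
  then have "closed (\<Inter>i\<in>{m..}. {x::nat\<Rightarrow>real. x i = 0})" by blast
  then have "closed ((\<Inter>i\<in>{m..}. {x::nat\<Rightarrow>real. x i = 0}) \<inter> {x. sqnorm m x \<le> 1})"
    by (intro closed_Int closed_Collect_le continuous_on_sqnorm continuous_on_const)
  also have "(\<Inter>i\<in>{m..}. {x. x i = 0}) \<inter> {x. sqnorm m x \<le> 1} = ?D" by auto
  finally have "compact (?D \<inter> ?K)"
    using K by (rule closed_Int_compact)
  then have "compact ?D" using sub by (simp add: Int_absorb2)
  then show ?thesis
    unfolding disc_eq_top_of_set by (simp add: compact_space_subtopology)
qed

lemma zero_in_disc_interior: "(\<lambda>i. 0) \<in> disc_interior m"
  by (simp add: disc_interior_eq)

section \<open>Radial retraction of the punctured disc onto its boundary\<close>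

definition punctured_disc :: "nat \<Rightarrow> (nat \<Rightarrow> real) set" where
  "punctured_disc m = topspace (disc m) - {\<lambda>i. 0}"

text \<open>The straight-line homotopy from the radial projection \<open>x / |x|\<close> at time 0
  to the identity at time 1. Written as a scalar multiple of \<open>x\<close>, it has norm
  \<open>1 - t + t |x|\<close>, which stays in the interval from 0 (excluded) to 1.\<close>

definition radial :: "nat \<Rightarrow> real \<times> (nat \<Rightarrow> real) \<Rightarrow> nat \<Rightarrow> real" where
  "radial m = (\<lambda>(t, x) i. ((1 - t) / sqrt (sqnorm m x) + t) * x i)"

lemma radial_1 [simp]: "radial m (1, x) = x"
  by (simp add: radial_def)

lemma radial_boundary: "x \<in> disc_boundary m \<Longrightarrow> radial m (t, x) = x"
  by (simp add: radial_def disc_boundary_eq)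

lemma punctured_disc_sqnorm: "x \<in> punctured_disc m \<Longrightarrow> sqnorm m x > 0"
  using sqnorm_nonneg[of m x] sqnorm_eq_0_iff[of m x]
  by (auto simp: punctured_disc_def topspace_disc less_le)

lemma sqnorm_radial:
  assumes "sqnorm m x > 0"
  shows "sqnorm m (radial m (t, x)) = (1 - t + t * sqrt (sqnorm m x))\<^sup>2"
proof -
  have "sqnorm m (radial m (t, x)) = ((1 - t) / sqrt (sqnorm m x) + t)\<^sup>2 * (sqrt (sqnorm m x))\<^sup>2"
    by (simp add: radial_def sqnorm_scale)
  also have "\<dots> = (((1 - t) / sqrt (sqnorm m x) + t) * sqrt (sqnorm m x))\<^sup>2"
    by (simp add: power_mult_distrib)
  also have "((1 - t) / sqrt (sqnorm m x) + t) * sqrt (sqnorm m x) = 1 - t + t * sqrt (sqnorm m x)"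
    using assms by (simp add: field_simps)
  finally show ?thesis .
qed

lemma radial_in_punctured:
  assumes "x \<in> punctured_disc m" "t \<in> {0..1}"
  shows "radial m (t, x) \<in> punctured_disc m"
proof -
  let ?r = "sqrt (sqnorm m x)"
  have r: "0 < ?r" "?r \<le> 1"
    using punctured_disc_sqnorm[OF assms(1)] assms(1) by (auto simp: punctured_disc_def topspace_disc)
  have le: "1 - t + t * ?r \<le> 1" using r assms(2) by (simp add: mult_left_le)
  have gt: "1 - t + t * ?r > 0"
    using r assms(2) by (cases "t = 1") (auto intro!: add_pos_nonneg)
  have n: "sqnorm m (radial m (t, x)) = (1 - t + t * ?r)\<^sup>2"
    using sqnorm_radial[OF punctured_disc_sqnorm[OF assms(1)]] .
  have "sqnorm m (radial m (t, x)) \<le> 1" "sqnorm m (radial m (t, x)) \<noteq> 0"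
    unfolding n using le gt by (auto simp: abs_square_le_1)
  moreover have "\<forall>i\<ge>m. radial m (t, x) i = 0"
    using assms(1) by (simp add: radial_def punctured_disc_def topspace_disc)
  ultimately show ?thesis by (auto simp: punctured_disc_def topspace_disc)
qed

lemma radial_0_in_boundary:
  assumes "x \<in> punctured_disc m"
  shows "radial m (0, x) \<in> disc_boundary m"
  using sqnorm_radial[OF punctured_disc_sqnorm[OF assms], of 0] assms
  by (auto simp: disc_boundary_eq radial_def punctured_disc_def topspace_disc)

lemma continuous_map_radial:
  "continuous_map (prod_topology (top_of_set {0..1}) (subtopology (disc m) (punctured_disc m)))
     (subtopology (disc m) (punctured_disc m)) (radial m)"
proof -
  let ?P = "punctured_disc m"
  have P: "subtopology (disc m) ?P = top_of_set ?P"
    by (simp add: disc_eq_top_of_set subtopology_subtopology punctured_disc_def topspace_disc Int_absorb1 Collect_mono)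
  have "continuous_on ({0..1} \<times> ?P) (\<lambda>z. ((1 - fst z) / sqrt (sqnorm m (snd z)) + fst z) * snd z i)" for i
  proof -
    have 1: "continuous_on ({0..1} \<times> ?P) (\<lambda>z. sqnorm m (snd z))"
      by (rule continuous_on_compose2[OF continuous_on_sqnorm[of UNIV]]) (auto intro: continuous_intros)
    have 2: "continuous_on ({0..1} \<times> ?P) (\<lambda>z. snd z i)"
      by (rule continuous_on_compose2[OF continuous_on_product_coordinates, where f = snd]) (auto intro: continuous_intros)
    show ?thesis
      using punctured_disc_sqnorm by (intro continuous_intros 1 2) fastforce
  qed
  then have "continuous_on ({0..1} \<times> ?P) (radial m)"
    by (intro continuous_on_coordinatewise_then_product) (simp only: radial_def case_prod_unfold)
  moreover have "radial m ` ({0..1} \<times> ?P) \<subseteq> ?P"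
    using radial_in_punctured by auto
  ultimately show ?thesis
    by (simp add: P continuous_map_in_subtopology image_subset_iff_funcset)
qed

text \<open>The time-0 map retracts \<open>S\<close> onto \<open>T\<close> and is homotopic within
  \<open>S\<close> to the identity, so every relative group of \<open>(S, T)\<close> vanishes. In
  the exact sequence of the triple \<open>(X, S, T)\<close> these are the two outer terms, and the
  middle map is an isomorphism.\<close>

lemma iso_hom_induced_relativization_retract:
  assumes "T \<subseteq> S" "S \<subseteq> topspace X"
    and h: "continuous_map (prod_topology (top_of_set {0..1}) (subtopology X S)) (subtopology X S) h"
    and h0: "\<And>x. x \<in> S \<Longrightarrow> h (0::real, x) \<in> T"
    and h1: "\<And>x. x \<in> S \<Longrightarrow> h (1, x) = x"
    and hT: "\<And>x. x \<in> T \<Longrightarrow> h (0, x) = x"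
  shows "hom_induced p X T X S id \<in> iso (relative_homology_group p X T) (relative_homology_group p X S)"
proof -
  have triv: "trivial_group (relative_homology_group q (subtopology X S) T)" for q
  proof (rule trivial_relative_homology_group_gen)
    let ?f = "\<lambda>x. h (0, x)"
    have ST: "subtopology (subtopology X S) T = subtopology X T"
      using assms(1) by (simp add: subtopology_subtopology Int_absorb1)
    have "continuous_map (subtopology X S) (prod_topology (top_of_set {0..1}) (subtopology X S)) (\<lambda>x. (0::real, x))"
      by (intro continuous_map_pairedI) auto
    from continuous_map_compose[OF this h]
    have c: "continuous_map (subtopology X S) (subtopology X S) ?f" by (simp add: o_def)
    then show c': "continuous_map (subtopology X S) (subtopology (subtopology X S) T) ?f"
      using h0 assms(2) by (auto simp: continuous_map_in_subtopology)
    show "homotopic_with (\<lambda>h. True) (subtopology (subtopology X S) T) (subtopology (subtopology X S) T) ?f id"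
    proof (rule homotopic_with_equal)
      show "continuous_map (subtopology (subtopology X S) T) (subtopology (subtopology X S) T) ?f"
        using c' continuous_map_from_subtopology by blast
    qed (auto simp: hT)
    show "homotopic_with (\<lambda>k. True) (subtopology X S) (subtopology X S) ?f id"
      using h h1 assms(2) by (subst homotopic_with) (auto intro!: exI[of _ h])
  qed
  show ?thesis
  proof (rule very_short_exact_sequence)
    show "exact_seq
         ([relative_homology_group(p - 1) (subtopology X S) T, relative_homology_group p X S, relative_homology_group p X T, relative_homology_group p (subtopology X S) T],
          [hom_relboundary p X S T, hom_induced p X T X S id, hom_induced p (subtopology X S) T X T id])"
      using homology_exactness_triple_1 [OF \<open>T \<subseteq> S\<close>] homology_exactness_triple_3 [OF \<open>T \<subseteq> S\<close>]
      by fastforce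
  qed (rule triv)+
qed


text \<open>\<open>Z\<close> is the closed set \<open>C\<close> with one \<open>m\<close>-cell glued
  on. The gluing topology is not postulated; it is recovered from compactness of the disc and the
  Hausdorff property, which make \<open>f\<close> a closed map.\<close>

locale cell_attachment =
  fixes m :: nat and Z :: "'a topology" and C :: "'a set" and f :: "(nat \<Rightarrow> real) \<Rightarrow> 'a"
  assumes Hausdorff: "Hausdorff_space Z"
    and closed_base: "closedin Z C"
    and cont: "continuous_map (disc m) Z f"
    and emb: "embedding_map (subtopology (disc m) (disc_interior m)) Z f"
    and boundary: "f ` disc_boundary m \<subseteq> C"
    and disjoint: "f ` disc_interior m \<inter> C = {}"
    and cover: "f ` disc_interior m \<union> C = topspace Z"
begin

definition punctured :: "'a set" where "punctured = topspace Z - {f (\<lambda>i. 0)}"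

lemma inj_interior: "inj_on f (disc_interior m)"
  using emb disc_Un[of m] unfolding embedding_map_def homeomorphic_map_def
  by (auto simp: inj_on_def topspace_subtopology injective_quotient_map)

lemma f_disc: "f ` topspace (disc m) \<subseteq> topspace Z"
  using cont continuous_map_image_subset_topspace by blast

lemma f_eqD:
  assumes "x \<in> topspace (disc m)" "y \<in> topspace (disc m)" "f x = f y" "x \<noteq> y"
  shows "x \<in> disc_boundary m \<and> y \<in> disc_boundary m"
  using assms inj_interior boundary disjoint disc_Un[of m] unfolding inj_on_def by fast

lemma f_punctured_iff: "x \<in> topspace (disc m) \<Longrightarrow> f x \<in> punctured \<longleftrightarrow> x \<in> punctured_disc m"
  using f_eqD[of x "\<lambda>i. 0"] f_disc disc_Un[of m] disc_Int[of m] zero_in_disc_interior[of m]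
  by (auto simp: punctured_def punctured_disc_def)

lemma base_subset_punctured: "C \<subseteq> punctured"
  using closedin_subset[OF closed_base] disjoint zero_in_disc_interior[of m]
  by (auto simp: punctured_def)

lemma punctured_subset: "punctured \<subseteq> topspace Z"
  by (auto simp: punctured_def)

text \<open>The map \<open>radial\<close> carried over to \<open>Z\<close>. The preimage is taken in
  the open disc, where \<open>f\<close> is injective; keeping \<open>C\<close> fixed is consistent
  with this because \<open>radial\<close> fixes the boundary sphere.\<close>

definition push :: "real \<times> 'a \<Rightarrow> 'a" where
  "push = (\<lambda>(t, z). if z \<in> C then z else f (radial m (t, inv_into (disc_interior m) f z)))"

lemma push_f:
  assumes "x \<in> punctured_disc m"
  shows "push (t, f x) = f (radial m (t, x))"
proof (cases "x \<in> disc_interior m")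
  case True
  then show ?thesis
    using disjoint inj_interior by (auto simp: push_def)
next
  case False
  then have "x \<in> disc_boundary m" using assms disc_Un[of m] by (auto simp: punctured_disc_def)
  then show ?thesis using boundary by (auto simp: push_def radial_boundary)
qed

lemma punctured_cases:
  assumes "z \<in> punctured"
  obtains "z \<in> C" | x where "x \<in> punctured_disc m" "z = f x"
proof -
  consider "z \<in> C" | x where "x \<in> disc_interior m" "z = f x"
    using assms cover punctured_subset by blast
  then show thesis
  proof cases
    case (2 x)
    then have "x \<in> topspace (disc m)" using disc_Un[of m] by blast
    then show thesis using that(2)[of x] f_punctured_iff[of x] 2 assms by simp
  qed (rule that(1))
qed

text \<open>The base and the closed cell are two closed pieces covering \<open>Z\<close>, so
  continuity is checked on each. On the cell, \<open>push\<close> composed with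
  \<open>id \<times> f\<close> equals \<open>f \<circ> radial m\<close>, which is continuous, and
  \<open>id \<times> f\<close> is a quotient map onto that piece.\<close>

lemma continuous_push:
  "continuous_map (prod_topology (top_of_set {0..1}) (subtopology Z punctured)) (subtopology Z punctured) push"
proof -
  let ?I = "top_of_set {0..1::real}"
  let ?W = "prod_topology ?I (subtopology Z punctured)"
  let ?K = "f ` topspace (disc m)"
  let ?P = "subtopology (disc m) (punctured_disc m)"
  have W: "?W = subtopology (prod_topology ?I Z) ({0..1} \<times> punctured)"
    by (simp add: prod_topology_subtopology)
  have topW: "topspace ?W = {0..1} \<times> punctured"
    using punctured_subset by auto
  have K: "closedin Z ?K"
    using compact_disc cont Hausdorff
    by (metis compact_space_def compactin_imp_closedin image_compactin)
  have cl: "closedin ?W ({0..1} \<times> (punctured \<inter> A))" if "closedin Z A" for A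
  proof -
    have "closedin (subtopology Z punctured) (punctured \<inter> A)"
      using that by (metis closedin_subtopology_Int_closed)
    then show ?thesis by (simp add: closedin_prod_Times_iff)
  qed
  have "continuous_map ?W (subtopology Z punctured) (\<lambda>z. if snd z \<in> C then snd z else push z)"
  proof (rule pasting_lemma_closed[where I = "{True, False}" and X = ?W
        and T = "\<lambda>b. {0..1} \<times> (punctured \<inter> (if b then C else ?K))" and f = "\<lambda>b. if b then snd else push"])
    show "closedin ?W ({0..1} \<times> (punctured \<inter> (if b then C else ?K)))" for b
      using cl K closed_base by simp
    \<comment> \<open>The punctured disc is in general not compact. Closedness is therefore obtained
      on the full disc, from compact to Hausdorff, and then restricted to the whole preimage of the
      punctured cell, which preserves it.\<close>
    have q: "quotient_map (prod_topology ?I ?P) (subtopology ?W ({0..1} \<times> (punctured \<inter> ?K))) (\<lambda>(t, x). (t, f x))"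
    proof (rule continuous_closed_imp_quotient_map)
      have F: "continuous_map (prod_topology ?I (disc m)) (prod_topology ?I Z) (\<lambda>(t, x). (t, f x))"
        using continuous_map_prod_top[of ?I "disc m" ?I Z id f] cont by simp
      have "compact_space (prod_topology ?I (disc m))"
        by (simp add: compact_space_prod_topology compact_disc compact_space_subtopology)
      moreover have "Hausdorff_space (prod_topology ?I Z)"
        using Hausdorff by (simp add: Hausdorff_space_prod_topology Hausdorff_space_subtopology)
      ultimately have c: "closed_map (prod_topology ?I (disc m)) (prod_topology ?I Z) (\<lambda>(t, x). (t, f x))"
        using F continuous_imp_closed_map by blast
      have eq: "{p \<in> topspace (prod_topology ?I (disc m)). (case p of (t, x) \<Rightarrow> (t, f x)) \<in> {0..1} \<times> (punctured \<inter> ?K)}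
         = {0..1} \<times> punctured_disc m"
        using f_punctured_iff by (auto simp: punctured_disc_def)
      have dom: "subtopology (prod_topology ?I (disc m)) ({0..1} \<times> punctured_disc m) = prod_topology ?I ?P"
        by (simp add: prod_topology_subtopology)
      have cod: "subtopology (prod_topology ?I Z) ({0..1} \<times> (punctured \<inter> ?K)) = subtopology ?W ({0..1} \<times> (punctured \<inter> ?K))"
        unfolding W subtopology_subtopology by (rule arg_cong) auto
      show "closed_map (prod_topology ?I ?P) (subtopology ?W ({0..1} \<times> (punctured \<inter> ?K))) (\<lambda>(t, x). (t, f x))"
        using closed_map_restriction[OF c eq] unfolding dom cod .
      have sub: "(\<lambda>(t, x). (t, f x)) ` ({0..1} \<times> punctured_disc m) = {0..1} \<times> (punctured \<inter> ?K)"
        using f_punctured_iff by (auto simp: punctured_disc_def image_iff)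
      have "continuous_map (prod_topology ?I ?P) (prod_topology ?I Z) (\<lambda>(t, x). (t, f x))"
        unfolding dom[symmetric] using F by (rule continuous_map_from_subtopology)
      then show "continuous_map (prod_topology ?I ?P) (subtopology ?W ({0..1} \<times> (punctured \<inter> ?K))) (\<lambda>(t, x). (t, f x))"
        unfolding cod[symmetric] continuous_map_in_subtopology
        using f_punctured_iff by (auto simp: punctured_disc_def)
      show "(\<lambda>(t, x). (t, f x)) ` topspace (prod_topology ?I ?P) = topspace (subtopology ?W ({0..1} \<times> (punctured \<inter> ?K)))"
      proof -
        have "topspace (prod_topology ?I ?P) = {0..1} \<times> punctured_disc m"
          by (auto simp: punctured_disc_def)
        moreover have "topspace (subtopology ?W ({0..1} \<times> (punctured \<inter> ?K))) = {0..1} \<times> (punctured \<inter> ?K)"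
          using topW by auto
        ultimately show ?thesis using sub by simp
      qed
    qed
    have "continuous_map (subtopology ?W ({0..1} \<times> (punctured \<inter> ?K))) (subtopology Z punctured) push"
    proof (rule continuous_compose_quotient_map[OF q])
      have "f ` punctured_disc m \<subseteq> punctured"
        using f_punctured_iff by (auto simp: punctured_disc_def)
      then have "continuous_map ?P (subtopology Z punctured) f"
        using cont by (auto simp: continuous_map_in_subtopology continuous_map_from_subtopology)
      then have "continuous_map (prod_topology ?I ?P) (subtopology Z punctured) (f \<circ> radial m)"
        by (rule continuous_map_compose[OF continuous_map_radial])
      then show "continuous_map (prod_topology ?I ?P) (subtopology Z punctured) (push \<circ> (\<lambda>(t, x). (t, f x)))"
        by (rule continuous_map_eq) (auto simp: push_f)
    qed
    then show "continuous_map (subtopology ?W ({0..1} \<times> (punctured \<inter> (if b then C else ?K)))) (subtopology Z punctured)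
        (if b then snd else push)" for b
      by (auto intro: continuous_map_from_subtopology continuous_map_snd)
    show "(if i then snd else push) x = (if j then snd else push) x"
      if "x \<in> topspace ?W \<inter> {0..1} \<times> (punctured \<inter> (if i then C else ?K)) \<inter> {0..1} \<times> (punctured \<inter> (if j then C else ?K))" for i j x
      using that by (auto simp: push_def split: if_splits)
    show "\<exists>j. j \<in> {True, False} \<and> x \<in> {0..1} \<times> (punctured \<inter> (if j then C else ?K)) \<and>
        (if snd x \<in> C then snd x else push x) = (if j then snd else push) x" if "x \<in> topspace ?W" for x
    proof (cases "snd x \<in> C")
      case True
      moreover have "x \<in> {0..1} \<times> punctured" using that topW by simp
      ultimately show ?thesis by (intro exI[of _ True]) auto
    next
      case False
      have x: "x \<in> {0..1} \<times> punctured" using that topW by simp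
      then have "snd x \<in> topspace Z" using punctured_subset by auto
      then have "snd x \<in> f ` disc_interior m" using cover False by auto
      moreover have "f ` disc_interior m \<subseteq> ?K"
        unfolding disc_Un[symmetric] by (intro image_mono) simp
      ultimately have "snd x \<in> ?K" by (rule rev_subsetD)
      then show ?thesis using x False by (intro exI[of _ False]) (auto simp: mem_Times_iff)
    qed
  qed auto
  then show ?thesis
    by (rule continuous_map_eq) (auto simp: push_def)
qed

lemma iso_relativization_punctured:
  "hom_induced p Z C Z punctured id \<in> iso (relative_homology_group p Z C) (relative_homology_group p Z punctured)"
proof (rule iso_hom_induced_relativization_retract[OF base_subset_punctured punctured_subset continuous_push])
  fix x assume x: "x \<in> punctured"
  show "push (0, x) \<in> C"
    using x
  proof (cases rule: punctured_cases)
    case (2 y)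
    then show ?thesis using radial_0_in_boundary[of y m] boundary by (auto simp: push_f)
  qed (simp add: push_def)
  show "push (1, x) = x"
    using x by (cases rule: punctured_cases) (simp_all add: push_f, simp add: push_def)
qed (simp add: push_def)

end

text \<open>The disc is itself a cell attached to its own boundary sphere. Hence the statements
  about \<open>Z\<close> hold for the disc as well and provide both vertical sides of the comparison
  squares below.\<close>

lemma cell_attachment_disc: "cell_attachment m (disc m) (disc_boundary m) id"
proof
  have "closed {x::nat\<Rightarrow>real. sqnorm m x = 1}"
    by (intro closed_Collect_eq continuous_on_sqnorm continuous_on_const)
  then have "closedin (disc m) (topspace (disc m) \<inter> {x. sqnorm m x = 1})"
    unfolding disc_eq_top_of_set by (simp add: closedin_closed_Int)
  moreover have "topspace (disc m) \<inter> {x. sqnorm m x = 1} = disc_boundary m"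
    by (auto simp: topspace_disc disc_boundary_eq)
  ultimately show "closedin (disc m) (disc_boundary m)" by simp
qed (use disc_Un[of m] disc_Int[of m] in \<open>auto simp: Hausdorff_disc embedding_map_def intro!: arg_cong[where f = "subtopology (disc m)"]\<close>)

context cell_attachment
begin

text \<open>Excision asks for the closure of the excised set to lie in the interior of the larger
  one. The complement of a single point is open in a Hausdorff space and contains the closed base,
  so it can play the larger set.\<close>

lemma iso_excision:
  "hom_induced p (subtopology Z (topspace Z - C)) (punctured - C) Z punctured id \<in>
     iso (relative_homology_group p (subtopology Z (topspace Z - C)) (punctured - C)) (relative_homology_group p Z punctured)"
proof -
  have "f (\<lambda>i. 0) \<in> topspace Z"
    using cover zero_in_disc_interior[of m] by auto
  then have "closedin Z {f (\<lambda>i. 0)}"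
    using Hausdorff by (simp add: closedin_Hausdorff_singleton)
  then have "openin Z punctured"
    unfolding punctured_def by (rule openin_diff[OF openin_topspace])
  then have "Z closure_of C \<subseteq> Z interior_of punctured"
    using closed_base base_subset_punctured by (simp add: closure_of_closedin interior_of_openin)
  from homology_excision_axiom[OF this punctured_subset] show ?thesis by simp
qed

text \<open>On the open cells \<open>f\<close> is a homeomorphism. One naturality square, with the
  excision isomorphisms of disc and \<open>Z\<close> as sides, moves this to the pairs relative to
  the punctured sets; a second one, with the relativization isomorphisms as sides, moves it to the
  pairs relative to the boundary and the base.\<close>

lemma iso_hom_induced_attachment:
  "hom_induced p (disc m) (disc_boundary m) Z C f \<in>
     iso (relative_homology_group p (disc m) (disc_boundary m)) (relative_homology_group p Z C)"
proof -
  interpret D: cell_attachment m "disc m" "disc_boundary m" id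
    by (rule cell_attachment_disc)
  have D_punctured: "D.punctured = punctured_disc m"
    by (simp add: D.punctured_def punctured_disc_def)
  let ?H = "relative_homology_group p"
  let ?D = "disc m" and ?S = "disc_boundary m" and ?E = "punctured_disc m"
  let ?Do = "subtopology ?D (topspace ?D - ?S)" and ?Zo = "subtopology Z (topspace Z - C)"
  have int: "topspace ?D - ?S = disc_interior m" using disc_Un[of m] disc_Int[of m] by auto
  have ext: "topspace Z - C = f ` disc_interior m" using cover disjoint by auto
  have fE: "f ` ?E \<subseteq> punctured" using f_punctured_iff by (auto simp: punctured_disc_def)
  have fES: "f ` (?E - ?S) = punctured - C"
  proof -
    have "f ` (?E - ?S) = f ` (disc_interior m - {\<lambda>i. 0})"
      using disc_Un[of m] disc_Int[of m] by (auto simp: punctured_disc_def)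
    also have "\<dots> = f ` disc_interior m - {f (\<lambda>i. 0)}"
      using inj_on_image_set_diff[OF inj_interior, of "disc_interior m" "{\<lambda>i. 0}"] zero_in_disc_interior[of m] by auto
    also have "\<dots> = punctured - C" using ext by (auto simp: punctured_def)
    finally show ?thesis .
  qed
  have h: "hom_induced p ?Do (?E - ?S) ?Zo (punctured - C) f \<in> iso (?H ?Do (?E - ?S)) (?H ?Zo (punctured - C))"
  proof (rule homeomorphic_map_relative_homology_iso[OF _ _ fES])
    have "f ` topspace (subtopology ?D (disc_interior m)) = f ` disc_interior m" using disc_Un[of m] by auto
    then show "homeomorphic_map ?Do ?Zo f"
      using emb unfolding embedding_map_def int ext by simp
    show "?E - ?S \<subseteq> topspace ?Do" by (auto simp: punctured_disc_def)
  qed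
  have contS: "continuous_map ?Do ?Zo f"
    using cont continuous_map_from_subtopology disc_Un[of m] unfolding int ext by (auto simp: continuous_map_in_subtopology)
  have contI: "continuous_map ?Zo Z id" "continuous_map ?Do ?D id"
    by (auto intro: continuous_map_from_subtopology)
  note e1 = D.iso_excision[of p, unfolded D_punctured]
  note i1 = D.iso_relativization_punctured[of p, unfolded D_punctured]
  let ?f' = "hom_induced p ?D ?E Z punctured f"
  have c1: "hom_induced p ?Zo (punctured - C) Z punctured id \<circ> hom_induced p ?Do (?E - ?S) ?Zo (punctured - C) f
     = ?f' \<circ> hom_induced p ?Do (?E - ?S) ?D ?E id"
  proof -
    have "f \<in> (?E - ?S) \<rightarrow> punctured - C" using fES by blast
    then show ?thesis
      using contS contI cont fE by (simp flip: hom_induced_compose add: image_subset_iff_funcset)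
  qed
  have f': "?f' \<in> iso (?H ?D ?E) (?H Z punctured)"
  proof -
    have "hom_induced p ?Zo (punctured - C) Z punctured id \<circ> hom_induced p ?Do (?E - ?S) ?Zo (punctured - C) f \<in> iso (?H ?Do (?E - ?S)) (?H Z punctured)"
      using iso_set_trans[OF h iso_excision] .
    then show ?thesis unfolding c1 
      using e1 by (auto simp: iso_def hom_induced_hom bij_betw_comp_iff)
  qed
  have c2: "hom_induced p Z C Z punctured id \<circ> hom_induced p ?D ?S Z C f = ?f' \<circ> hom_induced p ?D ?S ?D ?E id"
  proof -
    have "f \<in> ?S \<rightarrow> C" "f \<in> ?E \<rightarrow> punctured" "id \<in> C \<rightarrow> punctured" "id \<in> ?S \<rightarrow> ?E"
      using boundary fE base_subset_punctured D.base_subset_punctured[unfolded D_punctured] by auto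
    then show ?thesis
      using cont by (simp flip: hom_induced_compose)
  qed
  have "hom_induced p Z C Z punctured id \<circ> hom_induced p ?D ?S Z C f \<in> iso (?H ?D ?S) (?H Z punctured)"
    unfolding c2 using iso_set_trans[OF i1 f'] .
  moreover have "hom_induced p ?D ?S Z C f ` carrier (?H ?D ?S) \<subseteq> carrier (?H Z C)"
    using hom_induced_carrier by fast
  ultimately have "bij_betw (hom_induced p ?D ?S Z C f) (carrier (?H ?D ?S)) (carrier (?H Z C))"
    using iso_relativization_punctured[of p] bij_betw_comp_iff2 unfolding iso_def by blast
  then show ?thesis by (simp add: iso_def hom_induced_hom)
qed

end

section \<open>Free bases of abelian groups\<close>

definition int_comb :: "('b, 'c) monoid_scheme \<Rightarrow> 'i set \<Rightarrow> ('i \<Rightarrow> 'b) \<Rightarrow> ('i \<Rightarrow> int) \<Rightarrow> 'b" where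
  "int_comb G S b a = finprod G (\<lambda>i. b i [^]\<^bsub>G\<^esub> a i) S"

text \<open>Coefficients are total functions of which only the values on \<open>S\<close> count, so
  independence is asserted on \<open>S\<close> alone. Homology groups are written multiplicatively:
  combinations are products of integer powers.\<close>

definition free_basis :: "('b, 'c) monoid_scheme \<Rightarrow> 'i set \<Rightarrow> ('i \<Rightarrow> 'b) \<Rightarrow> bool" where
  "free_basis G S b \<longleftrightarrow> (\<forall>i\<in>S. b i \<in> carrier G) \<and>
     (\<forall>x\<in>carrier G. \<exists>a. x = int_comb G S b a) \<and>
     (\<forall>a. int_comb G S b a = \<one>\<^bsub>G\<^esub> \<longrightarrow> (\<forall>i\<in>S. a i = 0))"

context comm_group
begin

lemma int_comb_closed: "b \<in> S \<rightarrow> carrier G \<Longrightarrow> int_comb G S b a \<in> carrier G"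
  unfolding int_comb_def by (rule finprod_closed) (auto simp: Pi_iff)

lemma int_comb_add:
  "b \<in> S \<rightarrow> carrier G \<Longrightarrow> int_comb G S b (\<lambda>i. a i + a' i) = int_comb G S b a \<otimes> int_comb G S b a'"
  unfolding int_comb_def
  by (simp add: Pi_iff int_pow_mult flip: finprod_multf cong: finprod_cong)

lemma int_comb_cong:
  "b \<in> S \<rightarrow> carrier G \<Longrightarrow> (\<And>i. i \<in> S \<Longrightarrow> b i = b' i) \<Longrightarrow> (\<And>i. i \<in> S \<Longrightarrow> a i = a' i) \<Longrightarrow> int_comb G S b a = int_comb G S b' a'"
  unfolding int_comb_def by (rule finprod_cong') (auto simp: Pi_iff)

lemma int_comb_insert:
  "finite S \<Longrightarrow> k \<notin> S \<Longrightarrow> b \<in> insert k S \<rightarrow> carrier G \<Longrightarrow>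
    int_comb G (insert k S) b a = b k [^] a k \<otimes> int_comb G S b a"
  unfolding int_comb_def by (subst finprod_insert) (auto simp: Pi_iff)

lemma int_comb_pow:
  assumes "finite S" "b \<in> S \<rightarrow> carrier G"
  shows "int_comb G S b a [^] (c::int) = int_comb G S b (\<lambda>i. a i * c)"
  using assms
proof (induction S)
  case empty
  then show ?case by (simp add: int_comb_def)
next
  case (insert k S)
  then show ?case
    by (simp add: int_comb_insert int_comb_closed int_pow_distrib int_pow_pow Pi_iff)
qed

text \<open>Substituting combinations into combinations multiplies their coefficient matrices. This
  is what translates the composite of two boundary homomorphisms into a matrix product.\<close>

lemma int_comb_lincomb:
  assumes "finite S" "finite T" "b \<in> S \<rightarrow> carrier G"
  shows "int_comb G T (\<lambda>j. int_comb G S b (A j)) c = int_comb G S b (\<lambda>i. \<Sum>j\<in>T. A j i * c j)"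
  using assms(2)
proof (induction T)
  case empty
  then show ?case by (simp add: int_comb_def finprod_one_eqI)
next
  case (insert k T)
  then show ?case
    using assms by (simp add: int_comb_insert int_comb_closed int_comb_pow int_comb_add)
qed

lemma int_comb_inject:
  assumes "b \<in> S \<rightarrow> carrier G" "int_comb G S b a = int_comb G S b a'" "free_basis G S b" "i \<in> S"
  shows "a i = a' i"
proof -
  have "int_comb G S b a' \<otimes> int_comb G S b (\<lambda>i. a i - a' i) = int_comb G S b a"
    using int_comb_add[OF assms(1), of a' "\<lambda>i. a i - a' i"] by simp
  then have "int_comb G S b (\<lambda>i. a i - a' i) = \<one>"
    using assms(1,2) by (simp add: int_comb_closed)
  then have "a i - a' i = 0"
    using assms(3,4) unfolding free_basis_def by blast
  then show ?thesis by simp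
qed

end

lemma free_basis_empty:
  assumes "comm_group G" "trivial_group G"
  shows "free_basis G {} b"
proof -
  interpret comm_group G by fact
  show ?thesis using assms(2) by (simp add: free_basis_def int_comb_def trivial_group_def)
qed

lemma hom_int_comb:
  assumes "h \<in> hom G H" "comm_group G" "comm_group H" "finite S" "b \<in> S \<rightarrow> carrier G"
  shows "h (int_comb G S b a) = int_comb H S (\<lambda>i. h (b i)) a"
proof -
  interpret G: comm_group G by fact
  interpret H: comm_group H by fact
  have hc: "\<And>x. x \<in> carrier G \<Longrightarrow> h x \<in> carrier H" using assms(1) by (auto simp: hom_def)
  show ?thesis
    using assms(4,5)
  proof (induction S)
    case empty
    then show ?case using hom_one[OF assms(1)] by (simp add: int_comb_def G.is_group H.is_group)
  next
    case (insert k S)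
    then have "h (int_comb G (insert k S) b a) = h (b k [^]\<^bsub>G\<^esub> a k) \<otimes>\<^bsub>H\<^esub> h (int_comb G S b a)"
      using hom_mult[OF assms(1)] by (simp add: G.int_comb_insert G.int_comb_closed)
    also have "h (b k [^]\<^bsub>G\<^esub> a k) = h (b k) [^]\<^bsub>H\<^esub> a k"
      using insert by (intro hom_int_pow[OF assms(1)]) (auto simp: G.is_group H.is_group)
    finally show ?case
      using insert by (simp add: H.int_comb_insert hc Pi_iff)
  qed
qed

text \<open>The second claim covers every generator, since the class of a disc is an arbitrary
  choice of one. If 1 is an integer multiple of the image of \<open>g\<close> in the integers, that
  image is nonzero, so \<open>g\<close> has infinite order.\<close>

lemma integer_group_generator:
  assumes "group G" "G \<cong> integer_group"
  shows "\<exists>g\<in>carrier G. generate G {g} = carrier G"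
    and "\<And>g k::int. g \<in> carrier G \<Longrightarrow> generate G {g} = carrier G \<Longrightarrow> g [^]\<^bsub>G\<^esub> k = \<one>\<^bsub>G\<^esub> \<Longrightarrow> k = 0"
proof -
  interpret group G by fact
  obtain h where h: "h \<in> iso G integer_group" using assms(2) by (auto simp: is_iso_def)
  then have hh: "h \<in> hom G integer_group" and bij: "bij_betw h (carrier G) UNIV" by (auto simp: iso_def)
  have pow: "h (x [^]\<^bsub>G\<^esub> (j::int)) = j * h x" if "x \<in> carrier G" for x j
    using hom_int_pow[OF hh that] by (simp add: is_group)
  obtain g where g: "g \<in> carrier G" "h g = 1" using bij by (metis UNIV_I bij_betw_imp_surj_on imageE)
  have "x \<in> generate G {g}" if "x \<in> carrier G" for x
  proof -
    have "h (g [^]\<^bsub>G\<^esub> h x) = h x" using pow g by simp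
    then have "g [^]\<^bsub>G\<^esub> h x = x" using bij that g by (metis bij_betw_def inj_on_def int_pow_closed)
    then show ?thesis unfolding generate_pow[OF g(1)] by (auto intro: exI[of _ "h x"])
  qed
  then show "\<exists>g\<in>carrier G. generate G {g} = carrier G"
    using g generate_incl[of "{g}"] by blast
  have "l = 0" if g': "g' \<in> carrier G" "generate G {g'} = carrier G" "g' [^]\<^bsub>G\<^esub> (l::int) = \<one>\<^bsub>G\<^esub>" for g' l
  proof -
    obtain j where "g = g' [^]\<^bsub>G\<^esub> (j::int)" using g generate_pow[OF g'(1)] g'(2) by auto
    then have "j * h g' = 1" using pow[OF g'(1)] g by simp
    moreover have "l * h g' = 0"
      using pow[OF g'(1), of l] g'(3) hom_one[OF hh] by (simp add: is_group)
    ultimately show ?thesis by auto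
  qed
  then show "g \<in> carrier G \<Longrightarrow> generate G {g} = carrier G \<Longrightarrow> g [^]\<^bsub>G\<^esub> k = \<one>\<^bsub>G\<^esub> \<Longrightarrow> k = 0" for g and k :: int
    by blast
qed

text \<open>The coefficient of the new element is read off in \<open>K\<close>, which is infinite
  cyclic on its image. Dividing by that power leaves an element of the kernel, hence of the image of
  \<open>G\<close>, where the old basis decides the remaining coefficients.\<close>

lemma free_basis_extend:
  assumes G: "comm_group G" "comm_group H" "comm_group K"
    and phi: "\<phi> \<in> hom G H" "inj_on \<phi> (carrier G)" and psi: "\<psi> \<in> hom H K"
    and ex: "Coset.kernel H K \<psi> = \<phi> ` carrier G"
    and b: "free_basis G S b" "finite S" "k \<notin> S"
    and b': "\<And>i. i \<in> S \<Longrightarrow> b' i = \<phi> (b i)" and c: "b' k \<in> carrier H"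
    and gen: "\<And>x. x \<in> carrier K \<Longrightarrow> \<exists>j::int. x = \<psi> (b' k) [^]\<^bsub>K\<^esub> j"
    and inf: "\<And>j::int. \<psi> (b' k) [^]\<^bsub>K\<^esub> j = \<one>\<^bsub>K\<^esub> \<Longrightarrow> j = 0"
  shows "free_basis H (insert k S) b'"
proof -
  interpret G: comm_group G by fact
  interpret H: comm_group H by fact
  interpret K: comm_group K by fact
  interpret phi: group_hom G H \<phi> by (simp add: group_hom_def group_hom_axioms_def phi G.is_group H.is_group)
  interpret psi: group_hom H K \<psi> by (simp add: group_hom_def group_hom_axioms_def psi K.is_group H.is_group)
  have bG: "b \<in> S \<rightarrow> carrier G" using b by (auto simp: free_basis_def)
  have bH: "b' \<in> insert k S \<rightarrow> carrier H" using bG b' c by (auto simp: Pi_iff)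
  then have bS: "b' \<in> S \<rightarrow> carrier H" by auto
  have lin: "int_comb H S b' a = \<phi> (int_comb G S b a)" for a
    using hom_int_comb[OF phi(1) G(1,2) b(2) bG, of a] b' bS
    by (simp add: H.int_comb_cong[OF bS])
  have ins: "int_comb H (insert k S) b' a = b' k [^]\<^bsub>H\<^esub> a k \<otimes>\<^bsub>H\<^esub> \<phi> (int_comb G S b a)" for a
    using H.int_comb_insert[OF b(2,3) bH] lin by simp
  have psi_phi: "\<psi> (\<phi> x) = \<one>\<^bsub>K\<^esub>" if "x \<in> carrier G" for x
    using ex that unfolding Coset.kernel_def by blast
  show ?thesis
    unfolding free_basis_def
  proof (intro conjI ballI allI impI)
    show "b' i \<in> carrier H" if "i \<in> insert k S" for i using that bH by auto
    fix x assume x: "x \<in> carrier H"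
    then obtain j where j: "\<psi> x = \<psi> (b' k) [^]\<^bsub>K\<^esub> (j::int)" using gen psi.hom_closed by blast
    let ?y = "inv\<^bsub>H\<^esub> (b' k [^]\<^bsub>H\<^esub> j) \<otimes>\<^bsub>H\<^esub> x"
    have "\<psi> ?y = \<one>\<^bsub>K\<^esub>" using x c j by (simp add: psi.hom_int_pow)
    then have "?y \<in> \<phi> ` carrier G" unfolding ex[symmetric] Coset.kernel_def using x c by simp
    then obtain z where z: "z \<in> carrier G" "\<phi> z = ?y" by force
    have "\<forall>x\<in>carrier G. \<exists>a. x = int_comb G S b a" using b(1) unfolding free_basis_def by (elim conjE)
    from bspec[OF this z(1)] obtain a where a: "z = int_comb G S b a" by (rule exE)
    let ?a = "a(k := j)"
    have "int_comb G S b ?a = z"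
      unfolding a using b(3) by (intro G.int_comb_cong[OF bG]) auto
    then have "int_comb H (insert k S) b' ?a = x"
      using z x c by (simp add: ins) (simp add: H.m_assoc[symmetric])
    then show "\<exists>a. x = int_comb H (insert k S) b' a" by (intro exI) (rule sym)
  next
    fix a i assume a: "int_comb H (insert k S) b' a = \<one>\<^bsub>H\<^esub>" and i: "i \<in> insert k S"
    have l: "int_comb G S b a \<in> carrier G" using bG by (rule G.int_comb_closed)
    have "\<psi> (int_comb H (insert k S) b' a) = \<psi> (b' k) [^]\<^bsub>K\<^esub> a k"
      unfolding ins using c l psi_phi[OF l] by (simp add: psi.hom_int_pow)
    then have k: "a k = 0" using inf a by simp
    then have "\<phi> (int_comb G S b a) = \<one>\<^bsub>H\<^esub>" using ins[of a] a l by simp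
    then have "int_comb G S b a = \<one>\<^bsub>G\<^esub>" using phi(2) l by (metis G.one_closed inj_onD phi.hom_one)
    moreover have "\<forall>a. int_comb G S b a = \<one>\<^bsub>G\<^esub> \<longrightarrow> (\<forall>i\<in>S. a i = 0)"
      using b(1) unfolding free_basis_def by (elim conjE)
    ultimately have "\<forall>i\<in>S. a i = 0" by simp
    then show "a i = 0" using i k by auto
  qed
qed


section \<open>The homology of a disc relative to its boundary\<close>

lemma contractible_disc: "contractible_space (disc m)"
proof -
  let ?D = "topspace (disc m)" and ?h = "\<lambda>(t::real, x::nat\<Rightarrow>real) i::nat. (1 - t) * x i"
  have D: "disc m = top_of_set ?D" by (simp add: disc_eq_top_of_set)
  have "continuous_on ({0..1} \<times> ?D) (\<lambda>z. (1 - fst z) * snd z i)" for i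
  proof -
    have "continuous_on ({0..1} \<times> ?D) (\<lambda>z. snd z i)"
      by (rule continuous_on_compose2[OF continuous_on_product_coordinates, where f = snd]) (auto intro: continuous_intros)
    then show ?thesis by (intro continuous_intros)
  qed
  then have "continuous_on ({0..1} \<times> ?D) ?h"
    by (intro continuous_on_coordinatewise_then_product) (simp only: case_prod_unfold)
  moreover have "?h ` ({0..1} \<times> ?D) \<subseteq> ?D"
  proof (clarsimp simp: topspace_disc sqnorm_scale)
    fix t :: real and x assume "0 \<le> t" "t \<le> 1" "sqnorm m x \<le> 1"
    then have "(1 - t)\<^sup>2 \<le> 1" by (simp add: abs_square_le_1)
    then show "(1 - t)\<^sup>2 * sqnorm m x \<le> 1" using \<open>sqnorm m x \<le> 1\<close> by (intro mult_le_one) auto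
  qed
  ultimately have "continuous_map (prod_topology (top_of_set {0..1}) (top_of_set ?D)) (top_of_set ?D) ?h"
    by (simp add: continuous_map_in_subtopology image_subset_iff_funcset)
  then have "homotopic_with (\<lambda>h. True) (disc m) (disc m) id (\<lambda>x i. 0)"
    unfolding D[symmetric] by (subst homotopic_with) (auto intro!: exI[of _ ?h])
  then show ?thesis unfolding contractible_space_def by blast
qed

lemma disc_boundary_nsphere: "subtopology (disc (Suc n)) (disc_boundary (Suc n)) = nsphere n"
proof -
  have "{x::nat\<Rightarrow>real. (\<forall>i\<ge>Suc n. x i = 0) \<and> sqnorm (Suc n) x \<le> 1} \<inter> disc_boundary (Suc n)
     = {x. (\<Sum>i\<le>n. (x i)\<^sup>2) = 1 \<and> (\<forall>i>n. x i = 0)}"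
    by (auto simp: disc_boundary_eq sqnorm_def lessThan_Suc_atMost Suc_le_eq)
  then show ?thesis
    by (simp add: disc_eq_top_of_set nsphere subtopology_subtopology euclidean_product_topology)
qed

text \<open>For \<open>m = Suc n\<close> the disc is contractible, so its relative homology is the
  reduced homology of the \<open>n\<close>-sphere one degree lower. The 0-disc is treated apart: its
  boundary is empty and its homology is that of a point.\<close>

lemma relative_homology_disc:
  "relative_homology_group (int m) (disc m) (disc_boundary m) \<cong> integer_group"
  "j \<noteq> int m \<Longrightarrow> trivial_group (relative_homology_group j (disc m) (disc_boundary m))"
proof -
  consider "m = 0" | n where "m = Suc n" by (cases m) auto
  then have "relative_homology_group (int m) (disc m) (disc_boundary m) \<cong> integer_group \<and>
     (j \<noteq> int m \<longrightarrow> trivial_group (relative_homology_group j (disc m) (disc_boundary m)))"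
  proof cases
    case 1
    have "topspace (disc 0) = {\<lambda>i. 0}" "disc_boundary 0 = {}"
      by (auto simp: topspace_disc sqnorm_def disc_boundary_eq)
    then show ?thesis
      using 1 homology_coefficients[of "disc 0"] homology_dimension_axiom[of "disc 0" _ j] by simp
  next
    case (2 n)
    have "topspace (disc m) \<inter> disc_boundary m \<noteq> {}"
    proof -
      have "topspace (nsphere n) \<noteq> {}" using in_topspace_nsphere by blast
      then show ?thesis
        unfolding disc_boundary_nsphere[symmetric] 2 by simp
    qed
    then have iso: "relative_homology_group p (disc m) (disc_boundary m) \<cong> reduced_homology_group (p - 1) (nsphere n)" for p
      using isomorphic_group_relative_homology_of_contractible[OF contractible_disc, of m "disc_boundary m" p]
      by (simp add: 2 disc_boundary_nsphere)
    have "relative_homology_group (int m) (disc m) (disc_boundary m) \<cong> integer_group"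
      using iso[of "int m"] reduced_homology_group_nsphere(1)[of n] iso_trans by (auto simp: 2)
    moreover have "trivial_group (relative_homology_group j (disc m) (disc_boundary m))" if "j \<noteq> int m"
      using iso[of j] reduced_homology_group_nsphere(2)[of "j - 1" n] that 2
      by (subst isomorphic_group_triviality[OF iso]) auto
    ultimately show ?thesis by blast
  qed
  then show "relative_homology_group (int m) (disc m) (disc_boundary m) \<cong> integer_group"
    "j \<noteq> int m \<Longrightarrow> trivial_group (relative_homology_group j (disc m) (disc_boundary m))" by auto
qed

lemma disc_class:
  shows disc_class_carrier: "disc_class m \<in> carrier (relative_homology_group (int m) (disc m) (disc_boundary m))"
    and disc_class_generates: "x \<in> carrier (relative_homology_group (int m) (disc m) (disc_boundary m)) \<Longrightarrow>
      \<exists>k::int. x = disc_class m [^]\<^bsub>relative_homology_group (int m) (disc m) (disc_boundary m)\<^esub> k"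
    and disc_class_infinite: "disc_class m [^]\<^bsub>relative_homology_group (int m) (disc m) (disc_boundary m)\<^esub> (k::int) =
       \<one>\<^bsub>relative_homology_group (int m) (disc m) (disc_boundary m)\<^esub> \<Longrightarrow> k = 0"
proof -
  let ?H = "relative_homology_group (int m) (disc m) (disc_boundary m)"
  have "\<exists>g. g \<in> carrier ?H \<and> generate ?H {g} = carrier ?H"
    using integer_group_generator(1)[OF _ relative_homology_disc(1)] by auto
  then have *: "disc_class m \<in> carrier ?H \<and> generate ?H {disc_class m} = carrier ?H"
    unfolding disc_class_def by (rule someI_ex)
  then show "disc_class m \<in> carrier ?H" by blast
  show "\<exists>k::int. x = disc_class m [^]\<^bsub>?H\<^esub> k" if "x \<in> carrier ?H"
    using * that group.generate_pow[of ?H "disc_class m"] by auto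
  show "k = 0" if "disc_class m [^]\<^bsub>?H\<^esub> k = \<one>\<^bsub>?H\<^esub>"
    using integer_group_generator(2)[OF _ relative_homology_disc(1)] * that by auto
qed


section \<open>The cellular chain groups\<close>

text \<open>Lets open cells be exchanged for closed ones in a union that already contains the lower
  skeleton, where the boundaries of the cells lie.\<close>

lemma Un_UN_cong:
  assumes "\<And>k. k \<in> S \<Longrightarrow> T \<union> A k = T \<union> B k"
  shows "T \<union> (\<Union>k\<in>S. A k) = T \<union> (\<Union>k\<in>S. B k)"
proof -
  have "T \<union> (\<Union>k\<in>S. A k) = T \<union> (\<Union>k\<in>S. T \<union> A k)" by auto
  also have "\<dots> = T \<union> (\<Union>k\<in>S. T \<union> B k)" using assms by simp
  also have "\<dots> = T \<union> (\<Union>k\<in>S. B k)" by auto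
  finally show ?thesis .
qed

locale finite_cw =
  fixes X :: "'a cw_complex"
  assumes finite_cw: "finite_cw_complex X"
begin

lemma Hausdorff: "Hausdorff_space (cw_space X)"
  and finite_dims: "finite {m. cw_count X m > 0}"
  and char_cont: "k < cw_count X m \<Longrightarrow> continuous_map (disc m) (cw_space X) (cw_char X m k)"
  and char_emb: "k < cw_count X m \<Longrightarrow> embedding_map (subtopology (disc m) (disc_interior m)) (cw_space X) (cw_char X m k)"
  and char_boundary: "k < cw_count X m \<Longrightarrow> cw_char X m k ` disc_boundary m \<subseteq> skeleton X (int m - 1)"
  and cells_disjoint: "\<lbrakk>k < cw_count X m; k' < cw_count X m'; (m, k) \<noteq> (m', k')\<rbrakk> \<Longrightarrow> open_cell X m k \<inter> open_cell X m' k' = {}"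
  and cells_cover: "(\<Union>m. \<Union>k<cw_count X m. open_cell X m k) = topspace (cw_space X)"
proof -
  note * = finite_cw[unfolded finite_cw_complex_def]
  show "Hausdorff_space (cw_space X)" "finite {m. cw_count X m > 0}"
    "(\<Union>m. \<Union>k<cw_count X m. open_cell X m k) = topspace (cw_space X)"
    by (rule *[THEN conjunct1], rule *[THEN conjunct2, THEN conjunct1],
        rule *[THEN conjunct2, THEN conjunct2, THEN conjunct2, THEN conjunct2])
  have chars: "\<forall>m. \<forall>k<cw_count X m.
        continuous_map (disc m) (cw_space X) (cw_char X m k) \<and>
        embedding_map (subtopology (disc m) (disc_interior m)) (cw_space X) (cw_char X m k) \<and>
        cw_char X m k ` disc_boundary m \<subseteq> skeleton X (int m - 1)"
    using * by (elim conjE)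
  show "k < cw_count X m \<Longrightarrow> continuous_map (disc m) (cw_space X) (cw_char X m k)"
    "k < cw_count X m \<Longrightarrow> embedding_map (subtopology (disc m) (disc_interior m)) (cw_space X) (cw_char X m k)"
    "k < cw_count X m \<Longrightarrow> cw_char X m k ` disc_boundary m \<subseteq> skeleton X (int m - 1)"
    using chars by simp_all
  have "\<forall>m. \<forall>k<cw_count X m. \<forall>m'. \<forall>k'<cw_count X m'.
        (m, k) \<noteq> (m', k') \<longrightarrow> open_cell X m k \<inter> open_cell X m' k' = {}"
    using * by (elim conjE)
  then show "\<lbrakk>k < cw_count X m; k' < cw_count X m'; (m, k) \<noteq> (m', k')\<rbrakk> \<Longrightarrow> open_cell X m k \<inter> open_cell X m' k' = {}"
    by blast
qed

lemma skeleton_mono: "i \<le> j \<Longrightarrow> skeleton X i \<subseteq> skeleton X j"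
  unfolding skeleton_def by force

lemma skeleton_subset: "skeleton X i \<subseteq> topspace (cw_space X)"
  using cells_cover unfolding skeleton_def by blast

lemma skeleton_neg: "i < 0 \<Longrightarrow> skeleton X i = {}"
  unfolding skeleton_def by auto

lemma skeleton_step: "skeleton X (int m) = skeleton X (int m - 1) \<union> (\<Union>k<cw_count X m. open_cell X m k)"
proof -
  have "{l. int l \<le> int m} = insert m {l. int l \<le> int m - 1}" by auto
  then show ?thesis unfolding skeleton_def by auto
qed

lemma closed_cell_eq:
  assumes "k < cw_count X m"
  shows "skeleton X (int m - 1) \<union> cw_char X m k ` topspace (disc m) = skeleton X (int m - 1) \<union> open_cell X m k"
  unfolding open_cell_def disc_Un[symmetric] image_Un using char_boundary[OF assms] by blast

lemma closedin_closed_cell: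
  assumes "k < cw_count X m"
  shows "closedin (cw_space X) (cw_char X m k ` topspace (disc m))"
  using compact_disc[of m] char_cont[OF assms] Hausdorff
  by (metis compact_space_def compactin_imp_closedin image_compactin)

text \<open>The shift by one makes the induction start from the empty skeleton. Each step adds
  finitely many closed cells, which are compact and therefore closed in a Hausdorff space.\<close>

lemma closedin_skeleton_nat: "closedin (cw_space X) (skeleton X (int m - 1))"
proof (induction m)
  case 0
  then show ?case by (simp add: skeleton_neg)
next
  case (Suc m)
  have "skeleton X (int (Suc m) - 1) = skeleton X (int m)" by simp
  also have "\<dots> = skeleton X (int m - 1) \<union> (\<Union>k<cw_count X m. open_cell X m k)"
    by (rule skeleton_step)
  also have "\<dots> = skeleton X (int m - 1) \<union> (\<Union>k<cw_count X m. cw_char X m k ` topspace (disc m))"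
    by (intro Un_UN_cong closed_cell_eq[symmetric]) simp
  finally have eq: "skeleton X (int (Suc m) - 1) = \<dots>" .
  show ?case
    unfolding eq using Suc closedin_closed_cell by (intro closedin_Un) (auto intro!: closedin_Union)
qed

text \<open>A stage between two consecutive skeleta: only the \<open>m\<close>-cells with index in
  \<open>S\<close> are present, so enlarging \<open>S\<close> by one index attaches exactly one
  cell.\<close>

definition partial_skeleton :: "nat \<Rightarrow> nat set \<Rightarrow> 'a set" where
  "partial_skeleton m S = skeleton X (int m - 1) \<union> (\<Union>k\<in>S. open_cell X m k)"

lemma closedin_partial_skeleton:
  assumes "S \<subseteq> {..<cw_count X m}"
  shows "closedin (cw_space X) (partial_skeleton m S)"
proof -
  have eq: "partial_skeleton m S = skeleton X (int m - 1) \<union> (\<Union>k\<in>S. cw_char X m k ` topspace (disc m))"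
    unfolding partial_skeleton_def by (intro Un_UN_cong closed_cell_eq[symmetric]) (use assms in auto)
  have "finite S" using assms by (rule finite_subset) simp
  then show ?thesis
    unfolding eq using closedin_skeleton_nat[of m] closedin_closed_cell assms by (intro closedin_Un) (auto intro!: closedin_Union)
qed

lemma cell_attachment_partial:
  assumes "S \<subseteq> {..<cw_count X m}" "k < cw_count X m" "k \<notin> S"
  shows "cell_attachment m (subtopology (cw_space X) (partial_skeleton m (insert k S))) (partial_skeleton m S) (cw_char X m k)"
proof
  let ?B = "partial_skeleton m (insert k S)" and ?A = "partial_skeleton m S"
  have cl: "closedin (cw_space X) ?A" "closedin (cw_space X) ?B"
    using assms by (auto intro!: closedin_partial_skeleton)
  have topB: "topspace (subtopology (cw_space X) ?B) = ?B"
    using closedin_subset[OF cl(2)] by auto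
  have AB: "?A \<subseteq> ?B" by (auto simp: partial_skeleton_def)
  show "Hausdorff_space (subtopology (cw_space X) ?B)" using Hausdorff by (rule Hausdorff_space_subtopology)
  show "closedin (subtopology (cw_space X) ?B) ?A" using cl AB by (simp add: closedin_closed_subtopology)
  have im: "cw_char X m k ` topspace (disc m) \<subseteq> ?B"
    using closed_cell_eq[OF assms(2)] unfolding partial_skeleton_def by auto
  then show "continuous_map (disc m) (subtopology (cw_space X) ?B) (cw_char X m k)"
    using char_cont[OF assms(2)] by (auto simp: continuous_map_in_subtopology)
  show "embedding_map (subtopology (disc m) (disc_interior m)) (subtopology (cw_space X) ?B) (cw_char X m k)"
    unfolding embedding_map_in_subtopology using char_emb[OF assms(2)] im by auto
  show "cw_char X m k ` disc_boundary m \<subseteq> ?A"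
    using char_boundary[OF assms(2)] by (auto simp: partial_skeleton_def)
  have "open_cell X m k \<inter> open_cell X m' k' = {}" if "k' < cw_count X m'" "m' < m \<or> k' \<in> S" for m' k'
    using that assms cells_disjoint[OF assms(2) that(1)] by auto
  then have "open_cell X m k \<inter> ?A = {}"
    using assms(1) unfolding partial_skeleton_def skeleton_def by fastforce
  then show "cw_char X m k ` disc_interior m \<inter> ?A = {}" by (simp add: open_cell_def)
  show "cw_char X m k ` disc_interior m \<union> ?A = topspace (subtopology (cw_space X) ?B)"
    unfolding topB by (auto simp: partial_skeleton_def open_cell_def)
qed

definition partial_class :: "nat \<Rightarrow> nat set \<Rightarrow> nat \<Rightarrow> 'a chain set" where
  "partial_class m S k = hom_induced (int m) (disc m) (disc_boundary m)
     (subtopology (cw_space X) (partial_skeleton m S)) (skeleton X (int m - 1)) (cw_char X m k) (disc_class m)"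

abbreviation partial_group :: "nat \<Rightarrow> nat set \<Rightarrow> int \<Rightarrow> 'a chain set monoid" where
  "partial_group m S j \<equiv> relative_homology_group j (subtopology (cw_space X) (partial_skeleton m S)) (skeleton X (int m - 1))"

lemma trivial_group_exact:
  assumes "exact_seq ([C, B, A], [g, f])" "trivial_group A" "trivial_group C"
  shows "trivial_group B"
proof -
  have ex: "Coset.kernel B C g = f ` carrier A" and gh: "g \<in> hom B C" "group_hom A B f"
    using assms(1) by auto
  interpret f: group_hom A B f by fact
  have "carrier B = Coset.kernel B C g"
    using gh(1) assms(3) by (auto simp: Coset.kernel_def trivial_group_def hom_def)
  also have "\<dots> = {\<one>\<^bsub>B\<^esub>}"
    using assms(2) unfolding ex trivial_group_def by simp
  finally show ?thesis by (simp add: trivial_group_def)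
qed

text \<open>Induction on \<open>S\<close> along the exact sequence of the triple formed by the new
  stage, the old stage and the lower skeleton. By the attachment isomorphism the new stage relative
  to the old one has the homology of a disc relative to its boundary: infinite cyclic in degree
  \<open>m\<close>, zero in all others.\<close>

lemma partial_basis:
  assumes "finite S" "S \<subseteq> {..<cw_count X m}"
  shows "(\<forall>j. j \<noteq> int m \<longrightarrow> trivial_group (partial_group m S j)) \<and>
     free_basis (partial_group m S (int m)) S (partial_class m S)"
  using assms
proof (induction S)
  case empty
  let ?A = "skeleton X (int m - 1)"
  have "topspace (subtopology (cw_space X) ?A) = ?A" using skeleton_subset by auto
  then have "trivial_group (relative_homology_group j (subtopology (cw_space X) ?A) ?A)" for j
    by (metis trivial_relative_homology_group_topspace)
  then have t: "trivial_group (partial_group m {} j)" for j by (simp add: partial_skeleton_def)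
  then show ?case using free_basis_empty[OF _ t[of "int m"]] by auto
next
  case (insert k S)
  let ?T = "skeleton X (int m - 1)"
  let ?A = "partial_skeleton m S" and ?B = "partial_skeleton m (insert k S)"
  let ?XA = "subtopology (cw_space X) ?A" and ?XB = "subtopology (cw_space X) ?B"
  let ?K = "\<lambda>j. relative_homology_group j ?XB ?A"
  have S: "S \<subseteq> {..<cw_count X m}" "k < cw_count X m" "k \<notin> S" using insert by auto
  interpret att: cell_attachment m ?XB ?A "cw_char X m k"
    using S by (rule cell_attachment_partial)
  have IH: "\<And>j. j \<noteq> int m \<Longrightarrow> trivial_group (partial_group m S j)"
    "free_basis (partial_group m S (int m)) S (partial_class m S)"
    using insert by auto
  have isoK: "hom_induced j (disc m) (disc_boundary m) ?XB ?A (cw_char X m k) \<in>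
     iso (relative_homology_group j (disc m) (disc_boundary m)) (?K j)" for j
    by (rule att.iso_hom_induced_attachment)
  then have "relative_homology_group j (disc m) (disc_boundary m) \<cong> ?K j" for j
    by (rule is_isoI)
  then have trivK: "trivial_group (?K j)" if "j \<noteq> int m" for j
    using relative_homology_disc(2)[OF that] isomorphic_group_triviality1 by (metis group_relative_homology_group)
  have TA: "?T \<subseteq> ?A" and AB: "?A \<subseteq> ?B" by (auto simp: partial_skeleton_def)
  have XA: "subtopology ?XB ?A = ?XA" using AB by (simp add: subtopology_subtopology Int_absorb1)
  let ?phi = "\<lambda>j. hom_induced j ?XA ?T ?XB ?T id" and ?psi = "\<lambda>j. hom_induced j ?XB ?T ?XB ?A id"
  have ex1: "exact_seq ([partial_group m S (p - 1), ?K p, partial_group m (insert k S) p],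
                    [hom_relboundary p ?XB ?A ?T, ?psi p])" for p
    using homology_exactness_triple_1[OF TA, of p ?XB] unfolding XA .
  have ex2: "exact_seq ([partial_group m (insert k S) (p - 1), partial_group m S (p - 1), ?K p],
                    [?phi (p - 1), hom_relboundary p ?XB ?A ?T])" for p
    using homology_exactness_triple_2[OF TA, of p ?XB] unfolding XA .
  have ex3: "exact_seq ([?K p, partial_group m (insert k S) p, partial_group m S p],
                    [?psi p, ?phi p])" for p
    using homology_exactness_triple_3[OF TA, of p ?XB] unfolding XA .
  have "trivial_group (partial_group m (insert k S) j)" if "j \<noteq> int m" for j
    using trivial_group_exact[OF ex3] IH(1)[OF that] trivK[OF that] by blast
  moreover have "free_basis (partial_group m (insert k S) (int m)) (insert k S) (partial_class m (insert k S))"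
  proof (rule free_basis_extend[where G = "partial_group m S (int m)" and K = "?K (int m)" and \<phi> = "?phi (int m)" and \<psi> = "?psi (int m)" and b = "partial_class m S"])
    \<comment> \<open>The kernel is the image of the connecting map out of degree
      \<open>m + 1\<close>, and in that degree the new stage relative to the old one has no
      homology.\<close>
    show "inj_on (?phi (int m)) (carrier (partial_group m S (int m)))"
    proof -
      interpret gh: group_hom "partial_group m S (int m)" "partial_group m (insert k S) (int m)" "?phi (int m)"
        by (simp add: group_hom_def group_hom_axioms_def hom_induced_hom)
      have "Coset.kernel (partial_group m S (int m)) (partial_group m (insert k S) (int m)) (?phi (int m)) =
        hom_relboundary (int m + 1) ?XB ?A ?T ` carrier (?K (int m + 1))"
        using ex2[of "int m + 1"] by simp
      also have "\<dots> = {\<one>\<^bsub>partial_group m S (int m)\<^esub>}"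
        using trivK[of "int m + 1"] ex2[of "int m + 1"]
        by (auto simp: trivial_group_def group_hom.hom_one)
      finally show ?thesis by (simp add: gh.inj_iff_trivial_ker)
    qed
    show "Coset.kernel (partial_group m (insert k S) (int m)) (?K (int m)) (?psi (int m)) = ?phi (int m) ` carrier (partial_group m S (int m))"
      using ex3[of "int m"] by simp
    have c: "partial_class m (insert k S) k \<in> carrier (partial_group m (insert k S) (int m))"
      unfolding partial_class_def by (rule hom_induced_carrier)
    then show "partial_class m (insert k S) k \<in> carrier (partial_group m (insert k S) (int m))" .
    have cont: "continuous_map (disc m) (subtopology (cw_space X) (partial_skeleton m U)) (cw_char X m i)"
      if "i \<in> U" "U \<subseteq> {..<cw_count X m}" for i U
    proof -
      have i: "i < cw_count X m" using that by auto
      have "cw_char X m i ` topspace (disc m) \<subseteq> partial_skeleton m U"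
        using closed_cell_eq[OF i] that(1) unfolding partial_skeleton_def by auto
      then show ?thesis using char_cont[OF i] by (auto simp: continuous_map_in_subtopology)
    qed
    have bd: "cw_char X m i \<in> disc_boundary m \<rightarrow> ?T" if "i < cw_count X m" for i
      using char_boundary[OF that] by auto
    show "partial_class m (insert k S) i = ?phi (int m) (partial_class m S i)" if "i \<in> S" for i
    proof -
      have "continuous_map ?XA ?XB id"
        using AB by (auto simp: continuous_map_in_subtopology)
      then show ?thesis
        unfolding partial_class_def using that S cont[OF that S(1)] bd[of i]
        by (subst hom_induced_compose') auto
    qed
    \<comment> \<open>Made relative to the old stage, the new class is the image of the disc class
      under the attachment isomorphism. It therefore generates an infinite cyclic group, as the
      extension of the basis requires.\<close>
    have psi: "?psi (int m) (partial_class m (insert k S) k) =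
      hom_induced (int m) (disc m) (disc_boundary m) ?XB ?A (cw_char X m k) (disc_class m)"
      unfolding partial_class_def using S cont[of k "insert k S"] bd[of k] TA
      by (subst hom_induced_compose') auto
    let ?h = "hom_induced (int m) (disc m) (disc_boundary m) ?XB ?A (cw_char X m k)"
    let ?D = "relative_homology_group (int m) (disc m) (disc_boundary m)"
    have h: "?h \<in> hom ?D (?K (int m))" "bij_betw ?h (carrier ?D) (carrier (?K (int m)))"
      using isoK[of "int m"] by (auto simp: iso_def)
    have pow: "?h (disc_class m [^]\<^bsub>?D\<^esub> j) = ?h (disc_class m) [^]\<^bsub>?K (int m)\<^esub> (j::int)" for j
      using hom_int_pow[OF h(1) disc_class_carrier] by simp
    show "\<exists>j::int. x = ?psi (int m) (partial_class m (insert k S) k) [^]\<^bsub>?K (int m)\<^esub> j" if x: "x \<in> carrier (?K (int m))" for x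
    proof -
      obtain y where "y \<in> carrier ?D" "x = ?h y" using h(2) x unfolding bij_betw_def by blast
      then show ?thesis using disc_class_generates[of y m] pow unfolding psi by metis
    qed
    show "j = 0" if "?psi (int m) (partial_class m (insert k S) k) [^]\<^bsub>?K (int m)\<^esub> j = \<one>\<^bsub>?K (int m)\<^esub>" for j :: int
    proof -
      have "?h (disc_class m [^]\<^bsub>?D\<^esub> j) = ?h \<one>\<^bsub>?D\<^esub>"
        using that hom_one[OF h(1)] unfolding psi pow by simp
      moreover have "disc_class m [^]\<^bsub>?D\<^esub> j \<in> carrier ?D" "\<one>\<^bsub>?D\<^esub> \<in> carrier ?D"
        by (rule group.int_pow_closed[OF group_relative_homology_group disc_class_carrier],
            rule monoid.one_closed[OF group.is_monoid[OF group_relative_homology_group]])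
      ultimately have "disc_class m [^]\<^bsub>?D\<^esub> j = \<one>\<^bsub>?D\<^esub>"
        using h(2) unfolding bij_betw_def by (metis inj_onD)
      then show ?thesis by (rule disc_class_infinite)
    qed
  qed (use IH(2) insert.hyps in \<open>auto simp: hom_induced_hom\<close>)
  ultimately show ?case by blast
qed

lemma cell_chain_basis:
  "free_basis (cell_chain_group X (int m)) {..<cw_count X m} (cell_class X (int m))"
proof -
  have eq: "partial_skeleton m {..<cw_count X m} = skeleton X (int m)"
    by (simp only: partial_skeleton_def skeleton_step[of m])
  have "partial_class m {..<cw_count X m} = cell_class X (int m)"
    by (rule ext) (simp only: partial_class_def cell_class_def eq nat_int)
  with partial_basis[OF finite_lessThan subset_refl, of m] show ?thesis
    unfolding cell_chain_group_def eq by (elim conjE) simp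
qed

end

section \<open>The cellular boundary matrices\<close>

definition cell_boundary_hom :: "'a cw_complex \<Rightarrow> int \<Rightarrow> 'a chain set \<Rightarrow> 'a chain set" where
  "cell_boundary_hom X i = hom_relboundary i (subtopology (cw_space X) (skeleton X i)) (skeleton X (i - 1)) (skeleton X (i - 2))"

definition represents_boundary :: "'a cw_complex \<Rightarrow> int \<Rightarrow> int mat \<Rightarrow> bool" where
  "represents_boundary X i A \<longleftrightarrow> A \<in> carrier_mat (num_cells X (i - 1)) (num_cells X i) \<and>
     (\<forall>k<num_cells X i. cell_boundary_hom X i (cell_class X i k) =
        int_comb (cell_chain_group X (i - 1)) {..<num_cells X (i - 1)} (cell_class X (i - 1)) (\<lambda>j. A $$ (j, k)))"

lemma cell_boundary_eq_The: "i \<ge> 1 \<Longrightarrow> cell_boundary X i = (THE A. represents_boundary X i A)"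
  unfolding cell_boundary_def represents_boundary_def cell_boundary_hom_def int_comb_def by simp

lemma comm_group_cell_chain: "comm_group (cell_chain_group X i)"
  by (simp add: cell_chain_group_def)

lemma cell_class_carrier: "cell_class X i k \<in> carrier (cell_chain_group X i)"
  unfolding cell_class_def cell_chain_group_def by (rule hom_induced_carrier)

lemma (in comm_group) int_comb_const:
  assumes "finite S" "e \<in> carrier G"
  shows "int_comb G S (\<lambda>_. e) a = e [^] (\<Sum>i\<in>S. a i)"
  using assms
proof (induction S)
  case empty
  then show ?case by (simp add: int_comb_def)
next
  case (insert k S)
  then show ?case by (simp add: int_comb_insert int_pow_mult)
qed

context finite_cw
begin

lemma skeleton_skeleton: "subtopology (subtopology (cw_space X) (skeleton X i)) (skeleton X (i - 1)) = subtopology (cw_space X) (skeleton X (i - 1))"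
  using skeleton_mono[of "i - 1" i] by (simp add: subtopology_subtopology Int_absorb1)

lemma cell_boundary_hom: "cell_boundary_hom X i \<in> hom (cell_chain_group X i) (cell_chain_group X (i - 1))"
  using group_homomorphism_hom_relboundary[of i "subtopology (cw_space X) (skeleton X i)" "skeleton X (i - 1)" "skeleton X (i - 2)"]
  unfolding cell_boundary_hom_def cell_chain_group_def skeleton_skeleton by simp

text \<open>Unfolded, the composite contains two consecutive arrows of the long exact sequence of
  the pair of skeleta in degrees \<open>i - 1\<close> and \<open>i - 2\<close>: absolute homology is
  made relative and then sent to its boundary, which gives the neutral element.\<close>

lemma cell_boundary_hom_twice: "cell_boundary_hom X (i - 1) (cell_boundary_hom X i x) = \<one>\<^bsub>cell_chain_group X (i - 2)\<^esub>"
proof -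
  let ?X = "\<lambda>j. subtopology (cw_space X) (skeleton X j)" and ?S = "skeleton X"
  let ?y = "hom_boundary i (?X i) (?S (i - 1)) x"
  have y: "?y \<in> carrier (homology_group (i - 1) (?X (i - 1)))"
    using hom_boundary_carrier[of i "?X i" "?S (i - 1)" x] unfolding skeleton_skeleton .
  have "Coset.kernel (relative_homology_group (i - 1) (?X (i - 1)) (?S (i - 2))) (homology_group (i - 2) (subtopology (?X (i - 1)) (?S (i - 2)))) (hom_boundary (i - 1) (?X (i - 1)) (?S (i - 2)))
     = hom_induced (i - 1) (?X (i - 1)) {} (?X (i - 1)) (?S (i - 2)) id ` carrier (homology_group (i - 1) (?X (i - 1)))"
    using homology_exactness_axiom_1[of "i - 1" "?X (i - 1)" "?S (i - 2)"] by simp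
  then have 1: "hom_boundary (i - 1) (?X (i - 1)) (?S (i - 2)) (hom_induced (i - 1) (?X (i - 1)) {} (?X (i - 1)) (?S (i - 2)) id ?y)
     = \<one>\<^bsub>homology_group (i - 2) (subtopology (?X (i - 1)) (?S (i - 2)))\<^esub>"
    using y unfolding Coset.kernel_def by blast
  have ss: "subtopology (?X (i - 1)) (?S (i - 2)) = ?X (i - 2)"
    using skeleton_skeleton[of "i - 1"] by simp
  have "cell_boundary_hom X (i - 1) (cell_boundary_hom X i x) =
     hom_induced (i - 2) (?X (i - 2)) {} (?X (i - 2)) (?S (i - 3)) id \<one>\<^bsub>homology_group (i - 2) (?X (i - 2))\<^esub>"
    unfolding cell_boundary_hom_def hom_relboundary_def o_def skeleton_skeleton
    using 1 by (simp add: ss)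
  also have "\<dots> = \<one>\<^bsub>relative_homology_group (i - 2) (?X (i - 2)) (?S (i - 3))\<^esub>"
    by (rule hom_one[OF hom_induced_hom]) auto
  finally show ?thesis by (simp only: cell_chain_group_def) (simp add: algebra_simps)
qed

lemma cell_chain_basis':
  assumes "i \<ge> 0"
  shows "free_basis (cell_chain_group X i) {..<num_cells X i} (cell_class X i)"
  using cell_chain_basis[of "nat i"] assms by (simp add: num_cells_def)

lemma represents_boundary_unique:
  assumes "i \<ge> 1" "represents_boundary X i A" "represents_boundary X i B"
  shows "A = B"
proof (rule eq_matI)
  interpret comm_group "cell_chain_group X (i - 1)" by (rule comm_group_cell_chain)
  have A: "A \<in> carrier_mat (num_cells X (i - 1)) (num_cells X i)" and B: "B \<in> carrier_mat (num_cells X (i - 1)) (num_cells X i)"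
    using assms by (auto simp: represents_boundary_def)
  show "dim_row A = dim_row B" "dim_col A = dim_col B" using A B by auto
  fix j k assume jk: "j < dim_row B" "k < dim_col B"
  have "int_comb (cell_chain_group X (i - 1)) {..<num_cells X (i - 1)} (cell_class X (i - 1)) (\<lambda>j. A $$ (j, k))
    = int_comb (cell_chain_group X (i - 1)) {..<num_cells X (i - 1)} (cell_class X (i - 1)) (\<lambda>j. B $$ (j, k))"
    using assms jk B by (simp add: represents_boundary_def)
  from int_comb_inject[OF _ this cell_chain_basis', of j] show "A $$ (j, k) = B $$ (j, k)"
    using assms(1) jk B cell_class_carrier by auto
qed

lemma represents_boundary_exists:
  assumes "i \<ge> 1"
  shows "\<exists>A. represents_boundary X i A"
proof -
  let ?C = "cell_chain_group X (i - 1)" and ?p = "num_cells X (i - 1)"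
  interpret comm_group ?C by (rule comm_group_cell_chain)
  have "\<forall>x\<in>carrier ?C. \<exists>a. x = int_comb ?C {..<?p} (cell_class X (i - 1)) a"
    using cell_chain_basis'[of "i - 1"] assms unfolding free_basis_def by simp
  moreover have "cell_boundary_hom X i (cell_class X i k) \<in> carrier ?C" for k
    using hom_in_carrier[OF cell_boundary_hom cell_class_carrier] .
  ultimately have "\<forall>k. \<exists>a. cell_boundary_hom X i (cell_class X i k) = int_comb ?C {..<?p} (cell_class X (i - 1)) a"
    by blast
  then obtain a where a: "\<And>k. cell_boundary_hom X i (cell_class X i k) = int_comb ?C {..<?p} (cell_class X (i - 1)) (a k)"
    by metis
  have "represents_boundary X i (mat ?p (num_cells X i) (\<lambda>(j, k). a k j))"
    unfolding represents_boundary_def a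
    by (intro conjI allI impI int_comb_cong) (auto simp: cell_class_carrier)
  then show ?thesis ..
qed

lemma represents_cell_boundary: "i \<ge> 1 \<Longrightarrow> represents_boundary X i (cell_boundary X i)"
  unfolding cell_boundary_eq_The
  using represents_boundary_exists represents_boundary_unique by (metis theI)

lemma cell_boundary_carrier: "cell_boundary X i \<in> carrier_mat (num_cells X (i - 1)) (num_cells X i)"
proof (cases "i \<ge> 1")
  case True
  then show ?thesis using represents_cell_boundary by (simp add: represents_boundary_def)
next
  case False
  then show ?thesis by (auto simp: cell_boundary_def num_cells_def)
qed

lemma cell_boundary_hom_class:
  "i \<ge> 1 \<Longrightarrow> k < num_cells X i \<Longrightarrow> cell_boundary_hom X i (cell_class X i k) =
     int_comb (cell_chain_group X (i - 1)) {..<num_cells X (i - 1)} (cell_class X (i - 1)) (\<lambda>j. cell_boundary X i $$ (j, k))"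
  using represents_cell_boundary by (simp add: represents_boundary_def)

text \<open>The map from the vertices to a point sends all vertices to the same generator, and kills boundaries
  because the homology of the point relative to itself vanishes.\<close>

lemma column_sum_zero:
  assumes k: "k < num_cells X 1"
  shows "(\<Sum>j<num_cells X 0. cell_boundary X 1 $$ (j, k)) = 0"
proof -
  let ?pt = "discrete_topology {()}"
  let ?X = "\<lambda>j. subtopology (cw_space X) (skeleton X j)"
  let ?f = "\<lambda>_. ()"
  let ?phi = "hom_induced 0 (?X 0) {} ?pt {} ?f"
  let ?P = "homology_group 0 ?pt"
  let ?e = "hom_induced 0 (disc 0) {} ?pt {} ?f (disc_class 0)"
  have neg: "skeleton X (-1) = {}" by (rule skeleton_neg) simp
  have C0: "cell_chain_group X 0 = homology_group 0 (?X 0)"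
    by (simp add: cell_chain_group_def neg)
  have b0: "disc_boundary 0 = {}" by (simp add: disc_boundary_eq sqnorm_def)
  have top0: "topspace (disc 0) = {\<lambda>i. 0}" by (auto simp: topspace_disc sqnorm_def)
  have cont: "continuous_map T ?pt ?f" for T :: "'b topology" by simp
  interpret P: comm_group ?P by simp
  have e: "?phi (cell_class X 0 j) = ?e" if "j < num_cells X 0" for j
  proof -
    have j: "j < cw_count X 0" using that by (simp add: num_cells_def)
    have "cw_char X 0 j ` topspace (disc 0) \<subseteq> skeleton X 0"
      using closed_cell_eq[OF j] skeleton_step[of 0] j by auto
    then have "continuous_map (disc 0) (?X 0) (cw_char X 0 j)"
      using char_cont[OF j] by (auto simp: continuous_map_in_subtopology)
    then show ?thesis
      unfolding cell_class_def using cont by (simp add: neg b0 hom_induced_compose' o_def)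
  qed
  have ec: "?e \<in> carrier ?P" by (rule hom_induced_carrier)
  let ?A = "\<lambda>j. cell_boundary X 1 $$ (j, k)"
  let ?c = "cell_class X 1 k"
  have "?phi (cell_boundary_hom X 1 ?c) = \<one>\<^bsub>?P\<^esub>"
  proof -
    have "hom_relboundary 1 ?pt {()} {} \<circ> hom_induced 1 (?X 1) (skeleton X 0) ?pt {()} ?f =
         hom_induced 0 (subtopology (?X 1) (skeleton X 0)) {} (subtopology ?pt {()}) {} ?f \<circ> hom_relboundary 1 (?X 1) (skeleton X 0) {}"
      using naturality_hom_induced_relboundary[of "?X 1" ?pt ?f "skeleton X 0" "{()}" "{}" "{}" 1] cont by simp
    moreover have "subtopology ?pt {()} = ?pt" by (simp add: subtopology_superset)
    ultimately have "?phi (cell_boundary_hom X 1 ?c) = hom_relboundary 1 ?pt {()} {} (hom_induced 1 (?X 1) (skeleton X 0) ?pt {()} ?f ?c)"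
      using skeleton_skeleton[of 1] by (simp add: cell_boundary_hom_def neg fun_eq_iff)
    moreover have "hom_induced 1 (?X 1) (skeleton X 0) ?pt {()} ?f ?c = \<one>\<^bsub>relative_homology_group 1 ?pt {()}\<^esub>"
      using trivial_relative_homology_group_topspace[of 1 ?pt] hom_induced_carrier[of 1 "?X 1" "skeleton X 0" ?pt "{()}" ?f ?c]
      by (simp only: trivial_group_def topspace_discrete_topology singleton_iff)
    moreover have "hom_relboundary 1 ?pt {()} {} \<one>\<^bsub>relative_homology_group 1 ?pt {()}\<^esub> = \<one>\<^bsub>homology_group 0 (subtopology ?pt {()})\<^esub>"
      using hom_one[OF group_homomorphism_hom_relboundary[of 1 ?pt "{()}" "{}"]]
      by (simp only: group_relative_homology_group) simp
    ultimately show ?thesis using \<open>subtopology ?pt {()} = ?pt\<close> by simp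
  qed
  also have "cell_boundary_hom X 1 ?c = int_comb (cell_chain_group X 0) {..<num_cells X 0} (cell_class X 0) ?A"
    using cell_boundary_hom_class[of 1 k] k by simp
  also have "?phi \<dots> = int_comb ?P {..<num_cells X 0} (\<lambda>j. ?phi (cell_class X 0 j)) ?A"
    using cell_class_carrier[of X 0] unfolding C0 by (intro hom_int_comb) (auto simp: hom_induced_hom)
  also have "\<dots> = int_comb ?P {..<num_cells X 0} (\<lambda>j. ?e) ?A"
    using e ec by (intro P.int_comb_cong) auto
  also have "\<dots> = ?e [^]\<^bsub>?P\<^esub> (\<Sum>j<num_cells X 0. ?A j)"
    using ec by (intro P.int_comb_const) auto
  finally have one: "?e [^]\<^bsub>?P\<^esub> (\<Sum>j<num_cells X 0. ?A j) = \<one>\<^bsub>?P\<^esub>" .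
  let ?D = "homology_group 0 (disc 0)" and ?h = "hom_induced 0 (disc 0) {} ?pt {} ?f"
  have h: "?h \<in> hom ?D ?P" by (rule hom_induced_hom)
  have d: "disc_class 0 \<in> carrier ?D" using disc_class_carrier[of 0] by (simp add: b0)
  \<comment> \<open>The 0-disc is one point, so collapsing it loses nothing in homology. The common
    image of the vertices therefore has infinite order like the disc class, and a vanishing power
    forces the exponent, the column sum, to be zero.\<close>
  have "section_map (disc 0) ?pt ?f"
    unfolding section_map_def retraction_maps_def
    by (rule exI[of _ "\<lambda>_ i. 0"]) (auto simp: top0 continuous_map_from_discrete_topology)
  then have inj: "inj_on ?h (carrier ?D)" by (rule inj_on_hom_induced_section_map)
  let ?s = "\<Sum>j<num_cells X 0. ?A j"
  have "?h (disc_class 0 [^]\<^bsub>?D\<^esub> ?s) = ?h \<one>\<^bsub>?D\<^esub>"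
    using hom_int_pow[OF h d, of ?s] one hom_one[OF h] by simp
  moreover have "disc_class 0 [^]\<^bsub>?D\<^esub> ?s \<in> carrier ?D" "\<one>\<^bsub>?D\<^esub> \<in> carrier ?D"
    by (rule group.int_pow_closed[OF group_relative_homology_group d],
        rule monoid.one_closed[OF group.is_monoid[OF group_relative_homology_group]])
  ultimately have "disc_class 0 [^]\<^bsub>?D\<^esub> ?s = \<one>\<^bsub>?D\<^esub>" using inj by (metis inj_onD)
  then show ?thesis using disc_class_infinite[of 0] by (simp only: b0 of_nat_0)
qed

text \<open>Three regimes. For \<open>i \<le> 0\<close> the left factor is zero by definition. For
  \<open>i = 1\<close> it is the row of ones, so the product lists column sums. For
  \<open>i \<ge> 2\<close> both factors represent homomorphisms whose composite is trivial, and
  independence of the cell classes passes this to the coefficients.\<close>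

lemma boundary_boundary:
  "cell_boundary X (i - 1) * cell_boundary X i = 0\<^sub>m (num_cells X (i - 2)) (num_cells X i)" (is "?A * ?B = _")
proof -
  let ?p = "num_cells X (i - 2)" and ?q = "num_cells X (i - 1)" and ?n = "num_cells X i"
  have A: "?A \<in> carrier_mat ?p ?q" using cell_boundary_carrier[of "i - 1"] by simp
  have B: "?B \<in> carrier_mat ?q ?n" by (rule cell_boundary_carrier)
  have entry: "(?A * ?B) $$ (l, k) = (\<Sum>j<?q. ?A $$ (l, j) * ?B $$ (j, k))" if "l < ?p" "k < ?n" for l k
    using that A B by (simp add: scalar_prod_def lessThan_atLeast0)
  consider "i \<le> 0" | "i = 1" | "i \<ge> 2" by linarith
  then show ?thesis
  proof cases
    case 1
    then have "?A = 0\<^sub>m ?p ?q" by (simp add: cell_boundary_def)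
    then show ?thesis using B by (metis left_mult_zero_mat)
  next
    case 2
    show ?thesis
    proof (rule eq_matI)
      fix l k assume lk: "l < dim_row (0\<^sub>m ?p ?n :: int mat)" "k < dim_col (0\<^sub>m ?p ?n :: int mat)"
      then have "(?A * ?B) $$ (l, k) = (\<Sum>j<?q. ?B $$ (j, k))"
        using 2 by (subst entry) (auto simp: cell_boundary_def num_cells_def intro!: sum.cong)
      then show "(?A * ?B) $$ (l, k) = 0\<^sub>m ?p ?n $$ (l, k)"
        using column_sum_zero[of k] lk 2 by simp
    qed (use A B in auto)
  next
    case 3
    let ?C = "cell_chain_group X (i - 2)"
    interpret comm_group ?C by (rule comm_group_cell_chain)
    have cls: "cell_class X (i - 2) \<in> {..<?p} \<rightarrow> carrier ?C" using cell_class_carrier by auto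
    have "(\<Sum>j<?q. ?A $$ (l, j) * ?B $$ (j, k)) = 0" if lk: "l < ?p" "k < ?n" for l k
    proof -
      have "int_comb ?C {..<?p} (cell_class X (i - 2)) (\<lambda>l. \<Sum>j<?q. ?A $$ (l, j) * ?B $$ (j, k)) =
        int_comb ?C {..<?q} (\<lambda>j. int_comb ?C {..<?p} (cell_class X (i - 2)) (\<lambda>l. ?A $$ (l, j))) (\<lambda>j. ?B $$ (j, k))"
        using int_comb_lincomb[OF _ _ cls, of "{..<?q}" "\<lambda>j l. ?A $$ (l, j)"] by simp
      also have "\<dots> = int_comb ?C {..<?q} (\<lambda>j. cell_boundary_hom X (i - 1) (cell_class X (i - 1) j)) (\<lambda>j. ?B $$ (j, k))"
        using cell_boundary_hom_class[of "i - 1"] 3 int_comb_closed[OF cls] by (intro int_comb_cong) auto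
      also have "\<dots> = cell_boundary_hom X (i - 1) (int_comb (cell_chain_group X (i - 1)) {..<?q} (cell_class X (i - 1)) (\<lambda>j. ?B $$ (j, k)))"
        using cell_boundary_hom[of "i - 1"] cell_class_carrier comm_group_cell_chain
        by (intro hom_int_comb[symmetric]) auto
      also have "\<dots> = cell_boundary_hom X (i - 1) (cell_boundary_hom X i (cell_class X i k))"
        using cell_boundary_hom_class[of i k] 3 lk by simp
      also have "\<dots> = \<one>\<^bsub>?C\<^esub>" by (rule cell_boundary_hom_twice)
      finally have "int_comb ?C {..<?p} (cell_class X (i - 2)) (\<lambda>l. \<Sum>j<?q. ?A $$ (l, j) * ?B $$ (j, k)) = \<one>\<^bsub>?C\<^esub>" .
      moreover have "\<forall>a. int_comb ?C {..<?p} (cell_class X (i - 2)) a = \<one>\<^bsub>?C\<^esub> \<longrightarrow> (\<forall>l\<in>{..<?p}. a l = 0)"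
        using cell_chain_basis'[of "i - 2"] 3 unfolding free_basis_def by simp
      ultimately show ?thesis using lk(1) by blast
    qed
    then show ?thesis using A B entry by (intro eq_matI) auto
  qed
qed

end

section \<open>Cells and boundary matrices of a skeleton\<close>

lemma num_cells_skeleton: "is_skeleton X Y d \<Longrightarrow> i \<le> d \<Longrightarrow> num_cells X i = num_cells Y i"
  by (auto simp: is_skeleton_def num_cells_def)

lemma skeleton_skeleton_eq:
  assumes "is_skeleton X Y d" "i \<le> d"
  shows "skeleton X i = skeleton Y i"
proof -
  have "open_cell X m k = open_cell Y m k" if "int m \<le> i" "k < cw_count X m" for m k
  proof -
    have "cw_char X m k x = cw_char Y m k x" if "x \<in> topspace (disc m)" for x
      using assms that \<open>k < cw_count X m\<close> unfolding is_skeleton_def by blast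
    then show ?thesis
      unfolding open_cell_def using disc_Un[of m] by (intro image_cong) auto
  qed
  moreover have "cw_count X m = cw_count Y m" if "int m \<le> i" for m
    using assms that by (auto simp: is_skeleton_def)
  ultimately show ?thesis unfolding skeleton_def by simp
qed

text \<open>Up to degree \<open>d\<close> both complexes have the same skeleta, topologies and chain
  groups, so the two matrices satisfy one and the same description. The characteristic maps agree
  only on the disc, which suffices because an induced map depends only on the values there.\<close>

lemma cell_boundary_skeleton:
  assumes sk: "is_skeleton X Y d" and i: "i \<le> d"
  shows "cell_boundary X i = cell_boundary Y i"
proof (cases "i \<ge> 1")
  case True
  have X: "cw_space X = subtopology (cw_space Y) (skeleton Y d)"
    using sk by (simp add: is_skeleton_def)
  have mono: "skeleton Y j \<subseteq> skeleton Y d" if "j \<le> d" for j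
    using that unfolding skeleton_def by force
  have space: "subtopology (cw_space X) (skeleton X j) = subtopology (cw_space Y) (skeleton Y j)" if "j \<le> d" for j
    unfolding X skeleton_skeleton_eq[OF sk that] using mono[OF that]
    by (simp add: subtopology_subtopology Int_absorb1)
  have chain: "cell_chain_group X j = cell_chain_group Y j" if "j \<le> d" for j
    unfolding cell_chain_group_def using that space skeleton_skeleton_eq[OF sk] by simp
  have cls: "cell_class X j k = cell_class Y j k" if "0 \<le> j" "j \<le> d" "k < num_cells X j" for j k
  proof -
    have "cw_char X (nat j) k x = cw_char Y (nat j) k x" if "x \<in> topspace (disc (nat j))" for x
      using sk that \<open>k < num_cells X j\<close> \<open>0 \<le> j\<close> unfolding is_skeleton_def num_cells_def by simp
    moreover have "skeleton X (j - 1) = skeleton Y (j - 1)"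
      using that(2) by (intro skeleton_skeleton_eq[OF sk]) simp
    ultimately show ?thesis
      unfolding cell_class_def space[OF that(2)] by (simp only:) (rule fun_cong[OF hom_induced_eq])
  qed
  have bd: "cell_boundary_hom X i = cell_boundary_hom Y i"
    unfolding cell_boundary_hom_def using i space skeleton_skeleton_eq[OF sk] by simp
  have "represents_boundary X i A = represents_boundary Y i A" for A
  proof -
    interpret comm_group "cell_chain_group X (i - 1)" by (rule comm_group_cell_chain)
    have "int_comb (cell_chain_group X (i - 1)) {..<num_cells X (i - 1)} (cell_class X (i - 1)) a =
      int_comb (cell_chain_group Y (i - 1)) {..<num_cells Y (i - 1)} (cell_class Y (i - 1)) a" for a
      using i True cls cell_class_carrier[of X "i - 1"] num_cells_skeleton[OF sk, of "i - 1"]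
      by (simp add: chain[symmetric]) (rule int_comb_cong, auto)
    then show ?thesis
      using i True bd cls num_cells_skeleton[OF sk] by (simp add: represents_boundary_def)
  qed
  then show ?thesis using True by (simp add: cell_boundary_eq_The)
next
  case False
  then show ?thesis using num_cells_skeleton[OF sk] i by (simp add: cell_boundary_def)
qed

section \<open>Diagonalizing integer matrices\<close>

text \<open>The inverses are recorded as integer matrices, which expresses unimodularity without
  determinants.\<close>

definition mat_equiv :: "nat \<Rightarrow> nat \<Rightarrow> int mat \<Rightarrow> int mat \<Rightarrow> bool" where
  "mat_equiv p n D S \<longleftrightarrow> (\<exists>P P' Q Q'. P \<in> carrier_mat p p \<and> P' \<in> carrier_mat p p \<and>
     Q \<in> carrier_mat n n \<and> Q' \<in> carrier_mat n n \<and> P * P' = 1\<^sub>m p \<and> P' * P = 1\<^sub>m p \<and>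
     Q * Q' = 1\<^sub>m n \<and> Q' * Q = 1\<^sub>m n \<and> S = P * D * Q)"

lemma mult_mat_assoc_dim:
  fixes A B C :: "'a::semiring_0 mat"
  assumes "dim_col A = dim_row B" "dim_col B = dim_row C"
  shows "A * B * C = A * (B * C)"
  using assms by (intro assoc_mult_mat[of _ "dim_row A" "dim_col A" _ "dim_col B" _ "dim_col C"]) auto

lemma mat_equiv_refl:
  assumes "D \<in> carrier_mat p n"
  shows "mat_equiv p n D D"
  unfolding mat_equiv_def
  by (rule exI[of _ "1\<^sub>m p"], rule exI[of _ "1\<^sub>m p"], rule exI[of _ "1\<^sub>m n"], rule exI[of _ "1\<^sub>m n"]) (use assms in auto)

lemma cancel_inverses:
  fixes A :: "int mat"
  assumes "A \<in> carrier_mat p p" "A' \<in> carrier_mat p p" "B \<in> carrier_mat p p" "B' \<in> carrier_mat p p"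
    "A * A' = 1\<^sub>m p" "B * B' = 1\<^sub>m p"
  shows "(A * B) * (B' * A') = 1\<^sub>m p"
proof -
  have "(A * B) * (B' * A') = A * ((B * B') * A')"
    using assms(1-4) by (simp add: mult_mat_assoc_dim)
  then show ?thesis using assms by simp
qed

lemma mat_equiv_carrier: "mat_equiv p n D S \<Longrightarrow> D \<in> carrier_mat p n \<Longrightarrow> S \<in> carrier_mat p n"
  unfolding mat_equiv_def by auto

lemma mat_equiv_left:
  assumes "mat_equiv p n D S" "D \<in> carrier_mat p n" "L \<in> carrier_mat p p" "L' \<in> carrier_mat p p" "L * L' = 1\<^sub>m p" "L' * L = 1\<^sub>m p"
  shows "mat_equiv p n D (L * S)"
proof -
  obtain P P' Q Q' where PQ: "P \<in> carrier_mat p p" "P' \<in> carrier_mat p p" "Q \<in> carrier_mat n n" "Q' \<in> carrier_mat n n"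
    "P * P' = 1\<^sub>m p" "P' * P = 1\<^sub>m p" "Q * Q' = 1\<^sub>m n" "Q' * Q = 1\<^sub>m n" "S = P * D * Q"
    using assms(1) unfolding mat_equiv_def by blast
  have "L * S = (L * P) * D * Q" using PQ(1-4) assms(2,3) by (simp add: PQ(9) mult_mat_assoc_dim)
  moreover have "(L * P) * (P' * L') = 1\<^sub>m p" "(P' * L') * (L * P) = 1\<^sub>m p"
    using PQ assms by (auto intro!: cancel_inverses)
  ultimately show ?thesis
    using PQ(1-8) assms(3,4) mult_carrier_mat[of L p p P p] mult_carrier_mat[of P' p p L' p]
    unfolding mat_equiv_def by metis
qed

lemma mat_equiv_right:
  assumes "mat_equiv p n D S" "D \<in> carrier_mat p n" "L \<in> carrier_mat n n" "L' \<in> carrier_mat n n" "L * L' = 1\<^sub>m n" "L' * L = 1\<^sub>m n"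
  shows "mat_equiv p n D (S * L)"
proof -
  obtain P P' Q Q' where PQ: "P \<in> carrier_mat p p" "P' \<in> carrier_mat p p" "Q \<in> carrier_mat n n" "Q' \<in> carrier_mat n n"
    "P * P' = 1\<^sub>m p" "P' * P = 1\<^sub>m p" "Q * Q' = 1\<^sub>m n" "Q' * Q = 1\<^sub>m n" "S = P * D * Q"
    using assms(1) unfolding mat_equiv_def by blast
  have "S * L = P * D * (Q * L)" using PQ(1-4) assms(2,3) by (simp add: PQ(9) mult_mat_assoc_dim)
  moreover have "(Q * L) * (L' * Q') = 1\<^sub>m n" "(L' * Q') * (Q * L) = 1\<^sub>m n"
    using PQ assms by (auto intro!: cancel_inverses)
  ultimately show ?thesis
    using PQ(1-8) assms(3,4) mult_carrier_mat[of Q n n L n] mult_carrier_mat[of L' n n Q' n]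
    unfolding mat_equiv_def by metis
qed

text \<open>Left multiplication adds \<open>q i\<close> times row \<open>a\<close> to every other
  row \<open>i\<close> at once. The value \<open>q a\<close> is ignored, so row \<open>a\<close> is
  preserved and negating \<open>q\<close> gives the inverse; one such operation treats a whole
  column.\<close>

definition row_op :: "nat \<Rightarrow> nat \<Rightarrow> (nat \<Rightarrow> int) \<Rightarrow> int mat" where
  "row_op p a q = mat p p (\<lambda>(i, k). (if k = i then 1 else 0) + (if k = a then (if i = a then 0 else q i) else 0))"

lemma row_op_carrier [simp]: "row_op p a q \<in> carrier_mat p p"
  by (simp add: row_op_def)

lemma row_op_mult:
  assumes "S \<in> carrier_mat p n" "i < p" "j < n" "a < p"
  shows "(row_op p a q * S) $$ (i, j) = S $$ (i, j) + (if i = a then 0 else q i * S $$ (a, j))"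
proof -
  have "(row_op p a q * S) $$ (i, j) = (\<Sum>k\<in>{0..<p}. row_op p a q $$ (i, k) * S $$ (k, j))"
    using assms by (simp add: scalar_prod_def row_op_def)
  also have "\<dots> = (\<Sum>k\<in>{0..<p}. (if k = i then S $$ (k, j) else 0) + (if k = a then (if i = a then 0 else q i) * S $$ (k, j) else 0))"
    using assms by (intro sum.cong) (auto simp: row_op_def algebra_simps)
  also have "\<dots> = S $$ (i, j) + (if i = a then 0 else q i * S $$ (a, j))"
    using assms by (simp add: sum.distrib)
  finally show ?thesis .
qed

lemma row_op_inverse:
  assumes "a < p"
  shows "row_op p a q * row_op p a (\<lambda>i. - q i) = 1\<^sub>m p"
  using assms by (intro eq_matI) (auto simp: row_op_mult[of _ p p] simp del: index_mult_mat(1), auto simp: row_op_def)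

lemma row_op_inverse': "a < p \<Longrightarrow> row_op p a (\<lambda>i. - q i) * row_op p a q = 1\<^sub>m p"
  using row_op_inverse[of a p "\<lambda>i. - q i"] by simp

lemma col_op_mult:
  assumes "S \<in> carrier_mat p n" "i < p" "j < n" "b < n"
  shows "(S * transpose_mat (row_op n b q)) $$ (i, j) = S $$ (i, j) + (if j = b then 0 else q j * S $$ (i, b))"
proof -
  have "S * transpose_mat (row_op n b q) = transpose_mat (row_op n b q * transpose_mat S)"
    using assms by (subst transpose_mult[of _ n n _ p]) auto
  then show ?thesis
    using assms row_op_mult[of "transpose_mat S" n p j i b q]
    by (simp del: index_mult_mat(1) add: row_op_def)
qed

lemma mat_equiv_row_op:
  "mat_equiv p n D S \<Longrightarrow> D \<in> carrier_mat p n \<Longrightarrow> a < p \<Longrightarrow> mat_equiv p n D (row_op p a q * S)"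
  by (rule mat_equiv_left[where L' = "row_op p a (\<lambda>i. - q i)"]) (auto simp: row_op_inverse row_op_inverse')

lemma mat_equiv_col_op:
  assumes "mat_equiv p n D S" "D \<in> carrier_mat p n" "b < n"
  shows "mat_equiv p n D (S * transpose_mat (row_op n b q))"
proof (rule mat_equiv_right[OF assms(1,2)])
  let ?L = "transpose_mat (row_op n b q)" and ?L' = "transpose_mat (row_op n b (\<lambda>i. - q i))"
  show "?L * ?L' = 1\<^sub>m n" "?L' * ?L = 1\<^sub>m n"
    using row_op_inverse[OF assms(3)] row_op_inverse'[OF assms(3)]
    by (subst transpose_mult[of _ n n _ n, symmetric]; simp)+
qed auto

section \<open>Reduction to a matrix with isolated nonzero entries\<close>

definition isolated_entry :: "nat \<Rightarrow> nat \<Rightarrow> int mat \<Rightarrow> nat \<Rightarrow> nat \<Rightarrow> bool" where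
  "isolated_entry p n S i j \<longleftrightarrow> (\<forall>j'<n. j' \<noteq> j \<longrightarrow> S $$ (i, j') = 0) \<and> (\<forall>i'<p. i' \<noteq> i \<longrightarrow> S $$ (i', j) = 0)"

text \<open>A pivot of minimal absolute value outside the rows already treated
  divides its row and its column.\<close>

lemma mat_equiv_monomial:
  assumes D: "D \<in> carrier_mat p n"
  shows "\<exists>S. mat_equiv p n D S \<and> (\<forall>i<p. \<forall>j<n. S $$ (i, j) \<noteq> 0 \<longrightarrow> isolated_entry p n S i j)"
proof -
  \<comment> \<open>\<open>R\<close> collects the rows already treated. An extremal argument
    replaces the elimination algorithm: fix a pair with as many treated rows as possible; any pivot
    left over would allow one more row.\<close>
  define good where "good = (\<lambda>(R, S). R \<subseteq> {..<p} \<and> mat_equiv p n D S \<and>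
    (\<forall>i\<in>R. \<forall>j<n. S $$ (i, j) \<noteq> 0 \<longrightarrow> isolated_entry p n S i j))"
  have "good ({}, D)" using mat_equiv_refl[OF D] by (simp add: good_def)
  moreover have "\<forall>z. good z \<longrightarrow> card (fst z) < Suc p"
  proof (intro allI impI)
    fix z assume "good z"
    then have "fst z \<subseteq> {..<p}" by (auto simp: good_def split: prod.splits)
    from card_mono[OF _ this] show "card (fst z) < Suc p" by simp
  qed
  ultimately have "\<exists>z. good z \<and> (\<forall>z'. good z' \<longrightarrow> card (fst z') \<le> card (fst z))"
    by (rule Lattices_Big.ex_has_greatest_nat)
  then obtain z where "good z" and max: "\<And>z'. good z' \<Longrightarrow> card (fst z') \<le> card (fst z)"
    by metis
  then obtain R S0 where z: "z = (R, S0)" "good (R, S0)" by (cases z) auto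
  have R: "finite R" "R \<subseteq> {..<p}" using z(2) finite_subset[of R "{..<p}"] by (auto simp: good_def)
  \<comment> \<open>The minimum below ranges over all good matrices with this \<open>R\<close>, not
    over the entries of one matrix. A nonzero remainder produced by a row or column operation is
    thus an immediate contradiction.\<close>
  define piv where "piv = (\<lambda>(S, i, j). good (R, S) \<and> i < p \<and> i \<notin> R \<and> j < n \<and> S $$ (i, j) \<noteq> 0)"
  have "\<not> piv (S, i, j)" for S i j
  proof
    assume "piv (S, i, j)"
    then have "\<exists>w. piv w \<and> (\<forall>w'. piv w' \<longrightarrow> (case w of (S, i, j) \<Rightarrow> nat \<bar>S $$ (i, j)\<bar>) \<le> (case w' of (S, i, j) \<Rightarrow> nat \<bar>S $$ (i, j)\<bar>))"
      by (rule ex_has_least_nat)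
    then obtain w where w: "piv w" and min: "\<And>w'. piv w' \<Longrightarrow> (case w of (S, i, j) \<Rightarrow> nat \<bar>S $$ (i, j)\<bar>) \<le> (case w' of (S, i, j) \<Rightarrow> nat \<bar>S $$ (i, j)\<bar>)"
      by metis
    obtain T a b where wT: "w = (T, a, b)" by (cases w)
    have T: "good (R, T)" "a < p" "a \<notin> R" "b < n" "T $$ (a, b) \<noteq> 0" using w by (auto simp: piv_def wT)
    have min': "nat \<bar>T $$ (a, b)\<bar> \<le> nat \<bar>T' $$ (i, j)\<bar>" if "piv (T', i, j)" for T' i j
      using min[OF that] by (simp add: wT)
    have Teq: "mat_equiv p n D T" and Tiso: "\<And>i j. i \<in> R \<Longrightarrow> j < n \<Longrightarrow> T $$ (i, j) \<noteq> 0 \<Longrightarrow> isolated_entry p n T i j"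
      using T(1) by (auto simp: good_def)
    have Tc: "T \<in> carrier_mat p n" using mat_equiv_carrier[OF Teq D] .
    let ?v = "T $$ (a, b)"
    have Tb: "T $$ (i, b) = 0" if "i \<in> R" for i
    proof (rule ccontr)
      assume "T $$ (i, b) \<noteq> 0"
      then have "isolated_entry p n T i b" by (rule Tiso[OF that T(4)])
      moreover have "a \<noteq> i" using that T(3) by auto
      ultimately show False using T(2,5) unfolding isolated_entry_def by simp
    qed
    \<comment> \<open>Leaves remainders modulo the pivot in column \<open>b\<close>. In treated rows
      the entry of that column is 0, so \<open>q\<close> vanishes there and these rows are
      unchanged.\<close>
    define q where "q i = - (T $$ (i, b) div ?v)" for i
    define T1 where "T1 = row_op p a q * T"
    have T1e: "T1 $$ (i, j) = T $$ (i, j) + (if i = a then 0 else q i * T $$ (a, j))" if "i < p" "j < n" for i j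
      unfolding T1_def using row_op_mult[OF Tc that T(2)] .
    have T1eq: "mat_equiv p n D T1" unfolding T1_def by (rule mat_equiv_row_op[OF Teq D T(2)])
    have T1c: "T1 \<in> carrier_mat p n" using mat_equiv_carrier[OF T1eq D] .
    have T1R: "T1 $$ (i, j) = T $$ (i, j)" if "i \<in> R" "j < n" for i j
      using that R(2) T1e[of i j] Tb[of i] by (auto simp: q_def)
    have "good (R, T1)"
      unfolding good_def using R T1eq
    proof (clarsimp)
      fix i j assume ij: "i \<in> R" "j < n" "T1 $$ (i, j) \<noteq> 0"
      then have iso: "isolated_entry p n T i j" using Tiso T1R by auto
      have "T $$ (a, j) = 0" using iso T(2,3) ij(1) unfolding isolated_entry_def by auto
      then have "T1 $$ (i', j) = T $$ (i', j)" if "i' < p" for i' using T1e[OF that ij(2)] by simp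
      then show "isolated_entry p n T1 i j"
        using iso T1R[OF ij(1)] unfolding isolated_entry_def by auto
    qed
    have T1ab: "T1 $$ (a, b) = ?v" using T1e[OF T(2,4)] by simp
    have T1col: "T1 $$ (i, b) = 0" if "i < p" "i \<noteq> a" for i
    proof (rule ccontr)
      assume nz: "T1 $$ (i, b) \<noteq> 0"
      then have "i \<notin> R" using T1R[OF _ T(4)] Tb by auto
      then have "piv (T1, i, b)" using nz that T(4) \<open>good (R, T1)\<close> by (simp add: piv_def)
      then have "nat \<bar>?v\<bar> \<le> nat \<bar>T1 $$ (i, b)\<bar>" by (rule min')
      moreover have "T1 $$ (i, b) = T $$ (i, b) mod ?v"
        using T1e[OF that(1) T(4)] that(2) by (simp add: q_def minus_div_mult_eq_mod[symmetric])
      moreover have "\<bar>T $$ (i, b) mod ?v\<bar> < \<bar>?v\<bar>" using T(5) by (rule abs_mod_less)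
      ultimately show False by simp
    qed
    \<comment> \<open>Column \<open>b\<close> is by now zero outside the pivot, so this column
      operation alters row \<open>a\<close> only, and the entries isolated before stay
      isolated.\<close>
    define r where "r j = - (T1 $$ (a, j) div ?v)" for j
    define T2 where "T2 = T1 * transpose_mat (row_op n b r)"
    have T2e: "T2 $$ (i, j) = T1 $$ (i, j) + (if j = b then 0 else r j * T1 $$ (i, b))" if "i < p" "j < n" for i j
      unfolding T2_def using col_op_mult[OF T1c that T(4)] .
    have T2eq: "mat_equiv p n D T2" unfolding T2_def by (rule mat_equiv_col_op[OF T1eq D T(4)])
    have T2row: "T2 $$ (i, j) = T1 $$ (i, j)" if "i < p" "j < n" "i \<noteq> a" for i j
      using T2e[OF that(1,2)] T1col[OF that(1,3)] by simp
    have T1iso: "isolated_entry p n T1 i j" if "i \<in> R" "j < n" "T1 $$ (i, j) \<noteq> 0" for i j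
      using \<open>good (R, T1)\<close> that by (auto simp: good_def)
    have T2iso: "isolated_entry p n T2 i j" if "i \<in> R" "j < n" "T2 $$ (i, j) \<noteq> 0" for i j
    proof -
      have i: "i < p" "i \<noteq> a" using that R T(3) by auto
      have nz: "T1 $$ (i, j) \<noteq> 0" using T2row[OF i(1) that(2) i(2)] that(3) by simp
      then have iso: "isolated_entry p n T1 i j" using T1iso that by blast
      then have "T1 $$ (a, j) = 0" using i T(2) unfolding isolated_entry_def by auto
      then have "T2 $$ (i', j) = T1 $$ (i', j)" if "i' < p" for i'
        using T2e[OF that \<open>j < n\<close>] by (simp add: r_def)
      then show ?thesis using iso T2row[OF i(1) _ i(2)] unfolding isolated_entry_def by auto
    qed
    then have "good (R, T2)" using R T2eq by (auto simp: good_def)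
    have T2a: "T2 $$ (a, j) = 0" if "j < n" "j \<noteq> b" for j
    proof (rule ccontr)
      assume nz: "T2 $$ (a, j) \<noteq> 0"
      then have "piv (T2, a, j)" using T(2,3) that \<open>good (R, T2)\<close> by (simp add: piv_def)
      then have "nat \<bar>?v\<bar> \<le> nat \<bar>T2 $$ (a, j)\<bar>" by (rule min')
      moreover have "T2 $$ (a, j) = T1 $$ (a, j) mod ?v"
        using T2e[OF T(2) that(1)] that(2) T1ab by (simp add: r_def minus_div_mult_eq_mod[symmetric])
      moreover have "\<bar>T1 $$ (a, j) mod ?v\<bar> < \<bar>?v\<bar>" using T(5) by (rule abs_mod_less)
      ultimately show False by simp
    qed
    have T2b: "T2 $$ (i, b) = 0" if "i < p" "i \<noteq> a" for i
      using T2row[OF that(1) T(4) that(2)] T1col[OF that] by simp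
    have "isolated_entry p n T2 a j" if "j < n" "T2 $$ (a, j) \<noteq> 0" for j
      using T2a T2b that unfolding isolated_entry_def by metis
    then have "good (insert a R, T2)" using \<open>good (R, T2)\<close> T(2) by (auto simp: good_def)
    from max[OF this] show False using z(1) R T(3) by simp
  qed
  then have npiv: "\<not> piv (S0, i, j)" for i j by blast
  have "isolated_entry p n S0 i j" if "i < p" "j < n" "S0 $$ (i, j) \<noteq> 0" for i j
  proof (cases "i \<in> R")
    case True
    then show ?thesis using z(2) that by (auto simp: good_def)
  next
    case False
    then show ?thesis using npiv[of i j] z(2) that by (simp add: piv_def)
  qed
  then show ?thesis using z(2) by (auto simp: good_def)
qed

lemma mat_mult_entry:
  assumes "A \<in> carrier_mat p q" "B \<in> carrier_mat q n" "i < p" "j < n"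
  shows "(A * B) $$ (i, j) = (\<Sum>k\<in>{0..<q}. A $$ (i, k) * B $$ (k, j))"
  using assms by (simp add: scalar_prod_def)

text \<open>\<open>J\<close> is the transposed pattern of the nonzero entries of \<open>S\<close>.\<close>

lemma monomial_pattern:
  assumes S: "S \<in> carrier_mat p n"
    and iso: "\<And>i j. i < p \<Longrightarrow> j < n \<Longrightarrow> S $$ (i, j) \<noteq> 0 \<Longrightarrow> isolated_entry p n S i j"
  shows "\<exists>J W m. J \<in> carrier_mat n p \<and> W \<in> carrier_mat p n \<and> m > 0 \<and>
    J * S * J = transpose_mat S \<and> transpose_mat J * J * S = S \<and> S * J * transpose_mat J = S \<and>
    transpose_mat S * W = m \<cdot>\<^sub>m (J * transpose_mat J)"
proof -
  define J where "J = mat n p (\<lambda>(j, i). if S $$ (i, j) \<noteq> 0 then 1 else 0 :: int)"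
  have J: "J \<in> carrier_mat n p" by (simp add: J_def)
  define K where "K = {(i, j). i < p \<and> j < n \<and> S $$ (i, j) \<noteq> 0}"
  have K: "finite K" unfolding K_def by (rule finite_subset[of _ "{..<p} \<times> {..<n}"]) auto
  \<comment> \<open>A common multiple of all nonzero entries, so that the divisions defining
    \<open>W\<close> are exact.\<close>
  define m where "m = (\<Prod>(i, j)\<in>K. \<bar>S $$ (i, j)\<bar>)"
  have m: "m > 0" unfolding m_def by (rule prod_pos) (auto simp: K_def)
  define W where "W = mat p n (\<lambda>(i, j). if S $$ (i, j) \<noteq> 0 then m div S $$ (i, j) else 0)"
  have W: "W \<in> carrier_mat p n" by (simp add: W_def)
  have mdvd: "S $$ (i, j) * (m div S $$ (i, j)) = m" if "i < p" "j < n" "S $$ (i, j) \<noteq> 0" for i j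
  proof -
    have "\<bar>S $$ (i, j)\<bar> dvd m" unfolding m_def
      using dvd_prodI[OF K, of "(i, j)" "\<lambda>(i, j). \<bar>S $$ (i, j)\<bar>"] that by (simp add: K_def)
    then show ?thesis by simp
  qed
  have row: "S $$ (i, j') = 0" if "i < p" "j < n" "j' < n" "S $$ (i, j) \<noteq> 0" "j' \<noteq> j" for i j j'
    using iso[OF that(1,2,4)] that unfolding isolated_entry_def by auto
  have col: "S $$ (i', j) = 0" if "i < p" "j < n" "i' < p" "S $$ (i, j) \<noteq> 0" "i' \<noteq> i" for i j i'
    using iso[OF that(1,2,4)] that unfolding isolated_entry_def by auto
  have one_sum: "(\<Sum>k\<in>{0..<l}. f k) = f k0" if "k0 < l" "\<And>k. k < l \<Longrightarrow> k \<noteq> k0 \<Longrightarrow> f k = 0" for l k0 and f :: "nat \<Rightarrow> int"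
    using that by (subst sum.remove[of _ k0]) (auto intro!: sum.neutral)
  \<comment> \<open>\<open>J * S\<close> is diagonal. Column \<open>j\<close> has at most one
    nonzero entry, and the column sum names it without choosing its row.\<close>
  have JS: "(J * S) $$ (j, j') = (if j' = j then (\<Sum>i\<in>{0..<p}. S $$ (i, j)) else 0)" if "j < n" "j' < n" for j j'
  proof -
    have "(J * S) $$ (j, j') = (\<Sum>i\<in>{0..<p}. (if S $$ (i, j) \<noteq> 0 then 1 else 0) * S $$ (i, j'))"
      using that S J by (simp add: scalar_prod_def J_def)
    also have "\<dots> = (\<Sum>i\<in>{0..<p}. if j' = j then S $$ (i, j) else 0)"
    proof (rule sum.cong[OF refl])
      fix i assume i: "i \<in> {0..<p}"
      then show "(if S $$ (i, j) \<noteq> 0 then 1 else 0) * S $$ (i, j') = (if j' = j then S $$ (i, j) else 0)"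
        using row[of i j j'] that by simp
    qed
    finally show ?thesis by simp
  qed
  \<comment> \<open>The products of \<open>J\<close> and its transpose in the two orders are 0/1
    diagonal matrices: one marks the nonzero rows of \<open>S\<close>, the other its nonzero
    columns.\<close>
  have JJ: "(transpose_mat J * J) $$ (i, i') = (if i' = i \<and> (\<exists>j<n. S $$ (i, j) \<noteq> 0) then 1 else 0)" if "i < p" "i' < p" for i i'
  proof -
    have "(transpose_mat J * J) $$ (i, i') = (\<Sum>j\<in>{0..<n}. (if S $$ (i, j) \<noteq> 0 then 1 else 0) * (if S $$ (i', j) \<noteq> 0 then 1 else 0))"
      using that J by (simp add: scalar_prod_def J_def)
    also have "\<dots> = (if i' = i \<and> (\<exists>j<n. S $$ (i, j) \<noteq> 0) then 1 else 0)"
    proof (cases "\<exists>j<n. S $$ (i, j) \<noteq> 0")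
      case True
      then obtain j where j: "j < n" "S $$ (i, j) \<noteq> 0" by blast
      show ?thesis
        by (subst one_sum[of j]) (use j True that row[OF that(1) j(1) _ j(2)] col[OF that(1) j(1) _ j(2)] in \<open>auto simp: row[OF that(1) j(1) _ j(2)]\<close>)
    qed (auto intro!: sum.neutral)
    finally show ?thesis .
  qed
  have JJ': "(J * transpose_mat J) $$ (j, j') = (if j' = j \<and> (\<exists>i<p. S $$ (i, j) \<noteq> 0) then 1 else 0)" if "j < n" "j' < n" for j j'
  proof -
    have "(J * transpose_mat J) $$ (j, j') = (\<Sum>i\<in>{0..<p}. (if S $$ (i, j) \<noteq> 0 then 1 else 0) * (if S $$ (i, j') \<noteq> 0 then 1 else 0))"
      using that J by (simp add: scalar_prod_def J_def)
    also have "\<dots> = (if j' = j \<and> (\<exists>i<p. S $$ (i, j) \<noteq> 0) then 1 else 0)"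
    proof (cases "\<exists>i<p. S $$ (i, j) \<noteq> 0")
      case True
      then obtain i where i: "i < p" "S $$ (i, j) \<noteq> 0" by blast
      show ?thesis
        by (subst one_sum[of i]) (use i True that row[OF i(1) that(1) _ i(2)] col[OF i(1) that(1) _ i(2)] in auto)
    qed (auto intro!: sum.neutral)
    finally show ?thesis .
  qed
  have "J * S * J = transpose_mat S"
  proof (rule eq_matI)
    fix j i assume "j < dim_row (transpose_mat S)" "i < dim_col (transpose_mat S)"
    then have ji: "j < n" "i < p" using S by auto
    have "(J * S * J) $$ (j, i) = (\<Sum>j'\<in>{0..<n}. (J * S) $$ (j, j') * J $$ (j', i))"
      using ji by (intro mat_mult_entry[OF mult_carrier_mat[OF J S] J])
    also have "\<dots> = (J * S) $$ (j, j) * J $$ (j, i)"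
      using ji JS by (intro one_sum) (auto simp del: index_mult_mat(1))
    also have "\<dots> = S $$ (i, j)"
    proof (cases "S $$ (i, j) = 0")
      case False
      have "(\<Sum>i\<in>{0..<p}. S $$ (i, j)) = S $$ (i, j)"
        using ji col[OF ji(2,1) _ False] by (intro one_sum) auto
      then show ?thesis using ji JS[of j j] False by (simp add: J_def del: index_mult_mat(1))
    qed (use ji in \<open>simp add: J_def\<close>)
    finally show "(J * S * J) $$ (j, i) = transpose_mat S $$ (j, i)" using ji S by simp
  qed (use J S in auto)
  moreover have "transpose_mat J * J * S = S"
  proof (rule eq_matI)
    fix i j assume "i < dim_row S" "j < dim_col S"
    then have ij: "i < p" "j < n" using S by auto
    have "(transpose_mat J * J * S) $$ (i, j) = (\<Sum>i'\<in>{0..<p}. (transpose_mat J * J) $$ (i, i') * S $$ (i', j))"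
      using ij J by (intro mat_mult_entry[OF mult_carrier_mat[OF _ J] S]) simp_all
    also have "\<dots> = (transpose_mat J * J) $$ (i, i) * S $$ (i, j)"
      using ij JJ by (intro one_sum) (auto simp del: index_mult_mat(1))
    also have "\<dots> = S $$ (i, j)"
      using ij JJ[of i i] by (auto simp del: index_mult_mat(1))
    finally show "(transpose_mat J * J * S) $$ (i, j) = S $$ (i, j)" .
  qed (use J S in auto)
  moreover have "S * J * transpose_mat J = S"
  proof (rule eq_matI)
    fix i j assume "i < dim_row S" "j < dim_col S"
    then have ij: "i < p" "j < n" using S by auto
    have "(S * (J * transpose_mat J)) $$ (i, j) = (\<Sum>j'\<in>{0..<n}. S $$ (i, j') * (J * transpose_mat J) $$ (j', j))"
      using ij J by (intro mat_mult_entry[OF S mult_carrier_mat[OF J]]) simp_all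
    also have "\<dots> = S $$ (i, j) * (J * transpose_mat J) $$ (j, j)"
      using ij JJ' by (intro one_sum) (auto simp del: index_mult_mat(1))
    also have "\<dots> = S $$ (i, j)"
      using ij JJ'[of j j] by (auto simp del: index_mult_mat(1))
    finally show "(S * J * transpose_mat J) $$ (i, j) = S $$ (i, j)"
      using J S by (simp add: mult_mat_assoc_dim)
  qed (use J S in auto)
  moreover have "transpose_mat S * W = m \<cdot>\<^sub>m (J * transpose_mat J)"
  proof (rule eq_matI)
    fix j j' assume "j < dim_row (m \<cdot>\<^sub>m (J * transpose_mat J))" "j' < dim_col (m \<cdot>\<^sub>m (J * transpose_mat J))"
    then have jj: "j < n" "j' < n" using J by auto
    have "(transpose_mat S * W) $$ (j, j') = (\<Sum>i\<in>{0..<p}. S $$ (i, j) * W $$ (i, j'))"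
      using jj W S by (simp add: scalar_prod_def)
    also have "\<dots> = m * (if j' = j \<and> (\<exists>i<p. S $$ (i, j) \<noteq> 0) then 1 else 0)"
    proof (cases "\<exists>i<p. S $$ (i, j) \<noteq> 0")
      case True
      then obtain i where i: "i < p" "S $$ (i, j) \<noteq> 0" by blast
      show ?thesis
        by (subst one_sum[of i]) (use i True jj row[OF i(1) jj(1) _ i(2)] col[OF i(1) jj(1) _ i(2)] mdvd[OF i(1) jj(1) i(2)] in \<open>auto simp: W_def\<close>)
    qed (auto intro!: sum.neutral)
    finally show "(transpose_mat S * W) $$ (j, j') = (m \<cdot>\<^sub>m (J * transpose_mat J)) $$ (j, j')"
      using JJ'[OF jj] jj J by (simp del: index_mult_mat(1))
  qed (use J S W in auto)
  ultimately show ?thesis using J W m by blast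
qed

text \<open>The right-nested shape in which an inverse pair meets after a long product has been
  fully reassociated.\<close>

lemma dim_cancel:
  fixes A B X :: "'a::semiring_1 mat"
  assumes "A * B = 1\<^sub>m k" "dim_col A = dim_row B" "dim_col B = dim_row X" "dim_row X = k"
  shows "A * (B * X) = X"
  using assms by (simp flip: mult_mat_assoc_dim)

text \<open>The torsion of the cokernels of \<open>D\<close> and of its transpose agree via \<open>M\<close> and \<open>N\<close>;
  \<open>E\<close> is an integral idempotent onto the kernel of \<open>D\<close>.\<close>

lemma torsion_transfer_matrices:
  fixes D :: "int mat"
  assumes D: "D \<in> carrier_mat p n"
  obtains M N U V E W m where
    "M \<in> carrier_mat n p" "N \<in> carrier_mat p n" "U \<in> carrier_mat p n" "V \<in> carrier_mat n p"
    "E \<in> carrier_mat n n" "W \<in> carrier_mat p n" "(m::int) > 0"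
    "N * M * D = D" "M * N * transpose_mat D = transpose_mat D"
    "M * D = transpose_mat D * U" "N * transpose_mat D = D * V"
    "D * E = 0\<^sub>m p n" "transpose_mat D * W = m \<cdot>\<^sub>m (1\<^sub>m n - transpose_mat E)"
proof -
  obtain S where S: "mat_equiv p n D S" "\<And>i j. i < p \<Longrightarrow> j < n \<Longrightarrow> S $$ (i, j) \<noteq> 0 \<Longrightarrow> isolated_entry p n S i j"
    using mat_equiv_monomial[OF D] by blast
  have Sc: "S \<in> carrier_mat p n" using mat_equiv_carrier[OF S(1) D] .
  obtain J W0 m where J: "J \<in> carrier_mat n p" "W0 \<in> carrier_mat p n" "m > 0"
    and JSJ: "J * S * J = transpose_mat S" and JJS: "transpose_mat J * J * S = S" and SJJ: "S * J * transpose_mat J = S"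
    and SW: "transpose_mat S * W0 = m \<cdot>\<^sub>m (J * transpose_mat J)"
    using monomial_pattern[OF Sc S(2)] by blast
  obtain P P' Q Q' where PQ: "P \<in> carrier_mat p p" "P' \<in> carrier_mat p p" "Q \<in> carrier_mat n n" "Q' \<in> carrier_mat n n"
    and inv: "P * P' = 1\<^sub>m p" "P' * P = 1\<^sub>m p" "Q * Q' = 1\<^sub>m n" "Q' * Q = 1\<^sub>m n" and SPDQ: "S = P * D * Q"
    using S(1) unfolding mat_equiv_def by blast
  have inv_t: "transpose_mat P' * transpose_mat P = 1\<^sub>m p" "transpose_mat Q * transpose_mat Q' = 1\<^sub>m n"
    "transpose_mat Q' * transpose_mat Q = 1\<^sub>m n"
    by (simp_all only: inv transpose_one transpose_mult[OF PQ(1,2), symmetric]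
        transpose_mult[OF PQ(4,3), symmetric] transpose_mult[OF PQ(3,4), symmetric])
  note dims [simp] = carrier_matD[OF Sc] carrier_matD[OF D] carrier_matD[OF J(1)] carrier_matD[OF J(2)]
    carrier_matD[OF PQ(1)] carrier_matD[OF PQ(2)] carrier_matD[OF PQ(3)] carrier_matD[OF PQ(4)]
  note cancel = inv[THEN dim_cancel] inv_t[THEN dim_cancel]
  have DS: "D = P' * (S * Q')"
  proof -
    have "P' * (S * Q') = P' * (P * (D * (Q * Q')))" by (simp add: SPDQ mult_mat_assoc_dim)
    also have "\<dots> = D * (Q * Q')" by (rule dim_cancel[OF inv(2)]) auto
    also have "\<dots> = D" using D inv(3) by simp
    finally show ?thesis ..
  qed
  have tr: "transpose_mat (A * B) = transpose_mat B * transpose_mat A" if "dim_col A = dim_row B" for A B :: "int mat"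
    by (rule transpose_mult[of _ "dim_row A" "dim_col A" _ "dim_col B"]) (use that in auto)
  have DST: "transpose_mat D = transpose_mat Q' * (transpose_mat S * transpose_mat P')"
    by (simp add: DS tr mult_mat_assoc_dim)
  let ?Jt = "transpose_mat J" and ?St = "transpose_mat S"
  \<comment> \<open>\<open>J\<close> intertwines \<open>S\<close> with its transpose, hence sends
    the image of \<open>S\<close> into that of the transpose; the next identity is the same for the
    way back.\<close>
  have JS: "J * S = ?St * ?Jt"
    using arg_cong[OF SJJ, of "\<lambda>X. J * X"] by (simp add: JSJ[symmetric] mult_mat_assoc_dim)
  have JtSt: "?Jt * ?St = S * J"
    using arg_cong[OF JJS, of "\<lambda>X. X * J"] by (simp add: JSJ[symmetric] mult_mat_assoc_dim)
  have JJSt: "J * (?Jt * ?St) = ?St"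
    using arg_cong[OF SJJ, of transpose_mat] by (simp add: tr mult_mat_assoc_dim)
  have JJS': "?Jt * (J * S) = S" using JJS by (simp add: mult_mat_assoc_dim)
  have SJJ': "S * (J * ?Jt) = S" using SJJ by (simp add: mult_mat_assoc_dim)
  have JJt: "J * ?Jt \<in> carrier_mat n n" using J by simp
  \<comment> \<open>The diagonal case rewritten in the original bases. Since
    \<open>D = P' * (S * Q')\<close>, the matrix \<open>P\<close> leads from the cokernel of
    \<open>D\<close> to that of \<open>S\<close>, \<open>J\<close> from there to the cokernel of the
    transpose of \<open>S\<close>, and the transpose of \<open>Q'\<close> on to the cokernel of the
    transpose of \<open>D\<close>; this composite is \<open>?M\<close>, and \<open>?N\<close> runs
    backwards. In \<open>?E\<close> the middle factor projects onto the coordinates whose column in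
    \<open>S\<close> is zero.\<close>
  let ?M = "transpose_mat Q' * (J * P)" and ?N = "P' * (?Jt * transpose_mat Q)"
  let ?U = "transpose_mat P * (?Jt * Q')" and ?V = "Q * (J * transpose_mat P')"
  let ?E = "Q * ((1\<^sub>m n - J * ?Jt) * Q')" and ?W = "transpose_mat P * (W0 * transpose_mat Q)"
  have "?N * ?M * D = D"
  proof -
    have "?N * ?M * D = P' * (?Jt * (J * S) * Q')" by (simp add: DS mult_mat_assoc_dim cancel)
    then show ?thesis by (simp add: JJS' DS)
  qed
  moreover have "?M * ?N * transpose_mat D = transpose_mat D"
  proof -
    have "?M * ?N * transpose_mat D = transpose_mat Q' * (J * (?Jt * ?St) * transpose_mat P')"
      by (simp add: DST mult_mat_assoc_dim cancel)
    then show ?thesis by (simp add: JJSt DST)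
  qed
  moreover have "?M * D = transpose_mat D * ?U"
  proof -
    have "?M * D = transpose_mat Q' * (J * S * Q')" by (simp add: DS mult_mat_assoc_dim cancel)
    also have "\<dots> = transpose_mat D * ?U" by (simp add: JS DST mult_mat_assoc_dim cancel)
    finally show ?thesis .
  qed
  moreover have "?N * transpose_mat D = D * ?V"
  proof -
    have "?N * transpose_mat D = P' * (?Jt * ?St * transpose_mat P')" by (simp add: DST mult_mat_assoc_dim cancel)
    also have "\<dots> = D * ?V" unfolding JtSt by (simp add: DS mult_mat_assoc_dim cancel)
    finally show ?thesis .
  qed
  moreover have "D * ?E = 0\<^sub>m p n"
  proof -
    have "S * (1\<^sub>m n - J * ?Jt) = 0\<^sub>m p n"
      using Sc JJt by (simp add: mult_minus_distrib_mat[of _ p n _ n] SJJ')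
    moreover have "D * ?E = P' * (S * (1\<^sub>m n - J * ?Jt) * Q')" by (simp add: DS mult_mat_assoc_dim cancel)
    ultimately show ?thesis using PQ by simp
  qed
  moreover have "transpose_mat D * ?W = m \<cdot>\<^sub>m (1\<^sub>m n - transpose_mat ?E)"
  proof -
    have Qt: "transpose_mat Q' \<in> carrier_mat n n" "transpose_mat Q \<in> carrier_mat n n" using PQ by auto
    have JJQ: "J * ?Jt * transpose_mat Q \<in> carrier_mat n n" using JJt Qt by auto
    have t: "transpose_mat (1\<^sub>m n - J * ?Jt) = 1\<^sub>m n - J * ?Jt"
      by (rule eq_matI) (auto simp: scalar_prod_def mult.commute)
    have "transpose_mat ?E = transpose_mat Q' * ((1\<^sub>m n - J * ?Jt) * transpose_mat Q)"
      using t by (simp add: tr mult_mat_assoc_dim)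
    also have "\<dots> = transpose_mat Q' * (transpose_mat Q - J * ?Jt * transpose_mat Q)"
      using JJt Qt by (simp add: minus_mult_distrib_mat[of _ n n _ _ n])
    also have "\<dots> = 1\<^sub>m n - transpose_mat Q' * (J * ?Jt * transpose_mat Q)"
      using JJQ Qt by (simp add: mult_minus_distrib_mat[of _ n n _ n] inv_t)
    finally have E: "transpose_mat ?E = 1\<^sub>m n - transpose_mat Q' * (J * ?Jt * transpose_mat Q)" .
    have "transpose_mat D * ?W = transpose_mat Q' * (?St * W0 * transpose_mat Q)"
      by (simp add: DST mult_mat_assoc_dim cancel)
    also have "\<dots> = m \<cdot>\<^sub>m (transpose_mat Q' * (J * ?Jt * transpose_mat Q))"
      unfolding SW using mult_smult_assoc_mat[OF JJt Qt(2), of m] mult_smult_distrib[OF Qt(1) JJQ, of m] by simp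
    also have "transpose_mat Q' * (J * ?Jt * transpose_mat Q) = 1\<^sub>m n - transpose_mat ?E"
      unfolding E using JJQ Qt by (intro eq_matI) auto
    finally show ?thesis .
  qed
  moreover have "?M \<in> carrier_mat n p" "?N \<in> carrier_mat p n" "?U \<in> carrier_mat p n" "?V \<in> carrier_mat n p"
    "?E \<in> carrier_mat n n" "?W \<in> carrier_mat p n"
    by (rule carrier_matI; simp)+
  ultimately show thesis
    using J(3) by - (rule that[of ?M ?N ?U ?V ?E ?W m], assumption+)
qed

unbundle no inner_syntax

section \<open>Groups of vectors and their quotients\<close>

text \<open>Being a subgroup, phrased for a bare set of vectors: the same set serves now as a whole
  group and now as the subgroup divided out.\<close>

definition additive_set :: "nat \<Rightarrow> 'b::comm_ring_1 vec set \<Rightarrow> bool" where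
  "additive_set n L \<longleftrightarrow> L \<subseteq> carrier_vec n \<and> 0\<^sub>v n \<in> L \<and> (\<forall>x\<in>L. \<forall>y\<in>L. x + y \<in> L) \<and> (\<forall>x\<in>L. - x \<in> L)"

lemma vec_group_simps [simp]:
  "carrier (vec_group n L) = L" "x \<otimes>\<^bsub>vec_group n L\<^esub> y = x + y" "\<one>\<^bsub>vec_group n L\<^esub> = 0\<^sub>v n"
  by (simp_all add: vec_group_def)

lemma additive_set_carrier [simp]: "additive_set n (carrier_vec n)"
  by (simp add: additive_set_def)

lemma additive_setD:
  assumes "additive_set n L"
  shows "x \<in> L \<Longrightarrow> x \<in> carrier_vec n" "0\<^sub>v n \<in> L" "x \<in> L \<Longrightarrow> y \<in> L \<Longrightarrow> x + y \<in> L" "x \<in> L \<Longrightarrow> - x \<in> L"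
  using assms by (auto simp: additive_set_def)

lemma comm_group_vec_group:
  assumes "additive_set n L"
  shows "comm_group (vec_group n L)"
proof (rule comm_groupI; simp)
  note L = additive_setD[OF assms]
  show "\<And>x y. x \<in> L \<Longrightarrow> y \<in> L \<Longrightarrow> x + y \<in> L" "0\<^sub>v n \<in> L" using L by auto
  show "\<And>x y z. x \<in> L \<Longrightarrow> y \<in> L \<Longrightarrow> z \<in> L \<Longrightarrow> x + y + z = x + (y + z)"
    using L(1) by (metis assoc_add_vec)
  show "\<And>x y. x \<in> L \<Longrightarrow> y \<in> L \<Longrightarrow> x + y = y + x" using L(1) by (metis comm_add_vec)
  show "\<And>x. x \<in> L \<Longrightarrow> 0\<^sub>v n + x = x" using L(1) by auto
  show "\<And>x. x \<in> L \<Longrightarrow> \<exists>y\<in>L. y + x = 0\<^sub>v n" using L(1,4) uminus_l_inv_vec by blast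
qed

lemma group_vec_group: "additive_set n L \<Longrightarrow> Group.group (vec_group n L)"
  by (rule comm_group.axioms(2)[OF comm_group_vec_group])

lemma inv_vec_group:
  assumes "additive_set n L" "x \<in> L"
  shows "inv\<^bsub>vec_group n L\<^esub> x = - x"
  using additive_setD[OF assms(1)] assms(2)
  by (intro group.inv_equality[OF group_vec_group[OF assms(1)]]) (auto intro: uminus_l_inv_vec)

lemma subgroup_vec_group:
  assumes "additive_set n L" "additive_set n K" "K \<subseteq> L"
  shows "subgroup K (vec_group n L)"
  by (rule group.subgroupI[OF group_vec_group[OF assms(1)]])
     (use assms additive_setD[OF assms(2)] in \<open>auto simp: inv_vec_group subset_iff\<close>)

lemma nat_pow_vec_group:
  assumes "additive_set n L" "x \<in> L"
  shows "x [^]\<^bsub>vec_group n L\<^esub> (k::nat) = of_nat k \<cdot>\<^sub>v x"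
proof (induction k)
  case 0
  then show ?case using additive_setD(1)[OF assms] by (intro eq_vecI) auto
next
  case (Suc k)
  then show ?case
    using additive_setD(1)[OF assms] by (intro eq_vecI) (auto simp: nat_pow_def algebra_simps)
qed

lemma vec_coset_eq_iff:
  assumes "additive_set n L" "additive_set n K" "K \<subseteq> L" "x \<in> L" "y \<in> L"
  shows "K #>\<^bsub>vec_group n L\<^esub> x = K #>\<^bsub>vec_group n L\<^esub> y \<longleftrightarrow> x - y \<in> K"
proof -
  interpret group "vec_group n L" by (rule group_vec_group[OF assms(1)])
  have K: "subgroup K (vec_group n L)" using subgroup_vec_group[OF assms(1-3)] .
  have "x \<in> carrier_vec n" "y \<in> carrier_vec n" using assms(1,4,5) additive_setD(1) by blast+
  then have "x \<otimes>\<^bsub>vec_group n L\<^esub> inv\<^bsub>vec_group n L\<^esub> y = x - y"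
    using assms by (auto simp: inv_vec_group)
  then have "x \<in> K #>\<^bsub>vec_group n L\<^esub> y \<longleftrightarrow> x - y \<in> K"
    using subgroup.rcos_module[OF K is_group, of y x] assms(4,5) by simp
  moreover have "x \<in> K #>\<^bsub>vec_group n L\<^esub> y \<longleftrightarrow> K #>\<^bsub>vec_group n L\<^esub> x = K #>\<^bsub>vec_group n L\<^esub> y"
    using repr_independence[of x K y] rcos_self[of x K] K assms(4,5) by auto
  ultimately show ?thesis by simp
qed

lemma vec_coset_one_iff:
  assumes "additive_set n L" "additive_set n K" "K \<subseteq> L" "x \<in> L"
  shows "K #>\<^bsub>vec_group n L\<^esub> x = K \<longleftrightarrow> x \<in> K"
proof -
  have "K #>\<^bsub>vec_group n L\<^esub> 0\<^sub>v n = K"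
    using group.coset_join2[OF group_vec_group[OF assms(1)] _ subgroup_vec_group[OF assms(1-3)], of "0\<^sub>v n"]
      additive_setD(2)[OF assms(1)] additive_setD(2)[OF assms(2)] by simp
  moreover have "x - 0\<^sub>v n = x" using additive_setD(1)[OF assms(1,4)] by simp
  ultimately show ?thesis
    using vec_coset_eq_iff[OF assms(1-4) additive_setD(2)[OF assms(1)]] by simp
qed

lemma comm_group_vec_quotient:
  assumes "additive_set n L" "additive_set n K" "K \<subseteq> L"
  shows "comm_group (vec_group n L Mod K)"
  using comm_group.abelian_FactGroup[OF comm_group_vec_group[OF assms(1)] subgroup_vec_group[OF assms]] .

lemma quotient_hom:
  assumes G: "comm_group G" "subgroup N G" and H: "comm_group H" "subgroup N' H"
    and h: "h \<in> hom G H" "h ` N \<subseteq> N'"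
  obtains g where "g \<in> hom (G Mod N) (H Mod N')" "\<And>x. x \<in> carrier G \<Longrightarrow> g (N #>\<^bsub>G\<^esub> x) = N' #>\<^bsub>H\<^esub> h x"
proof -
  interpret G: comm_group G by fact
  interpret H: comm_group H by fact
  interpret h: group_hom G H h
    by (simp add: group_hom_def group_hom_axioms_def h(1) G.is_group H.is_group)
  have N': "N' \<lhd> H" using H.subgroup_imp_normal[OF H(2)] .
  have hom: "(\<lambda>x. N' #>\<^bsub>H\<^esub> h x) \<in> hom G (H Mod N')"
    using hom_compose[OF h(1) normal.r_coset_hom_Mod[OF N']] by (simp add: o_def)
  have "N' #>\<^bsub>H\<^esub> h x = N' #>\<^bsub>H\<^esub> h y" if "x \<in> carrier G" "y \<in> carrier G" "N #>\<^bsub>G\<^esub> x = N #>\<^bsub>G\<^esub> y" for x y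
  proof -
    have "x \<in> N #>\<^bsub>G\<^esub> y" using G.rcos_self[OF that(1) G(2)] that(3) by simp
    then have "x \<otimes>\<^bsub>G\<^esub> inv\<^bsub>G\<^esub> y \<in> N" using subgroup.rcos_module[OF G(2) G.is_group that(2,1)] by simp
    then have "h (x \<otimes>\<^bsub>G\<^esub> inv\<^bsub>G\<^esub> y) \<in> N'" using h(2) by blast
    then have "h x \<otimes>\<^bsub>H\<^esub> inv\<^bsub>H\<^esub> h y \<in> N'" using that by simp
    then have "h x \<in> N' #>\<^bsub>H\<^esub> h y" using subgroup.rcos_module[OF H(2) H.is_group, of "h y" "h x"] that by simp
    then show ?thesis using H.repr_independence[OF _ _ H(2)] that by auto
  qed
  from FactGroup_universal[OF hom G.subgroup_imp_normal[OF G(2)] this] that show thesis by blast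
qed

lemma group_torsion_subgroup:
  assumes "comm_group A"
  shows "Group.group (torsion_subgroup A)"
proof -
  interpret comm_group A by fact
  have "subgroup {x \<in> carrier A. \<exists>m::nat. m > 0 \<and> x [^]\<^bsub>A\<^esub> m = \<one>\<^bsub>A\<^esub>} A"
  proof (rule subgroupI)
    have "\<one>\<^bsub>A\<^esub> \<in> {x \<in> carrier A. \<exists>m::nat. m > 0 \<and> x [^]\<^bsub>A\<^esub> m = \<one>\<^bsub>A\<^esub>}"
      by (simp add: exI[of _ "1::nat"])
    then show "{x \<in> carrier A. \<exists>m::nat. m > 0 \<and> x [^]\<^bsub>A\<^esub> m = \<one>\<^bsub>A\<^esub>} \<noteq> {}"
      by blast
    fix x assume "x \<in> {x \<in> carrier A. \<exists>m::nat. m > 0 \<and> x [^]\<^bsub>A\<^esub> m = \<one>\<^bsub>A\<^esub>}"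
    then show "inv\<^bsub>A\<^esub> x \<in> {x \<in> carrier A. \<exists>m::nat. m > 0 \<and> x [^]\<^bsub>A\<^esub> m = \<one>\<^bsub>A\<^esub>}"
      by (auto simp: nat_pow_inv)
    fix y assume "y \<in> {x \<in> carrier A. \<exists>m::nat. m > 0 \<and> x [^]\<^bsub>A\<^esub> m = \<one>\<^bsub>A\<^esub>}"
    with \<open>x \<in> _\<close> obtain k l :: nat where xy: "x \<in> carrier A" "y \<in> carrier A" "k > 0" "l > 0" "x [^]\<^bsub>A\<^esub> k = \<one>\<^bsub>A\<^esub>" "y [^]\<^bsub>A\<^esub> l = \<one>\<^bsub>A\<^esub>"
      by auto
    have "(x \<otimes>\<^bsub>A\<^esub> y) [^]\<^bsub>A\<^esub> (k * l) = (x [^]\<^bsub>A\<^esub> k) [^]\<^bsub>A\<^esub> l \<otimes>\<^bsub>A\<^esub> (y [^]\<^bsub>A\<^esub> l) [^]\<^bsub>A\<^esub> k"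
      using xy(1,2) by (simp add: nat_pow_distrib nat_pow_pow mult.commute)
    then have "(x \<otimes>\<^bsub>A\<^esub> y) [^]\<^bsub>A\<^esub> (k * l) = \<one>\<^bsub>A\<^esub>" using xy by simp
    then show "x \<otimes>\<^bsub>A\<^esub> y \<in> {x \<in> carrier A. \<exists>m::nat. m > 0 \<and> x [^]\<^bsub>A\<^esub> m = \<one>\<^bsub>A\<^esub>}"
      using xy by (auto intro!: exI[of _ "k * l"])
  qed auto
  from subgroup.subgroup_is_group[OF this is_group] show ?thesis by (simp add: torsion_subgroup_def)
qed


section \<open>Orthogonal projection onto a real span\<close>

abbreviation real_span :: "nat \<Rightarrow> real vec set \<Rightarrow> real vec set" where
  "real_span n \<equiv> LinearCombinations.module.span class_ring (module_vec TYPE(real) n)"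

lemma real_span_mono: "L \<subseteq> L' \<Longrightarrow> real_span n L \<subseteq> real_span n L'"
proof -
  interpret vec_space "TYPE(real)" n .
  show "L \<subseteq> L' \<Longrightarrow> real_span n L \<subseteq> real_span n L'" by (rule span_is_monotone)
qed

lemma real_span:
  assumes L: "L \<subseteq> carrier_vec n"
  shows real_span_carrier: "u \<in> real_span n L \<Longrightarrow> u \<in> carrier_vec n"
    and real_span_mem: "u \<in> L \<Longrightarrow> u \<in> real_span n L"
    and real_span_zero: "0\<^sub>v n \<in> real_span n L"
    and real_span_add: "u \<in> real_span n L \<Longrightarrow> v \<in> real_span n L \<Longrightarrow> u + v \<in> real_span n L"
    and real_span_smult: "u \<in> real_span n L \<Longrightarrow> c \<cdot>\<^sub>v u \<in> real_span n L"
proof -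
  interpret vec_space "TYPE(real)" n .
  have sub: "submodule class_ring (real_span n L) V" using L by (intro span_is_submodule) simp
  show "u \<in> real_span n L \<Longrightarrow> u \<in> carrier_vec n" using span_closed[of L u] L by simp
  show "u \<in> L \<Longrightarrow> u \<in> real_span n L" using L by (intro span_mem) auto
  show "0\<^sub>v n \<in> real_span n L" using submodule.zero_closed[OF sub] by simp
  show "u \<in> real_span n L \<Longrightarrow> v \<in> real_span n L \<Longrightarrow> u + v \<in> real_span n L" using submodule.m_closed[OF sub] by simp
  show "u \<in> real_span n L \<Longrightarrow> c \<cdot>\<^sub>v u \<in> real_span n L" using submodule.smult_closed[OF sub] by (simp add: class_ring_simps)
qed

lemma real_span_minus:
  assumes "L \<subseteq> carrier_vec n" "u \<in> real_span n L" "v \<in> real_span n L"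
  shows "u - v \<in> real_span n L"
proof -
  have "u - v = u + (-1) \<cdot>\<^sub>v v"
    using real_span_carrier[OF assms(1)] assms(2,3) by (intro eq_vecI) auto
  then show ?thesis using real_span_add[OF assms(1,2)] real_span_smult[OF assms(1,3)] by simp
qed

lemma orthogonal_real_span:
  assumes L: "L \<subseteq> carrier_vec n" and t: "t \<in> carrier_vec n" "\<And>w. w \<in> L \<Longrightarrow> t \<bullet> w = 0" and u: "u \<in> real_span n L"
  shows "t \<bullet> u = 0"
proof -
  interpret vec_space "TYPE(real)" n .
  have "submodule class_ring {u \<in> carrier_vec n. t \<bullet> u = 0} V"
    by unfold_locales (use t(1) in \<open>auto simp: scalar_prod_add_distrib[of _ n] class_ring_simps\<close>)
  then have "real_span n L \<subseteq> {u \<in> carrier_vec n. t \<bullet> u = 0}"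
    using L t(2) by (intro span_is_subset) auto
  then show ?thesis using u by blast
qed

lemma real_scalar_prod_self:
  fixes t :: "real vec"
  assumes "t \<in> carrier_vec n" "t \<bullet> t = 0"
  shows "t = 0\<^sub>v n"
proof (rule eq_vecI)
  fix i assume "i < dim_vec (0\<^sub>v n :: real vec)"
  moreover have "\<forall>i\<in>{0..<n}. t $ i * t $ i = 0"
    using assms by (subst sum_nonneg_eq_0_iff[symmetric]) (auto simp: scalar_prod_def)
  ultimately show "t $ i = 0\<^sub>v n $ i" by simp
qed (use assms in auto)

text \<open>Gram-Schmidt along a list of possibly dependent generators. The induction hypothesis is
  applied both to \<open>v\<close> and to the new generator \<open>w\<close>; the residue
  \<open>t\<close> of \<open>w\<close> supplies the one new direction in which the residue of
  \<open>v\<close> is corrected.\<close>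

lemma orthogonal_decomposition:
  assumes "set ws \<subseteq> carrier_vec n" "v \<in> carrier_vec n"
  shows "\<exists>u\<in>real_span n (set ws). \<forall>w\<in>set ws. (v - u) \<bullet> w = 0"
  using assms
proof (induction ws arbitrary: v)
  case Nil
  then show ?case using real_span_zero[of "{}" n] by auto
next
  case (Cons w ws)
  have ws: "set ws \<subseteq> carrier_vec n" and w: "w \<in> carrier_vec n" and all: "set (w # ws) \<subseteq> carrier_vec n" using Cons.prems by auto
  obtain uw where uw: "uw \<in> real_span n (set ws)" "\<And>x. x \<in> set ws \<Longrightarrow> (w - uw) \<bullet> x = 0"
    using Cons.IH[OF ws w] by blast
  obtain uv where uv: "uv \<in> real_span n (set ws)" "\<And>x. x \<in> set ws \<Longrightarrow> (v - uv) \<bullet> x = 0"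
    using Cons.IH[OF ws Cons.prems(2)] by blast
  have c: "uw \<in> carrier_vec n" "uv \<in> carrier_vec n" using real_span_carrier[OF ws] uw uv by auto
  define t where "t = w - uw"
  define s where "s = v - uv"
  have ts: "t \<in> carrier_vec n" "s \<in> carrier_vec n" using c w Cons.prems by (auto simp: t_def s_def)
  \<comment> \<open>If \<open>t \<bullet> t = 0\<close> then \<open>t = 0\<close>, that is,
    \<open>w\<close> already lies in the span of the earlier generators and no correction takes
    place.\<close>
  define a where "a = (if t \<bullet> t = 0 then 0 else (s \<bullet> t) / (t \<bullet> t))"
  have sat: "s - a \<cdot>\<^sub>v t \<in> carrier_vec n" using ts by auto
  have at: "(s - a \<cdot>\<^sub>v t) \<bullet> t = 0"
  proof (cases "t \<bullet> t = 0")
    case True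
    then have "t = 0\<^sub>v n" using real_scalar_prod_self ts by blast
    then show ?thesis using ts sat by simp
  next
    case False
    then show ?thesis using ts by (simp add: minus_scalar_prod_distrib[of _ n] a_def)
  qed
  have orth: "(s - a \<cdot>\<^sub>v t) \<bullet> x = 0" if "x \<in> set ws" for x
  proof -
    have "x \<in> carrier_vec n" using ws that by auto
    then show ?thesis using uw(2)[OF that] uv(2)[OF that] ts by (simp add: minus_scalar_prod_distrib[of _ n] t_def[symmetric] s_def[symmetric])
  qed
  have "(s - a \<cdot>\<^sub>v t) \<bullet> uw = 0" using orthogonal_real_span[OF ws sat orth uw(1)] .
  moreover have "w = uw + t" using c w by (auto simp: t_def)
  ultimately have "(s - a \<cdot>\<^sub>v t) \<bullet> w = 0" using at sat c ts by (simp add: scalar_prod_add_distrib[of _ n])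
  moreover have "v - (uv + a \<cdot>\<^sub>v t) = s - a \<cdot>\<^sub>v t" using c ts Cons.prems by (auto simp: s_def)
  moreover have "uv + a \<cdot>\<^sub>v t \<in> real_span n (set (w # ws))"
  proof -
    have "uv \<in> real_span n (set (w # ws))" "uw \<in> real_span n (set (w # ws))"
      using real_span_mono[of "set ws" "set (w # ws)" n] uv uw by auto
    moreover have "w \<in> real_span n (set (w # ws))" by (rule real_span_mem[OF all]) simp
    ultimately show ?thesis unfolding t_def
      using real_span_add[OF all] real_span_smult[OF all] real_span_minus[OF all] by blast
  qed
  ultimately show ?case using orth by (intro bexI[of _ "uv + a \<cdot>\<^sub>v t"]) auto
qed


section \<open>The lattice of integer vectors killed by a matrix\<close>

abbreviation real_vec :: "int vec \<Rightarrow> real vec" where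
  "real_vec \<equiv> map_vec of_int"

lemma real_vec_add: "v \<in> carrier_vec n \<Longrightarrow> w \<in> carrier_vec n \<Longrightarrow> real_vec (v + w) = real_vec v + real_vec w"
  by (intro eq_vecI) auto

lemma real_vec_diff: "v \<in> carrier_vec n \<Longrightarrow> w \<in> carrier_vec n \<Longrightarrow> real_vec (v - w) = real_vec v - real_vec w"
  by (intro eq_vecI) auto

lemma real_vec_scalar_prod: "dim_vec v = dim_vec w \<Longrightarrow> real_vec v \<bullet> real_vec w = of_int (v \<bullet> w)"
  by (simp add: scalar_prod_def)

lemma real_vec_inject: "real_vec v = real_vec w \<longleftrightarrow> v = w"
  by (auto simp: vec_eq_iff)

text \<open>Reduces orthogonality to, and pairings with, an integer image to finitely many pairings
  with columns.\<close>

lemma scalar_prod_mat_mult: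
  assumes "A \<in> carrier_mat n k" "w \<in> carrier_vec k" "t \<in> carrier_vec n"
  shows "t \<bullet> real_vec (A *\<^sub>v w) = (\<Sum>j\<in>{0..<k}. (t \<bullet> real_vec (col A j)) * of_int (w $ j))"
proof -
  have "t \<bullet> real_vec (A *\<^sub>v w) = (\<Sum>i\<in>{0..<n}. \<Sum>j\<in>{0..<k}. t $ i * (of_int (A $$ (i, j)) * of_int (w $ j)))"
    using assms by (simp add: scalar_prod_def sum_distrib_left)
  also have "\<dots> = (\<Sum>j\<in>{0..<k}. \<Sum>i\<in>{0..<n}. t $ i * (of_int (A $$ (i, j)) * of_int (w $ j)))"
    by (rule sum.swap)
  also have "\<dots> = (\<Sum>j\<in>{0..<k}. (t \<bullet> real_vec (col A j)) * of_int (w $ j))"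
    using assms by (intro sum.cong) (auto simp: scalar_prod_def sum_distrib_right mult.assoc)
  finally show ?thesis .
qed

lemma additive_set_kernel:
  assumes "(A :: int mat) \<in> carrier_mat p n"
  shows "additive_set n (mat_kernel A)"
proof -
  have "A *\<^sub>v 0\<^sub>v n = 0\<^sub>v p"
    using assms by (intro eq_vecI) auto
  moreover have "A *\<^sub>v (- v) = - (A *\<^sub>v v)" if "v \<in> carrier_vec n" for v
    using assms that by (intro eq_vecI) auto
  moreover have "- (0\<^sub>v p) = (0\<^sub>v p :: int vec)" by (intro eq_vecI) auto
  ultimately show ?thesis
    unfolding additive_set_def mat_kernel[OF assms]
    by (simp add: mult_add_distrib_mat_vec[OF assms] subset_iff)
qed

lemma mat_imageI: "A \<in> carrier_mat p n \<Longrightarrow> v \<in> carrier_vec n \<Longrightarrow> A *\<^sub>v v \<in> mat_image A"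
  by (auto simp: mat_image_def)

lemma mat_imageE:
  assumes "x \<in> mat_image A" "A \<in> carrier_mat p n"
  obtains v where "v \<in> carrier_vec n" "x = A *\<^sub>v v"
proof -
  obtain v where "v \<in> carrier_vec (dim_col A)" "x = A *\<^sub>v v"
    using assms(1) unfolding mat_image_def by (rule imageE)
  then show thesis using that assms(2) by auto
qed

lemma additive_set_image:
  assumes "(A :: int mat) \<in> carrier_mat p n"
  shows "additive_set p (mat_image A)"
proof -
  have zero: "A *\<^sub>v 0\<^sub>v n = 0\<^sub>v p"
    using assms by (intro eq_vecI) auto
  have neg: "- (A *\<^sub>v v) = A *\<^sub>v (- v)" if "v \<in> carrier_vec n" for v
    using assms that by (intro eq_vecI) auto
  have "mat_image A \<subseteq> carrier_vec p"
    using assms by (auto elim!: mat_imageE)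
  moreover have "0\<^sub>v p \<in> mat_image A"
    using mat_imageI[OF assms zero_carrier_vec] zero by simp
  moreover have "x + y \<in> mat_image A" if x: "x \<in> mat_image A" and y: "y \<in> mat_image A" for x y
  proof -
    obtain v where v: "v \<in> carrier_vec n" "x = A *\<^sub>v v" using mat_imageE[OF x assms] .
    obtain w where w: "w \<in> carrier_vec n" "y = A *\<^sub>v w" using mat_imageE[OF y assms] .
    have "x + y = A *\<^sub>v (v + w)" using mult_add_distrib_mat_vec[OF assms v(1) w(1)] v w by simp
    then show ?thesis using mat_imageI[OF assms add_carrier_vec[OF v(1) w(1)]] by simp
  qed
  moreover have "- x \<in> mat_image A" if x: "x \<in> mat_image A" for x
  proof -
    obtain v where v: "v \<in> carrier_vec n" "x = A *\<^sub>v v" using mat_imageE[OF x assms] .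
    then show ?thesis using neg[OF v(1)] mat_imageI[OF assms uminus_carrier_vec[THEN iffD2, OF v(1)]] by simp
  qed
  ultimately show ?thesis by (simp add: additive_set_def)
qed

lemma additive_set_real_lattice:
  assumes "additive_set n L"
  shows "additive_set n (real_lattice L)"
proof -
  note L = additive_setD[OF assms]
  have "0\<^sub>v n = real_vec (0\<^sub>v n)" by (intro eq_vecI) auto
  moreover have "real_vec x + real_vec y = real_vec (x + y)" if "x \<in> L" "y \<in> L" for x y
    using L(1) that real_vec_add by metis
  moreover have "- real_vec x = real_vec (- x)" for x by (intro eq_vecI) auto
  ultimately show ?thesis
    unfolding additive_set_def real_lattice_def using L by (auto intro!: imageI)
qed

text \<open>Matrix form of the kernel of \<open>D\<close> being a direct summand.
  \<open>D * E = 0\<close> puts the columns of \<open>E\<close> into the kernel; the identity with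
  \<open>W\<close>, used as it stands and transposed, yields that integer vectors orthogonal to the
  kernel are torsion modulo the cuts and that \<open>E\<close> fixes the kernel.\<close>

locale kernel_lattice =
  fixes D E W :: "int mat" and p n :: nat and m :: int
  assumes D: "D \<in> carrier_mat p n" and E: "E \<in> carrier_mat n n" and W: "W \<in> carrier_mat p n" and m: "m > 0"
    and DE: "D * E = 0\<^sub>m p n" and DW: "transpose_mat D * W = m \<cdot>\<^sub>m (1\<^sub>m n - transpose_mat E)"
begin

abbreviation "F \<equiv> mat_kernel D"
abbreviation "FR \<equiv> real_lattice (mat_kernel D)"

lemma F: "additive_set n F"
  using additive_set_kernel[OF D] .

lemma FR: "additive_set n FR"
  using additive_set_real_lattice[OF F] .

lemma F_carrier: "F \<subseteq> carrier_vec n" and FR_carrier: "FR \<subseteq> carrier_vec n"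
  using F FR by (auto simp: additive_set_def)

lemma col_E_in: "j < n \<Longrightarrow> col E j \<in> F"
proof (rule mat_kernelI[OF D])
  assume j: "j < n"
  then show "col E j \<in> carrier_vec n" using E by auto
  have "D *\<^sub>v col E j = col (D * E) j" using D E j by (intro eq_vecI) auto
  then show "D *\<^sub>v col E j = 0\<^sub>v p" using DE j by simp
qed

text \<open>The columns of \<open>E\<close> lie in \<open>F\<close>, so the transpose of
  \<open>E\<close> kills \<open>t\<close>, and the identity for \<open>W\<close> evaluated at
  \<open>t\<close> is the claim. One multiplier \<open>m\<close> thus works for all integer vectors
  orthogonal to \<open>F\<close>.\<close>

lemma orthogonal_F_imp:
  assumes t: "t \<in> carrier_vec n" "\<And>w. w \<in> F \<Longrightarrow> t \<bullet> w = 0"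
  shows "m \<cdot>\<^sub>v t = transpose_mat D *\<^sub>v (W *\<^sub>v t)"
proof -
  have Et: "transpose_mat E *\<^sub>v t = 0\<^sub>v n"
  proof (rule eq_vecI)
    fix j assume "j < dim_vec (0\<^sub>v n :: int vec)"
    then have j: "j < n" by simp
    then have "(transpose_mat E *\<^sub>v t) $ j = col E j \<bullet> t" using E by simp
    also have "\<dots> = t \<bullet> col E j" using E j t(1) by (intro comm_scalar_prod[of _ n]) auto
    finally show "(transpose_mat E *\<^sub>v t) $ j = 0\<^sub>v n $ j" using t(2)[OF col_E_in[OF j]] j by simp
  qed (use E in auto)
  have "transpose_mat D *\<^sub>v (W *\<^sub>v t) = (m \<cdot>\<^sub>m (1\<^sub>m n - transpose_mat E)) *\<^sub>v t"
    unfolding DW[symmetric] using D W t by simp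
  also have "\<dots> = m \<cdot>\<^sub>v ((1\<^sub>m n - transpose_mat E) *\<^sub>v t)"
    using E t(1) by (intro eq_vecI) auto
  also have "(1\<^sub>m n - transpose_mat E) *\<^sub>v t = t"
    using E t(1) Et by (simp add: minus_mult_distrib_mat_vec[of _ n n])
  finally show ?thesis ..
qed

text \<open>Transposing the identity for \<open>W\<close> gives \<open>W^T D = m (1 - E)\<close>. On
  the kernel of \<open>D\<close> the left side vanishes, and \<open>m\<close> cancels over the
  integers.\<close>

lemma E_fix:
  assumes x: "x \<in> F"
  shows "E *\<^sub>v x = x"
proof -
  have xc: "x \<in> carrier_vec n" and Dx: "D *\<^sub>v x = 0\<^sub>v p" using mat_kernelD[OF D x] by auto
  have "transpose_mat W * D = m \<cdot>\<^sub>m (1\<^sub>m n - E)"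
  proof -
    have "transpose_mat W * D = transpose_mat (transpose_mat D * W)"
      using D W by (subst transpose_mult[of _ n p _ n]) auto
    also have "\<dots> = m \<cdot>\<^sub>m (1\<^sub>m n - E)"
      unfolding DW using E by (intro eq_matI) auto
    finally show ?thesis .
  qed
  then have "(m \<cdot>\<^sub>m (1\<^sub>m n - E)) *\<^sub>v x = transpose_mat W *\<^sub>v (D *\<^sub>v x)"
    using D W xc by (metis assoc_mult_mat_vec transpose_carrier_mat)
  also have "\<dots> = 0\<^sub>v n"
    unfolding Dx using W by (intro eq_vecI) auto
  also have "(m \<cdot>\<^sub>m (1\<^sub>m n - E)) *\<^sub>v x = m \<cdot>\<^sub>v ((1\<^sub>m n - E) *\<^sub>v x)"
    using E xc by (intro eq_vecI) auto
  also have "(1\<^sub>m n - E) *\<^sub>v x = x - E *\<^sub>v x"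
    using E xc by (simp add: minus_mult_distrib_mat_vec[of _ n n])
  finally have eq: "m \<cdot>\<^sub>v (x - E *\<^sub>v x) = 0\<^sub>v n" .
  show ?thesis
  proof (rule eq_vecI)
    fix i assume "i < dim_vec x"
    then have i: "i < n" using xc by auto
    have "(m \<cdot>\<^sub>v (x - E *\<^sub>v x)) $ i = m * (x $ i - (E *\<^sub>v x) $ i)"
      using i xc E by (simp del: index_mult_mat_vec)
    then show "(E *\<^sub>v x) $ i = x $ i" using eq m i by simp
  qed (use E xc in auto)
qed

end

section \<open>Elementary identities for vectors\<close>

lemma mult_mat_vec_smult:
  fixes A :: "'a::comm_ring_1 mat"
  assumes "A \<in> carrier_mat p n" "v \<in> carrier_vec n"
  shows "A *\<^sub>v (k \<cdot>\<^sub>v v) = k \<cdot>\<^sub>v (A *\<^sub>v v)"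
  using assms by (intro eq_vecI) auto

lemma smult_vec_cancel:
  fixes v w :: "int vec"
  assumes "k \<noteq> 0" "k \<cdot>\<^sub>v v = k \<cdot>\<^sub>v w" "v \<in> carrier_vec n" "w \<in> carrier_vec n"
  shows "v = w"
proof (rule eq_vecI)
  fix i assume "i < dim_vec w"
  then have i: "i < n" using assms by auto
  have "(k \<cdot>\<^sub>v v) $ i = (k \<cdot>\<^sub>v w) $ i" using assms(2) by simp
  then show "v $ i = w $ i" using assms(1,3,4) i by simp
qed (use assms in auto)

lemma vec_diff_zero:
  fixes v w :: "'a::ring vec"
  assumes "v - w = 0\<^sub>v n" "v \<in> carrier_vec n" "w \<in> carrier_vec n"
  shows "v = w"
proof (rule eq_vecI)
  fix i assume "i < dim_vec w"
  then have i: "i < n" using assms by auto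
  have "(v - w) $ i = 0" using assms(1) i by simp
  then show "v $ i = w $ i" using assms(2,3) i by simp
qed (use assms in auto)

lemma mat_mult3_vec:
  fixes A B C :: "'a::semiring_0 mat"
  assumes "A \<in> carrier_mat n1 n2" "B \<in> carrier_mat n2 n3" "C \<in> carrier_mat n3 n4" "v \<in> carrier_vec n4"
  shows "(A * B * C) *\<^sub>v v = A *\<^sub>v (B *\<^sub>v (C *\<^sub>v v))"
  using assms by (simp add: assoc_mult_mat_vec[OF mult_carrier_mat[OF assms(1,2)] assms(3)]
      assoc_mult_mat_vec[OF assms(1,2)] del: assoc_mult_mat)

lemma zero_mat_mult_vec: "v \<in> carrier_vec n \<Longrightarrow> 0\<^sub>m p n *\<^sub>v v = (0\<^sub>v p :: 'a::semiring_1 vec)"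
  by (intro eq_vecI) auto

lemma mat_mult_unit_vec:
  fixes A :: "'a::comm_ring_1 mat"
  assumes "A \<in> carrier_mat p n" "j < n"
  shows "A *\<^sub>v unit_vec n j = col A j"
  using assms by (intro eq_vecI) auto

section \<open>Projection of integer vectors onto the dual of the flow lattice\<close>

context kernel_lattice
begin

abbreviation "F_dual \<equiv> dual_lattice n FR"

lemma FR_E: "w \<in> FR \<Longrightarrow> \<exists>x. x \<in> F \<and> w = real_vec x"
  by (auto simp: real_lattice_def)

lemma FR_I: "x \<in> F \<Longrightarrow> real_vec x \<in> FR"
  by (simp add: real_lattice_def)

text \<open>Orthogonal decomposition works with finitely many generators. The columns of
  \<open>E\<close> suffice: every \<open>x\<close> in \<open>F\<close> equals \<open>E x\<close>, an
  integer combination of them.\<close>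

lemma projection_exists:
  assumes v: "v \<in> carrier_vec n"
  shows "\<exists>u\<in>real_span n FR. \<forall>w\<in>FR. (v - u) \<bullet> w = 0"
proof -
  let ?ws = "map (\<lambda>j. real_vec (col E j)) [0..<n]"
  have ws: "set ?ws \<subseteq> FR" using col_E_in FR_I by auto
  then have wsc: "set ?ws \<subseteq> carrier_vec n" using FR_carrier by (rule subset_trans)
  obtain u where u: "u \<in> real_span n (set ?ws)" "\<And>w. w \<in> set ?ws \<Longrightarrow> (v - u) \<bullet> w = 0"
    using orthogonal_decomposition[OF wsc v] by blast
  have uc: "u \<in> carrier_vec n" using real_span_carrier[OF wsc u(1)] .
  have "(v - u) \<bullet> w = 0" if w: "w \<in> FR" for w
  proof -
    obtain x where x: "x \<in> F" "w = real_vec x" using FR_E[OF w] by blast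
    have xc: "x \<in> carrier_vec n" using F_carrier x(1) by blast
    have "(v - u) \<bullet> real_vec (E *\<^sub>v x) = (\<Sum>j\<in>{0..<n}. ((v - u) \<bullet> real_vec (col E j)) * of_int (x $ j))"
      using v uc by (intro scalar_prod_mat_mult[OF E xc]) auto
    also have "\<dots> = 0" using u(2) by (intro sum.neutral) auto
    finally show ?thesis unfolding x(2) E_fix[OF x(1)] .
  qed
  then show ?thesis using real_span_mono[OF ws] u(1) by blast
qed

lemma span_orthogonal_zero:
  assumes "u \<in> real_span n FR" "\<And>w. w \<in> FR \<Longrightarrow> u \<bullet> w = 0"
  shows "u = 0\<^sub>v n"
proof -
  have uc: "u \<in> carrier_vec n" using real_span_carrier[OF FR_carrier assms(1)] .
  have "u \<bullet> u = 0" using orthogonal_real_span[OF FR_carrier uc assms(2) assms(1)] .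
  then show ?thesis using real_scalar_prod_self[OF uc] by simp
qed

lemma projection_unique:
  assumes v: "v \<in> carrier_vec n" and u: "u \<in> real_span n FR" "\<forall>w\<in>FR. (v - u) \<bullet> w = 0"
    and u': "u' \<in> real_span n FR" "\<forall>w\<in>FR. (v - u') \<bullet> w = 0"
  shows "u = u'"
proof -
  have c: "u \<in> carrier_vec n" "u' \<in> carrier_vec n" using real_span_carrier[OF FR_carrier] u u' by auto
  have "u - u' = 0\<^sub>v n"
  proof (rule span_orthogonal_zero)
    show "u - u' \<in> real_span n FR" using real_span_minus[OF FR_carrier u(1) u'(1)] .
    fix w assume w: "w \<in> FR"
    then have wc: "w \<in> carrier_vec n" using FR_carrier by blast
    have "v \<bullet> w - u \<bullet> w = 0" "v \<bullet> w - u' \<bullet> w = 0"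
      using u(2) u'(2) w minus_scalar_prod_distrib[OF v c(1) wc] minus_scalar_prod_distrib[OF v c(2) wc] by auto
    then show "(u - u') \<bullet> w = 0" using minus_scalar_prod_distrib[OF c wc] by simp
  qed
  then show ?thesis using c by (rule vec_diff_zero)
qed

definition proj :: "real vec \<Rightarrow> real vec" where
  "proj v = (THE u. u \<in> real_span n FR \<and> (\<forall>w\<in>FR. (v - u) \<bullet> w = 0))"

lemma proj_eqI:
  assumes "v \<in> carrier_vec n" "u \<in> real_span n FR" "\<And>w. w \<in> FR \<Longrightarrow> (v - u) \<bullet> w = 0"
  shows "proj v = u"
  unfolding proj_def
proof (rule the_equality)
  show "u \<in> real_span n FR \<and> (\<forall>w\<in>FR. (v - u) \<bullet> w = 0)" using assms by blast
  then show "u' = u" if "u' \<in> real_span n FR \<and> (\<forall>w\<in>FR. (v - u') \<bullet> w = 0)" for u'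
    using that projection_unique[OF assms(1)] by blast
qed

lemma proj:
  assumes "v \<in> carrier_vec n"
  shows proj_span: "proj v \<in> real_span n FR" and proj_orthogonal: "w \<in> FR \<Longrightarrow> (v - proj v) \<bullet> w = 0"
    and proj_carrier: "proj v \<in> carrier_vec n"
proof -
  obtain u where u: "u \<in> real_span n FR" "\<forall>w\<in>FR. (v - u) \<bullet> w = 0"
    using projection_exists[OF assms] by blast
  have "proj v = u" by (rule proj_eqI[OF assms u(1)]) (use u(2) in blast)
  then show "proj v \<in> real_span n FR" "w \<in> FR \<Longrightarrow> (v - proj v) \<bullet> w = 0" "proj v \<in> carrier_vec n"
    using u real_span_carrier[OF FR_carrier] by auto
qed

lemma proj_scalar_prod:
  assumes v: "v \<in> carrier_vec n" and w: "w \<in> FR"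
  shows "proj v \<bullet> w = v \<bullet> w"
proof -
  have "w \<in> carrier_vec n" using FR_carrier w by blast
  then show ?thesis
    using proj_orthogonal[OF v w] minus_scalar_prod_distrib[OF v proj_carrier[OF v], of w] by simp
qed

lemma proj_add:
  assumes v: "v \<in> carrier_vec n" and w: "w \<in> carrier_vec n"
  shows "proj (v + w) = proj v + proj w"
proof (rule proj_eqI)
  note c = proj_carrier[OF v] proj_carrier[OF w]
  show "proj v + proj w \<in> real_span n FR"
    using real_span_add[OF FR_carrier proj_span[OF v] proj_span[OF w]] .
  fix x assume x: "x \<in> FR"
  then have xc: "x \<in> carrier_vec n" using FR_carrier by blast
  have "v + w - (proj v + proj w) = (v - proj v) + (w - proj w)"
    using v w c by (intro eq_vecI) auto
  then show "(v + w - (proj v + proj w)) \<bullet> x = 0"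
    using proj_orthogonal[OF v x] proj_orthogonal[OF w x] v w c xc
    by (simp add: add_scalar_prod_distrib[of _ n])
qed (use v w in auto)

lemma F_dual_eq: "F_dual = {u \<in> real_span n FR. \<forall>w\<in>FR. u \<bullet> w \<in> \<int>}"
  by (simp add: dual_lattice_def)

lemma F_dual: "additive_set n F_dual"
proof -
  have c: "u \<in> carrier_vec n" if "u \<in> real_span n FR" for u using real_span_carrier[OF FR_carrier that] .
  have wc: "w \<in> carrier_vec n" if "w \<in> FR" for w using FR_carrier that by blast
  have "0\<^sub>v n \<in> F_dual"
    unfolding F_dual_eq using real_span_zero[OF FR_carrier] wc by simp
  moreover have "u + v \<in> F_dual" if "u \<in> F_dual" "v \<in> F_dual" for u v
    using that real_span_add[OF FR_carrier] unfolding F_dual_eq by (simp add: add_scalar_prod_distrib[OF c c wc])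
  moreover have "- u \<in> F_dual" if "u \<in> F_dual" for u
  proof -
    have "- u = (-1) \<cdot>\<^sub>v u" by (intro eq_vecI) auto
    moreover have "((-1) \<cdot>\<^sub>v u) \<bullet> w = - (u \<bullet> w)" if w: "w \<in> FR" for w
    proof -
      have "u \<in> carrier_vec n" using \<open>u \<in> F_dual\<close> c by (simp add: F_dual_eq)
      then have "dim_vec u = dim_vec w" using wc[OF w] by auto
      then show ?thesis by (simp add: scalar_prod_smult_left)
    qed
    ultimately show ?thesis
      using that real_span_smult[OF FR_carrier, of u "-1"] unfolding F_dual_eq by simp
  qed
  ultimately show ?thesis unfolding additive_set_def using c by (auto simp: F_dual_eq)
qed

lemma FR_subset_F_dual: "FR \<subseteq> F_dual"
proof
  fix u assume u: "u \<in> FR"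
  then obtain x where x: "x \<in> F" "u = real_vec x" using FR_E by blast
  have "u \<bullet> w \<in> \<int>" if w: "w \<in> FR" for w
  proof -
    obtain y where y: "y \<in> F" "w = real_vec y" using FR_E[OF w] by blast
    have "dim_vec x = dim_vec y" using additive_setD(1)[OF F x(1)] additive_setD(1)[OF F y(1)] by simp
    then show ?thesis using x y by (simp add: real_vec_scalar_prod)
  qed
  then show "u \<in> F_dual" using real_span_mem[OF FR_carrier u] by (simp add: F_dual_eq)
qed

lemma proj_int_in_F_dual:
  assumes z: "z \<in> carrier_vec n"
  shows "proj (real_vec z) \<in> F_dual"
proof -
  have zc: "real_vec z \<in> carrier_vec n" using z by simp
  have "proj (real_vec z) \<bullet> w \<in> \<int>" if w: "w \<in> FR" for w
  proof -
    obtain y where y: "y \<in> F" "w = real_vec y" using FR_E w by blast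
    have "dim_vec z = dim_vec y" using z additive_setD(1)[OF F y(1)] by simp
    then show ?thesis using y(2) proj_scalar_prod[OF zc w] by (simp add: real_vec_scalar_prod)
  qed
  then show ?thesis using proj_span[OF zc] by (simp add: F_dual_eq)
qed

text \<open>An integer-valued functional on \<open>F\<close> extends to all integer vectors by
  composing with \<open>E\<close>; \<open>z\<close> is the vector representing
  \<open>x \<mapsto> u \<bullet> E x\<close>. The floor only changes the type, since these pairings
  are integers.\<close>

lemma proj_int_surj:
  assumes u: "u \<in> F_dual"
  shows "\<exists>z\<in>carrier_vec n. proj (real_vec z) = u"
proof -
  define z where "z = vec n (\<lambda>j. \<lfloor>u \<bullet> real_vec (col E j)\<rfloor>)"
  have z: "z \<in> carrier_vec n" by (simp add: z_def)
  have uc: "u \<in> carrier_vec n" using additive_setD(1)[OF F_dual u] .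
  have zj: "of_int (z $ j) = u \<bullet> real_vec (col E j)" if "j < n" for j
    using that u FR_I[OF col_E_in[OF that]] by (auto simp: z_def F_dual_eq elim: Ints_cases)
  have "proj (real_vec z) = u"
  proof (rule proj_eqI)
    show "u \<in> real_span n FR" using u by (simp add: F_dual_eq)
    fix w assume "w \<in> FR"
    then obtain x where x: "x \<in> F" "w = real_vec x" using FR_E by blast
    have xc: "x \<in> carrier_vec n" using F_carrier x by blast
    have "u \<bullet> w = (\<Sum>j\<in>{0..<n}. (u \<bullet> real_vec (col E j)) * of_int (x $ j))"
      using scalar_prod_mat_mult[OF E xc uc] unfolding E_fix[OF x(1)] x(2) .
    also have "\<dots> = real_vec z \<bullet> w"
      using zj z xc by (simp add: scalar_prod_def x(2))
    finally show "(real_vec z - u) \<bullet> w = 0"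
      using z uc xc x(2) by (simp add: minus_scalar_prod_distrib[of _ n])
  qed (use z in simp)
  then show ?thesis using z by blast
qed

lemma proj_int_hom: "(\<lambda>v. proj (real_vec v)) \<in> hom (vec_group n (carrier_vec n)) (vec_group n F_dual)"
  by (rule homI) (auto simp: proj_int_in_F_dual real_vec_add[of _ n] proj_add)

section \<open>The exact sequence and the cocritical group\<close>

lemma cut_orthogonal:
  assumes c: "c \<in> mat_image (transpose_mat D)" and w: "w \<in> F"
  shows "c \<bullet> w = 0"
proof -
  obtain z where z: "z \<in> carrier_vec p" "c = transpose_mat D *\<^sub>v z"
    using mat_imageE[OF c, of n p] D by auto
  have "c \<bullet> w = z \<bullet> (D *\<^sub>v w)"
    using transpose_vec_mult_scalar[OF D _ z(1), of w] mat_kernelD[OF D w] z(2) by simp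
  then show ?thesis using mat_kernelD[OF D w] z by simp
qed

text \<open>The left map is induced by \<open>M\<close>, the right one by orthogonal projection.
  \<open>M\<close> turns torsion classes into integer vectors orthogonal to \<open>F\<close>, which
  gives one inclusion of exactness; for the other, a class projecting into \<open>F\<close> is
  represented by such a vector, and \<open>N\<close> returns a torsion class mapping to it.\<close>

lemma discriminant_exact_sequence:
  assumes D0: "D0 \<in> carrier_mat q p" "D0 * D = 0\<^sub>m q n"
    and M: "M \<in> carrier_mat n p" and N: "N \<in> carrier_mat p n" and U: "U \<in> carrier_mat p n" and V: "V \<in> carrier_mat n p"
    and NM: "N * M * D = D" and MN: "M * N * transpose_mat D = transpose_mat D"
    and MD: "M * D = transpose_mat D * U" and ND: "N * transpose_mat D = D * V"
  shows "\<exists>f g. short_exact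
    (torsion_subgroup (vec_group p (mat_kernel D0) Mod mat_image D)) f
    (vec_group n (carrier_vec n) Mod (mat_image (transpose_mat D) <#>\<^bsub>vec_group n (carrier_vec n)\<^esub> F)) g
    (discriminant_group n FR)"
proof -
  let ?G = "vec_group p (mat_kernel D0)" and ?I = "mat_image D" and ?C = "mat_image (transpose_mat D)"
  let ?Z = "vec_group n (carrier_vec n)"
  define K where "K = ?C <#>\<^bsub>?Z\<^esub> F"
  let ?A = "?G Mod ?I" and ?B = "?Z Mod K" and ?H = "vec_group n F_dual"
  let ?T = "torsion_subgroup ?A" and ?Q = "?H Mod FR"
  have DT: "transpose_mat D \<in> carrier_mat n p" using D by simp
  have ker: "additive_set p (mat_kernel D0)" using additive_set_kernel[OF D0(1)] .
  have I: "additive_set p ?I" using additive_set_image[OF D] .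
  have C: "additive_set n ?C" using additive_set_image[OF DT] .
  have I_ker: "?I \<subseteq> mat_kernel D0"
  proof
    fix x assume "x \<in> ?I"
    then obtain z where z: "z \<in> carrier_vec n" "x = D *\<^sub>v z" using mat_imageE[OF _ D] by blast
    have "D0 *\<^sub>v x = (D0 * D) *\<^sub>v z" using D0(1) D z by simp
    then show "x \<in> mat_kernel D0"
      using D z by (intro mat_kernelI[OF D0(1)]) (auto simp: D0(2) zero_mat_mult_vec)
  qed
  have K_iff: "x \<in> K \<longleftrightarrow> (\<exists>c\<in>?C. \<exists>w\<in>F. x = c + w)" for x
    by (auto simp: K_def set_mult_def)
  have CK: "c \<in> K" if "c \<in> ?C" for c
    using that additive_setD(2)[OF F] additive_setD(1)[OF C that] unfolding K_iff
    by (intro bexI[of _ c] bexI[of _ "0\<^sub>v n"]) auto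
  have FK: "w \<in> K" if "w \<in> F" for w
    using that additive_setD(2)[OF C] additive_setD(1)[OF F that] unfolding K_iff
    by (intro bexI[of _ "0\<^sub>v n"] bexI[of _ w]) auto
  have K: "additive_set n K"
  proof -
    have 1: "x \<in> carrier_vec n" if "x \<in> K" for x
      using that additive_setD(1)[OF C] additive_setD(1)[OF F] unfolding K_iff by auto
    have 2: "x + y \<in> K" if x: "x \<in> K" and y: "y \<in> K" for x y
    proof -
      obtain c w where cw: "c \<in> ?C" "w \<in> F" "x = c + w" using x unfolding K_iff by blast
      obtain c' w' where cw': "c' \<in> ?C" "w' \<in> F" "y = c' + w'" using y unfolding K_iff by blast
      have "x + y = (c + c') + (w + w')"
        using additive_setD(1)[OF C cw(1)] additive_setD(1)[OF F cw(2)] additive_setD(1)[OF C cw'(1)]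
          additive_setD(1)[OF F cw'(2)] unfolding cw(3) cw'(3) by (intro eq_vecI) auto
      then show ?thesis unfolding K_iff
        using additive_setD(3)[OF C cw(1) cw'(1)] additive_setD(3)[OF F cw(2) cw'(2)] by blast
    qed
    have 3: "- x \<in> K" if x: "x \<in> K" for x
    proof -
      obtain c w where cw: "c \<in> ?C" "w \<in> F" "x = c + w" using x unfolding K_iff by blast
      have "- x = - c + - w"
        using additive_setD(1)[OF C cw(1)] additive_setD(1)[OF F cw(2)] unfolding cw(3) by (intro eq_vecI) auto
      then show ?thesis unfolding K_iff
        using additive_setD(4)[OF C cw(1)] additive_setD(4)[OF F cw(2)] by blast
    qed
    show ?thesis
      unfolding additive_set_def using 1 2 3 CK[OF additive_setD(2)[OF C]] by blast
  qed
  have K_sub: "K \<subseteq> carrier_vec n" using K by (simp add: additive_set_def)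
  have A: "comm_group ?A" using comm_group_vec_quotient[OF ker I I_ker] .
  have B: "comm_group ?B" using comm_group_vec_quotient[OF additive_set_carrier K K_sub] .
  have Q: "comm_group ?Q" using comm_group_vec_quotient[OF F_dual FR FR_subset_F_dual] .
  have T: "Group.group ?T" using group_torsion_subgroup[OF A] .

  \<comment> \<open>The cut part is orthogonal to \<open>F\<close> and the flow part lies in its
    span, so \<open>c + w\<close> projects to \<open>w\<close>.\<close>
  have "(\<lambda>v. proj (real_vec v)) ` K \<subseteq> FR"
  proof
    fix u assume "u \<in> (\<lambda>v. proj (real_vec v)) ` K"
    then obtain c w where cw: "c \<in> ?C" "w \<in> F" "u = proj (real_vec (c + w))" by (auto simp: K_iff)
    have cc: "c \<in> carrier_vec n" "w \<in> carrier_vec n" using additive_setD(1)[OF C cw(1)] additive_setD(1)[OF F cw(2)] .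
    have "proj (real_vec (c + w)) = real_vec w"
    proof (rule proj_eqI)
      show "real_vec w \<in> real_span n FR" using real_span_mem[OF FR_carrier FR_I[OF cw(2)]] .
      fix x assume "x \<in> FR"
      then obtain y where y: "y \<in> F" "x = real_vec y" using FR_E by blast
      have "real_vec (c + w) - real_vec w = real_vec c" using cc by (intro eq_vecI) auto
      then show "(real_vec (c + w) - real_vec w) \<bullet> x = 0"
        using cut_orthogonal[OF cw(1) y(1)] y additive_setD(1)[OF F y(1)] cc by (simp add: real_vec_scalar_prod)
    qed (use cc in simp)
    then show "u \<in> FR" using cw FR_I by simp
  qed
  then obtain g where g: "g \<in> hom ?B ?Q"
    and g_coset: "\<And>v. v \<in> carrier_vec n \<Longrightarrow> g (K #>\<^bsub>?Z\<^esub> v) = FR #>\<^bsub>?H\<^esub> proj (real_vec v)"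
    using quotient_hom[OF comm_group_vec_group[OF additive_set_carrier] subgroup_vec_group[OF additive_set_carrier K K_sub]
        comm_group_vec_group[OF F_dual] subgroup_vec_group[OF F_dual FR FR_subset_F_dual] proj_int_hom] by auto
  have g_surj: "g ` carrier ?B = carrier ?Q"
  proof
    show "g ` carrier ?B \<subseteq> carrier ?Q" using hom_carrier[OF g] .
    show "carrier ?Q \<subseteq> g ` carrier ?B"
    proof
      fix y assume "y \<in> carrier ?Q"
      then obtain u where u: "u \<in> F_dual" "y = FR #>\<^bsub>?H\<^esub> u" by (auto simp: carrier_FactGroup)
      obtain z where z: "z \<in> carrier_vec n" "proj (real_vec z) = u" using proj_int_surj[OF u(1)] by blast
      then show "y \<in> g ` carrier ?B"
        using u(2) g_coset[OF z(1)] by (auto simp: carrier_FactGroup)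
    qed
  qed

  have M_hom: "(\<lambda>x. M *\<^sub>v x) \<in> hom ?G ?Z"
    using M additive_setD(1)[OF ker] by (intro homI) (auto simp: mult_add_distrib_mat_vec[OF M])
  have M_I: "M *\<^sub>v x \<in> ?C" if x: "x \<in> ?I" for x
  proof -
    obtain z where z: "z \<in> carrier_vec n" "x = D *\<^sub>v z" using mat_imageE[OF x D] .
    have "M *\<^sub>v x = (M * D) *\<^sub>v z" using M D z by simp
    also have "\<dots> = transpose_mat D *\<^sub>v (U *\<^sub>v z)" unfolding MD using DT U z by simp
    finally show ?thesis using mat_imageI[OF DT, of "U *\<^sub>v z"] U z by simp
  qed
  have M_K: "(\<lambda>x. M *\<^sub>v x) ` ?I \<subseteq> K" using M_I CK by blast
  obtain f where f: "f \<in> hom ?A ?B"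
    and f_coset: "\<And>x. x \<in> mat_kernel D0 \<Longrightarrow> f (?I #>\<^bsub>?G\<^esub> x) = K #>\<^bsub>?Z\<^esub> (M *\<^sub>v x)"
    using quotient_hom[OF comm_group_vec_group[OF ker] subgroup_vec_group[OF ker I I_ker]
        comm_group_vec_group[OF additive_set_carrier] subgroup_vec_group[OF additive_set_carrier K K_sub] M_hom M_K] by auto
  have fT: "f \<in> hom ?T ?B"
    using f by (auto simp: hom_def torsion_subgroup_def)

  have T_iff: "X \<in> carrier ?T \<longleftrightarrow> (\<exists>x\<in>mat_kernel D0. X = ?I #>\<^bsub>?G\<^esub> x \<and> (\<exists>k::int. k > 0 \<and> k \<cdot>\<^sub>v x \<in> ?I))" for X
  proof -
    interpret G: comm_group ?G using comm_group_vec_group[OF ker] .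
    have nrm: "?I \<lhd> ?G" using G.subgroup_imp_normal[OF subgroup_vec_group[OF ker I I_ker]] .
    have pow: "(?I #>\<^bsub>?G\<^esub> x) [^]\<^bsub>?A\<^esub> (k::nat) = \<one>\<^bsub>?A\<^esub> \<longleftrightarrow> of_nat k \<cdot>\<^sub>v x \<in> ?I" if x: "x \<in> mat_kernel D0" for x k
    proof -
      have "of_nat k \<cdot>\<^sub>v x \<in> mat_kernel D0"
        using G.nat_pow_closed[of x k] x by (simp add: nat_pow_vec_group[OF ker x])
      moreover have "(?I #>\<^bsub>?G\<^esub> x) [^]\<^bsub>?A\<^esub> k = ?I #>\<^bsub>?G\<^esub> (of_nat k \<cdot>\<^sub>v x)"
        using normal.FactGroup_pow[OF nrm, of x k] x by (simp add: nat_pow_vec_group[OF ker x])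
      ultimately show ?thesis
        using vec_coset_one_iff[OF ker I I_ker] by simp
    qed
    have conv: "(\<exists>k::nat. k > 0 \<and> of_nat k \<cdot>\<^sub>v x \<in> ?I) \<longleftrightarrow> (\<exists>k::int. k > 0 \<and> k \<cdot>\<^sub>v x \<in> ?I)" for x
      by (metis of_nat_0_less_iff zero_less_imp_eq_int)
    have tors: "(\<exists>k::nat. k > 0 \<and> (?I #>\<^bsub>?G\<^esub> x) [^]\<^bsub>?A\<^esub> k = \<one>\<^bsub>?A\<^esub>) \<longleftrightarrow> (\<exists>k::int. k > 0 \<and> k \<cdot>\<^sub>v x \<in> ?I)"
      if "x \<in> mat_kernel D0" for x
      using pow[OF that] conv[of x] by simp
    have "X \<in> carrier ?T \<longleftrightarrow> (\<exists>x\<in>mat_kernel D0. X = ?I #>\<^bsub>?G\<^esub> x) \<and> (\<exists>k::nat. k > 0 \<and> X [^]\<^bsub>?A\<^esub> k = \<one>\<^bsub>?A\<^esub>)"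
      by (simp add: torsion_subgroup_def carrier_FactGroup image_iff)
    also have "\<dots> \<longleftrightarrow> (\<exists>x\<in>mat_kernel D0. X = ?I #>\<^bsub>?G\<^esub> x \<and> (\<exists>k::nat. k > 0 \<and> (?I #>\<^bsub>?G\<^esub> x) [^]\<^bsub>?A\<^esub> k = \<one>\<^bsub>?A\<^esub>))"
      by blast
    also have "\<dots> \<longleftrightarrow> (\<exists>x\<in>mat_kernel D0. X = ?I #>\<^bsub>?G\<^esub> x \<and> (\<exists>k::int. k > 0 \<and> k \<cdot>\<^sub>v x \<in> ?I))"
      by (rule bex_cong[OF refl]) (simp only: tors)
    finally show ?thesis .
  qed
  \<comment> \<open>\<open>k (M x)\<close> is a cut and hence orthogonal to \<open>F\<close>; the
    factor \<open>k\<close> cancels because the pairing is an integer.\<close>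
  have M_orth: "(M *\<^sub>v x) \<bullet> w = 0" if x: "x \<in> carrier_vec p" "k > 0" "k \<cdot>\<^sub>v x \<in> ?I" and w: "w \<in> F" for x w k
  proof -
    have wc: "w \<in> carrier_vec n" using F_carrier w by blast
    have "k * ((M *\<^sub>v x) \<bullet> w) = (k \<cdot>\<^sub>v (M *\<^sub>v x)) \<bullet> w"
      using M wc by (subst scalar_prod_smult_left) auto
    also have "k \<cdot>\<^sub>v (M *\<^sub>v x) = M *\<^sub>v (k \<cdot>\<^sub>v x)" using mult_mat_vec_smult[OF M x(1)] by simp
    also have "(M *\<^sub>v (k \<cdot>\<^sub>v x)) \<bullet> w = 0" using cut_orthogonal[OF M_I[OF x(3)] w] .
    finally show ?thesis using x(2) by simp
  qed
  \<comment> \<open>\<open>N M\<close> is the identity on the image of \<open>D\<close>, therefore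
    also on every \<open>x\<close> with a nonzero multiple there, and \<open>N\<close> sends cuts
    back into that image.\<close>
  have M_inj: "x \<in> ?I" if x: "x \<in> carrier_vec p" "k > 0" "k \<cdot>\<^sub>v x \<in> ?I" "M *\<^sub>v x \<in> ?C" for x k
  proof -
    obtain z where z: "z \<in> carrier_vec n" "k \<cdot>\<^sub>v x = D *\<^sub>v z" using mat_imageE[OF x(3) D] .
    obtain u where u: "u \<in> carrier_vec p" "M *\<^sub>v x = transpose_mat D *\<^sub>v u" using mat_imageE[OF x(4) DT] .
    have c: "N *\<^sub>v (M *\<^sub>v x) \<in> carrier_vec p" using N M x(1) by auto
    have "k \<cdot>\<^sub>v (N *\<^sub>v (M *\<^sub>v x)) = N *\<^sub>v (M *\<^sub>v (k \<cdot>\<^sub>v x))"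
      using mult_mat_vec_smult[OF M x(1)] mult_mat_vec_smult[OF N, of "M *\<^sub>v x"] M x(1) by simp
    also have "\<dots> = (N * M * D) *\<^sub>v z"
      using mat_mult3_vec[OF N M D z(1)] z(2) by simp
    also have "\<dots> = k \<cdot>\<^sub>v x" using NM z by simp
    finally have "N *\<^sub>v (M *\<^sub>v x) = x" using smult_vec_cancel[of k, OF _ _ c x(1)] x(2) by simp
    moreover have "N *\<^sub>v (M *\<^sub>v x) = (N * transpose_mat D) *\<^sub>v u" using N DT u by simp
    moreover have "\<dots> = D *\<^sub>v (V *\<^sub>v u)" unfolding ND using D V u by simp
    ultimately have "x = D *\<^sub>v (V *\<^sub>v u)" by simp
    then show ?thesis using mat_imageI[OF D, of "V *\<^sub>v u"] V u by simp
  qed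

  have "f ` carrier ?T = Coset.kernel ?B ?Q g"
  proof
    show "f ` carrier ?T \<subseteq> Coset.kernel ?B ?Q g"
    proof
      fix Y assume "Y \<in> f ` carrier ?T"
      then obtain X where X: "X \<in> carrier ?T" "Y = f X" by blast
      obtain x k where x: "x \<in> mat_kernel D0" "Y = f (?I #>\<^bsub>?G\<^esub> x)" "k > 0" "k \<cdot>\<^sub>v x \<in> ?I"
        using X(1) unfolding T_iff X(2) by blast
      have xc: "x \<in> carrier_vec p" using additive_setD(1)[OF ker x(1)] .
      have Mx: "M *\<^sub>v x \<in> carrier_vec n" using M xc by auto
      have Y: "Y = K #>\<^bsub>?Z\<^esub> (M *\<^sub>v x)" using f_coset[OF x(1)] x(2) by simp
      have "proj (real_vec (M *\<^sub>v x)) = 0\<^sub>v n"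
      proof (rule proj_eqI)
        show "0\<^sub>v n \<in> real_span n FR" using real_span_zero[OF FR_carrier] .
        fix w assume "w \<in> FR"
        then obtain y where y: "y \<in> F" "w = real_vec y" using FR_E by blast
        have "real_vec (M *\<^sub>v x) - 0\<^sub>v n = real_vec (M *\<^sub>v x)" using Mx by simp
        then show "(real_vec (M *\<^sub>v x) - 0\<^sub>v n) \<bullet> w = 0"
          using M_orth[OF xc x(3,4) y(1)] y(2) additive_setD(1)[OF F y(1)] M by (simp add: real_vec_scalar_prod)
      qed (use Mx in simp)
      then have "g Y = FR"
        using Y g_coset[OF Mx] vec_coset_one_iff[OF F_dual FR FR_subset_F_dual additive_setD(2)[OF F_dual]]
          additive_setD(2)[OF FR] by simp
      moreover have "Y \<in> carrier ?B" using Y Mx by (auto simp: carrier_FactGroup)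
      ultimately show "Y \<in> Coset.kernel ?B ?Q g" by (simp add: Coset.kernel_def)
    qed
    show "Coset.kernel ?B ?Q g \<subseteq> f ` carrier ?T"
    proof
      fix Y assume "Y \<in> Coset.kernel ?B ?Q g"
      then obtain v where v: "v \<in> carrier_vec n" "Y = K #>\<^bsub>?Z\<^esub> v" "g Y = FR"
        by (auto simp: Coset.kernel_def carrier_FactGroup)
      have vc: "real_vec v \<in> carrier_vec n" using v(1) by simp
      have "FR #>\<^bsub>?H\<^esub> proj (real_vec v) = FR" using g_coset[OF v(1)] v by simp
      then have "proj (real_vec v) \<in> FR"
        using vec_coset_one_iff[OF F_dual FR FR_subset_F_dual proj_int_in_F_dual[OF v(1)]] by simp
      then obtain w where w: "w \<in> F" "proj (real_vec v) = real_vec w" using FR_E by blast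
      have wc: "w \<in> carrier_vec n" using F_carrier w by blast
      \<comment> \<open>Subtracting the flow \<open>w\<close> keeps the class and leaves a vector
        orthogonal to \<open>F\<close>.\<close>
      define t where "t = v - w"
      have tc: "t \<in> carrier_vec n" using v wc by (simp add: t_def)
      have "t \<bullet> y = 0" if y: "y \<in> F" for y
      proof -
        have yc: "y \<in> carrier_vec n" using F_carrier y by blast
        have "real_of_int (t \<bullet> y) = (real_vec v - proj (real_vec v)) \<bullet> real_vec y"
          using real_vec_scalar_prod[of t y] tc yc wc real_vec_diff[OF v(1) wc] by (simp add: t_def w(2))
        then show ?thesis using proj_orthogonal[OF vc FR_I[OF y]] by simp
      qed
      then have mt: "m \<cdot>\<^sub>v t = transpose_mat D *\<^sub>v (W *\<^sub>v t)" using orthogonal_F_imp[OF tc] by blast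
      have Wt: "W *\<^sub>v t \<in> carrier_vec p" using W tc by auto
      let ?y = "N *\<^sub>v t"
      have yc: "?y \<in> carrier_vec p" using N tc by auto
      have my: "m \<cdot>\<^sub>v ?y = D *\<^sub>v (V *\<^sub>v (W *\<^sub>v t))"
      proof -
        have "m \<cdot>\<^sub>v ?y = N *\<^sub>v (m \<cdot>\<^sub>v t)" using mult_mat_vec_smult[OF N tc] by simp
        also have "\<dots> = (N * transpose_mat D) *\<^sub>v (W *\<^sub>v t)" unfolding mt using N DT Wt by simp
        also have "\<dots> = D *\<^sub>v (V *\<^sub>v (W *\<^sub>v t))" unfolding ND using D V Wt by simp
        finally show ?thesis .
      qed
      have VWt: "V *\<^sub>v (W *\<^sub>v t) \<in> carrier_vec n" using V Wt by auto
      have my_I: "m \<cdot>\<^sub>v ?y \<in> ?I" unfolding my using mat_imageI[OF D VWt] .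
      \<comment> \<open>A nonzero multiple of the preimage is a boundary and so a cycle; integer
        vectors have no torsion, so the preimage itself is a cycle.\<close>
      have y_ker: "?y \<in> mat_kernel D0"
      proof (rule mat_kernelI[OF D0(1) yc])
        have "m \<cdot>\<^sub>v (D0 *\<^sub>v ?y) = D0 *\<^sub>v (m \<cdot>\<^sub>v ?y)" using mult_mat_vec_smult[OF D0(1) yc] by simp
        also have "\<dots> = 0\<^sub>v q" using my_I I_ker mat_kernelD(2)[OF D0(1)] by blast
        also have "\<dots> = m \<cdot>\<^sub>v 0\<^sub>v q" by (intro eq_vecI) auto
        finally show "D0 *\<^sub>v ?y = 0\<^sub>v q" using smult_vec_cancel[of m _ _ q] m D0(1) yc by simp
      qed
      \<comment> \<open>\<open>M N\<close> is the identity on the cuts, and \<open>m t\<close> is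
        one of them.\<close>
      have "M *\<^sub>v ?y = t"
      proof -
        have "m \<cdot>\<^sub>v (M *\<^sub>v ?y) = M *\<^sub>v (N *\<^sub>v (m \<cdot>\<^sub>v t))"
          using mult_mat_vec_smult[OF M yc] mult_mat_vec_smult[OF N tc] by simp
        also have "\<dots> = (M * N * transpose_mat D) *\<^sub>v (W *\<^sub>v t)" unfolding mt using mat_mult3_vec[OF M N DT Wt] by simp
        also have "\<dots> = m \<cdot>\<^sub>v t" unfolding MN mt ..
        finally show ?thesis using smult_vec_cancel[of m _ _ n] m M yc tc by simp
      qed
      moreover have "v - t \<in> K"
      proof -
        have "v - t = w" using v wc by (intro eq_vecI) (auto simp: t_def)
        then show ?thesis using FK[OF w(1)] by simp
      qed
      then have "K #>\<^bsub>?Z\<^esub> v = K #>\<^bsub>?Z\<^esub> t"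
        using vec_coset_eq_iff[OF additive_set_carrier K K_sub v(1) tc] by simp
      ultimately have "Y = f (?I #>\<^bsub>?G\<^esub> ?y)" using f_coset[OF y_ker] v(2) by simp
      moreover have "?I #>\<^bsub>?G\<^esub> ?y \<in> carrier ?T" unfolding T_iff using y_ker m my_I by blast
      ultimately show "Y \<in> f ` carrier ?T" by blast
    qed
  qed
  moreover have "inj_on f (carrier ?T)"
    unfolding inj_on_one_iff'[OF fT T comm_group.axioms(2)[OF B]]
  proof (intro allI impI)
    fix X assume X: "X \<in> carrier ?T" "f X = \<one>\<^bsub>?B\<^esub>"
    then obtain x k where x: "x \<in> mat_kernel D0" "X = ?I #>\<^bsub>?G\<^esub> x" "k > 0" "k \<cdot>\<^sub>v x \<in> ?I"
      unfolding T_iff by blast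
    have xc: "x \<in> carrier_vec p" using additive_setD(1)[OF ker x(1)] .
    have Mx: "M *\<^sub>v x \<in> carrier_vec n" using M xc by auto
    have "K #>\<^bsub>?Z\<^esub> (M *\<^sub>v x) = K" using f_coset[OF x(1)] x(2) X(2) by simp
    then have "M *\<^sub>v x \<in> K" using vec_coset_one_iff[OF additive_set_carrier K K_sub Mx] by simp
    then obtain c w where cw: "c \<in> ?C" "w \<in> F" "M *\<^sub>v x = c + w" unfolding K_iff by blast
    have cc: "c \<in> carrier_vec n" "w \<in> carrier_vec n" using additive_setD(1)[OF C cw(1)] additive_setD(1)[OF F cw(2)] .
    \<comment> \<open>Both \<open>M x\<close> and \<open>c\<close> are orthogonal to
      \<open>w\<close>, and \<open>w\<close> is their difference. This is where the sum of cuts and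
      flows is seen to be direct.\<close>
    have "w \<bullet> w = 0"
      using M_orth[OF xc x(3,4) cw(2)] cut_orthogonal[OF cw(1,2)] add_scalar_prod_distrib[OF cc cc(2)] cw(3) by simp
    then have "real_vec w \<bullet> real_vec w = 0" by (simp add: real_vec_scalar_prod)
    then have "real_vec w = 0\<^sub>v n" using real_scalar_prod_self[of "real_vec w" n] cc by simp
    also have "\<dots> = real_vec (0\<^sub>v n)" by (intro eq_vecI) auto
    finally have "w = 0\<^sub>v n" by (simp only: real_vec_inject)
    then have "M *\<^sub>v x \<in> ?C" using cw cc by simp
    then have "x \<in> ?I" using M_inj[OF xc x(3,4)] by blast
    then have "X = ?I" using x(2) vec_coset_one_iff[OF ker I I_ker x(1)] by simp
    then show "X = \<one>\<^bsub>?T\<^esub>" by (simp add: torsion_subgroup_def)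
  qed
  ultimately have "short_exact ?T f ?B g ?Q"
    unfolding short_exact_def mon_def epi_def
    using T comm_group.axioms(2)[OF B] comm_group.axioms(2)[OF Q] fT g g_surj by blast
  then show ?thesis unfolding K_def discriminant_group_def by blast
qed

text \<open>The hypotheses say that the columns of \<open>A\<close> form a basis of
  \<open>F\<close>. A vector of the real span is determined by its pairings with them, and every
  integer vector of pairings occurs; on \<open>F\<close>, the image of \<open>A\<close>, taking
  pairings is multiplication by the transpose of \<open>A\<close>.\<close>

lemma cocritical_iso_discriminant:
  assumes A: "A \<in> carrier_mat n k" and im: "mat_image A = F" and inj: "mat_kernel A = {0\<^sub>v k}"
  shows "vec_group k (carrier_vec k) Mod mat_image (transpose_mat A * A) \<cong> discriminant_group n FR"
proof -
  let ?H = "vec_group n F_dual" and ?Z = "vec_group k (carrier_vec k)" and ?I = "mat_image (transpose_mat A * A)"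
  have AT: "transpose_mat A \<in> carrier_mat k n" and AA: "transpose_mat A * A \<in> carrier_mat k k" using A by auto
  have I: "additive_set k ?I" using additive_set_image[OF AA] .
  then have I_sub: "?I \<subseteq> carrier_vec k" by (simp add: additive_set_def)
  have col_in: "col A j \<in> F" if "j < k" for j
  proof -
    have "A *\<^sub>v unit_vec k j = col A j" using mat_mult_unit_vec[OF A that] .
    then show ?thesis unfolding im[symmetric] using mat_imageI[OF A, of "unit_vec k j"] by simp
  qed
  \<comment> \<open>Multiplication by the transpose of \<open>A\<close>. The floor returns to
    integer vectors and is exact on the dual lattice.\<close>
  define h where "h u = vec k (\<lambda>j. \<lfloor>u \<bullet> real_vec (col A j)\<rfloor>)" for u
  have hj: "of_int (h u $ j) = u \<bullet> real_vec (col A j)" if "u \<in> F_dual" "j < k" for u j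
    using that FR_I[OF col_in[OF that(2)]] by (auto simp: h_def F_dual_eq elim: Ints_cases)
  have hc: "h u \<in> carrier_vec k" for u by (simp add: h_def)
  have uc: "u \<in> carrier_vec n" if "u \<in> F_dual" for u using additive_setD(1)[OF F_dual that] .
  have h_hom: "h \<in> hom ?H ?Z"
  proof (rule homI)
    fix u v assume uv: "u \<in> carrier ?H" "v \<in> carrier ?H"
    have "h (u + v) = h u + h v"
    proof (rule eq_vecI)
      fix j assume "j < dim_vec (h u + h v)"
      then have j: "j < k" by (simp add: h_def)
      have "real_of_int (h (u + v) $ j) = real_of_int (h u $ j + h v $ j)"
        using uv hj j additive_setD(3)[OF F_dual] uc A
        by (simp add: add_scalar_prod_distrib[of _ n])
      then show "h (u + v) $ j = (h u + h v) $ j" using j hc[of u] hc[of v] by (simp only: of_int_eq_iff) simp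
    qed (simp add: h_def)
    then show "h (u \<otimes>\<^bsub>?H\<^esub> v) = h u \<otimes>\<^bsub>?Z\<^esub> h v" by simp
  qed (simp add: hc)
  have h_FR: "h (real_vec (A *\<^sub>v y)) = (transpose_mat A * A) *\<^sub>v y" if y: "y \<in> carrier_vec k" for y
  proof (rule eq_vecI)
    fix j assume "j < dim_vec ((transpose_mat A * A) *\<^sub>v y)"
    then have j: "j < k" using A by auto
    have Ay: "A *\<^sub>v y \<in> carrier_vec n" using A y by auto
    have "h (real_vec (A *\<^sub>v y)) $ j = (A *\<^sub>v y) \<bullet> col A j"
      using j A by (simp add: h_def real_vec_scalar_prod)
    also have "\<dots> = (transpose_mat A *\<^sub>v (A *\<^sub>v y)) $ j"
      using j A Ay by (simp add: comm_scalar_prod[of _ n])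
    also have "transpose_mat A *\<^sub>v (A *\<^sub>v y) = (transpose_mat A * A) *\<^sub>v y" using A AT y by simp
    finally show "h (real_vec (A *\<^sub>v y)) $ j = ((transpose_mat A * A) *\<^sub>v y) $ j" .
  qed (use A in \<open>simp add: h_def\<close>)
  have h_im: "h ` FR \<subseteq> ?I"
  proof
    fix z assume "z \<in> h ` FR"
    then obtain x where x: "x \<in> F" "z = h (real_vec x)" using FR_E by blast
    obtain y where "y \<in> carrier_vec k" "x = A *\<^sub>v y" using mat_imageE[OF _ A] x(1) im by blast
    then show "z \<in> ?I" using x(2) h_FR mat_imageI[OF AA] by simp
  qed
  obtain \<phi> where \<phi>: "\<phi> \<in> hom (?H Mod FR) (?Z Mod ?I)"
    and \<phi>_coset: "\<And>u. u \<in> F_dual \<Longrightarrow> \<phi> (FR #>\<^bsub>?H\<^esub> u) = ?I #>\<^bsub>?Z\<^esub> h u"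
    using quotient_hom[OF comm_group_vec_group[OF F_dual] subgroup_vec_group[OF F_dual FR FR_subset_F_dual]
        comm_group_vec_group[OF additive_set_carrier] subgroup_vec_group[OF additive_set_carrier I I_sub] h_hom h_im] by auto
  have gH: "Group.group (?H Mod FR)" and gZ: "Group.group (?Z Mod ?I)"
    using comm_group.axioms(2)[OF comm_group_vec_quotient[OF F_dual FR FR_subset_F_dual]]
      comm_group.axioms(2)[OF comm_group_vec_quotient[OF additive_set_carrier I I_sub]] by auto
  have "inj_on \<phi> (carrier (?H Mod FR))"
    unfolding inj_on_one_iff'[OF \<phi> gH gZ]
  proof (intro allI impI)
    fix X assume X: "X \<in> carrier (?H Mod FR)" "\<phi> X = \<one>\<^bsub>?Z Mod ?I\<^esub>"
    then obtain u where u: "u \<in> F_dual" "X = FR #>\<^bsub>?H\<^esub> u" by (auto simp: carrier_FactGroup)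
    have "h u \<in> ?I"
      using X(2) u \<phi>_coset[OF u(1)] vec_coset_one_iff[OF additive_set_carrier I I_sub hc] by simp
    then obtain y where y: "y \<in> carrier_vec k" "h u = (transpose_mat A * A) *\<^sub>v y" using mat_imageE[OF _ AA] by blast
    \<comment> \<open>A lattice vector with the same pairings as \<open>u\<close>. The difference
      lies in the span of \<open>F\<close> and is orthogonal to \<open>F\<close>, hence
      zero.\<close>
    let ?a = "real_vec (A *\<^sub>v y)"
    have aFR: "?a \<in> FR" using FR_I mat_imageI[OF A y(1)] im by simp
    then have a: "?a \<in> F_dual" using FR_subset_F_dual by blast
    have d: "u - ?a \<in> carrier_vec n" using uc[OF u(1)] uc[OF a] by (rule minus_carrier_vec)
    have "u - ?a = 0\<^sub>v n"
    proof (rule span_orthogonal_zero)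
      show "u - ?a \<in> real_span n FR"
        using real_span_minus[OF FR_carrier] u(1) a by (simp add: F_dual_eq)
      fix w assume "w \<in> FR"
      then obtain x where x: "x \<in> F" "w = real_vec x" using FR_E by blast
      obtain y' where y': "y' \<in> carrier_vec k" "x = A *\<^sub>v y'" using mat_imageE[OF _ A] x(1) im by blast
      have "(u - ?a) \<bullet> real_vec (col A j) = 0" if j: "j < k" for j
      proof -
        have "u \<bullet> real_vec (col A j) = ?a \<bullet> real_vec (col A j)"
          using hj[OF u(1) j] hj[OF a j] h_FR[OF y(1)] y(2) by simp
        then show ?thesis using uc[OF u(1)] uc[OF a] A j by (simp add: minus_scalar_prod_distrib[of _ n])
      qed
      then show "(u - ?a) \<bullet> w = 0"
        using scalar_prod_mat_mult[OF A y'(1) d] x(2) y'(2) by simp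
    qed
    then have "u = ?a" using uc[OF u(1)] uc[OF a] by (rule vec_diff_zero)
    then have "X = FR" using u aFR vec_coset_one_iff[OF F_dual FR FR_subset_F_dual u(1)] by simp
    then show "X = \<one>\<^bsub>?H Mod FR\<^esub>" by simp
  qed
  moreover have "carrier (?Z Mod ?I) \<subseteq> \<phi> ` carrier (?H Mod FR)"
  proof
    fix X assume "X \<in> carrier (?Z Mod ?I)"
    then obtain z where z: "z \<in> carrier_vec k" "X = ?I #>\<^bsub>?Z\<^esub> z" by (auto simp: carrier_FactGroup)
    have "\<forall>j. j < n \<longrightarrow> (\<exists>y. y \<in> carrier_vec k \<and> A *\<^sub>v y = col E j)"
      using mat_imageE[OF _ A] col_E_in im by metis
    then obtain y where y: "\<And>j. j < n \<Longrightarrow> y j \<in> carrier_vec k" "\<And>j. j < n \<Longrightarrow> A *\<^sub>v y j = col E j" by metis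
    \<comment> \<open>A lift of \<open>E\<close> through \<open>A\<close>. Since \<open>E\<close>
      fixes the image of \<open>A\<close>, \<open>A Y A = A\<close>, and injectivity of
      \<open>A\<close> makes \<open>Y\<close> a left inverse of \<open>A\<close>.\<close>
    define Y where "Y = mat k n (\<lambda>(i, j). y j $ i)"
    have Y: "Y \<in> carrier_mat k n" by (simp add: Y_def)
    have AY: "A * Y = E"
    proof (rule eq_matI)
      fix i j assume "i < dim_row E" "j < dim_col E"
      then have ij: "i < n" "j < n" using E by auto
      have "col Y j = y j" using ij y(1)[OF ij(2)] by (intro eq_vecI) (auto simp: Y_def)
      then have "(A * Y) $$ (i, j) = (A *\<^sub>v y j) $ i" using A Y ij by simp
      then show "(A * Y) $$ (i, j) = E $$ (i, j)" using y(2)[OF ij(2)] ij E by simp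
    qed (use A Y E in auto)
    \<comment> \<open>Pairing with column \<open>i\<close> of \<open>A\<close> gives
      \<open>z $ i\<close>, because \<open>Y\<close> sends that column to the \<open>i\<close>-th
      unit vector. Projecting to the span of \<open>F\<close> leaves all pairings with
      \<open>F\<close> as they are.\<close>
    define v where "v = transpose_mat Y *\<^sub>v z"
    have v: "v \<in> carrier_vec n" using Y z by (simp add: v_def)
    let ?u = "proj (real_vec v)"
    have u: "?u \<in> F_dual" using proj_int_in_F_dual[OF v] .
    have "h ?u = z"
    proof (rule eq_vecI)
      fix i assume "i < dim_vec z"
      then have i: "i < k" using z by simp
      have ac: "col A i \<in> carrier_vec n" using A i by auto
      have Yc: "Y *\<^sub>v col A i \<in> carrier_vec k" using Y ac by auto
      have "A *\<^sub>v (Y *\<^sub>v col A i) = A *\<^sub>v unit_vec k i"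
        using A Y ac i E_fix[OF col_in[OF i]] AY mat_mult_unit_vec[OF A i] assoc_mult_mat_vec[OF A Y ac] by simp
      then have "A *\<^sub>v (Y *\<^sub>v col A i - unit_vec k i) = 0\<^sub>v n"
        using A Yc by (simp add: mult_minus_distrib_mat_vec[OF A Yc])
      then have "Y *\<^sub>v col A i - unit_vec k i \<in> mat_kernel A"
        using Yc by (intro mat_kernelI[OF A]) auto
      then have *: "Y *\<^sub>v col A i - unit_vec k i = 0\<^sub>v k" using inj by simp
      have Yi: "Y *\<^sub>v col A i = unit_vec k i"
        using * Yc by (rule vec_diff_zero) simp
      have "real_of_int (h ?u $ i) = ?u \<bullet> real_vec (col A i)" using hj[OF u i] .
      also have "\<dots> = real_vec v \<bullet> real_vec (col A i)"
        using v by (intro proj_scalar_prod FR_I col_in[OF i]) simp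
      also have "\<dots> = of_int (v \<bullet> col A i)" using v A by (simp add: real_vec_scalar_prod)
      also have "v \<bullet> col A i = z \<bullet> (Y *\<^sub>v col A i)"
        unfolding v_def using transpose_vec_mult_scalar[OF Y ac z(1)] .
      also have "\<dots> = z $ i" unfolding Yi using z(1) i by simp
      finally show "h ?u $ i = z $ i" by simp
    qed (use z in \<open>simp add: h_def\<close>)
    then have "X = \<phi> (FR #>\<^bsub>?H\<^esub> ?u)" using \<phi>_coset[OF u] z(2) by simp
    then show "X \<in> \<phi> ` carrier (?H Mod FR)" using u by (auto simp: carrier_FactGroup)
  qed
  ultimately have "\<phi> \<in> iso (?H Mod FR) (?Z Mod ?I)"
    using \<phi> hom_carrier[OF \<phi>] by (auto simp: iso_def bij_betw_def)
  then have "?H Mod FR \<cong> ?Z Mod ?I" by (rule is_isoI)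
  then show ?thesis unfolding discriminant_group_def using group.iso_sym[OF gH] by blast
qed

end

section \<open>Homology of an acyclization in degrees \<open>d\<close> and
  \<open>d + 1\<close>\<close>

lemma mat_image_no_columns:
  assumes "(A :: int mat) \<in> carrier_mat p 0"
  shows "mat_image A = {0\<^sub>v p}"
proof -
  have "x = 0\<^sub>v p" if x: "x \<in> mat_image A" for x
  proof -
    obtain v where "v \<in> carrier_vec 0" "x = A *\<^sub>v v" using mat_imageE[OF x assms] .
    then show ?thesis using assms by (intro eq_vecI) (auto simp: scalar_prod_def)
  qed
  moreover have "0\<^sub>v p \<in> mat_image A" by (rule additive_setD(2)[OF additive_set_image[OF assms]])
  ultimately show ?thesis by blast
qed

lemma trivial_vec_quotientD:
  assumes "trivial_group (vec_group n L Mod K)" "additive_set n L" "additive_set n K" "K \<subseteq> L"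
  shows "L = K"
proof -
  have "x \<in> K" if x: "x \<in> L" for x
  proof -
    have "K #>\<^bsub>vec_group n L\<^esub> x \<in> carrier (vec_group n L Mod K)"
      using x by (simp add: carrier_FactGroup)
    then have "K #>\<^bsub>vec_group n L\<^esub> x = K" using assms(1) by (simp add: trivial_group_def)
    then show ?thesis using vec_coset_one_iff[OF assms(2-4) x] by simp
  qed
  then show ?thesis using assms(4) by blast
qed

text \<open>\<open>Max\<close> is an upper bound only for a finite set, so the occupied dimensions
  are first confined to -1 and the finitely many dimensions of actual cells.\<close>

lemma (in finite_cw) num_cells_above_dim:
  assumes "i > cw_dim X"
  shows "num_cells X i = 0"
proof (rule ccontr)
  assume "num_cells X i \<noteq> 0"
  then have "i \<in> {i. num_cells X i > 0}" by simp
  moreover have "{i. num_cells X i > 0} \<subseteq> insert (-1) (int ` {m. cw_count X m > 0})"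
  proof
    fix j assume "j \<in> {i. num_cells X i > 0}"
    then consider "j = -1" | "j \<ge> 0" "cw_count X (nat j) > 0"
      by (auto simp: num_cells_def split: if_splits)
    then show "j \<in> insert (-1) (int ` {m. cw_count X m > 0})"
    proof cases
      case 2
      then have "j = int (nat j)" "nat j \<in> {m. cw_count X m > 0}" by simp_all
      then show ?thesis by blast
    qed simp
  qed
  then have "finite {i. num_cells X i > 0}"
    by (rule finite_subset) (use finite_dims in simp)
  ultimately have "i \<le> cw_dim X" unfolding cw_dim_def by (rule Max_ge[rotated])
  then show False using assms by simp
qed

theorem theorem7p7:
  fixes X :: "'a cw_complex" and d :: int and n :: nat
  assumes "finite_cw_complex X" and "cw_dim X = d" and "num_cells X d = n"
  shows "(\<exists>f g. short_exact
           (torsion_subgroup (reduced_cellular_homology X (d - 1))) f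
           (vec_group n (carrier_vec n) Mod
              (cut_lattice X <#>\<^bsub>vec_group n (carrier_vec n)\<^esub> flow_lattice X)) g
           (discriminant_group n (real_lattice (flow_lattice X)))) \<and>
         (\<forall>Y. acyclization Y X \<longrightarrow>
           cocritical_group X Y \<cong> discriminant_group n (real_lattice (flow_lattice X)))"
proof -
  interpret X: finite_cw X by unfold_locales (rule assms(1))
  define D where "D = cell_boundary X d"
  define p where "p = num_cells X (d - 1)"
  have D: "D \<in> carrier_mat p n"
    using X.cell_boundary_carrier[of d] assms(3) by (simp add: D_def p_def)
  have D0: "cell_boundary X (d - 1) \<in> carrier_mat (num_cells X (d - 2)) p"
    using X.cell_boundary_carrier[of "d - 1"] by (simp add: p_def)
  have D0D: "cell_boundary X (d - 1) * D = 0\<^sub>m (num_cells X (d - 2)) n"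
    using X.boundary_boundary[of d] assms(3) by (simp add: D_def)
  obtain M N U V E W m where MN: "M \<in> carrier_mat n p" "N \<in> carrier_mat p n" "U \<in> carrier_mat p n" "V \<in> carrier_mat n p"
    and EW: "E \<in> carrier_mat n n" "W \<in> carrier_mat p n" "m > 0"
    and eqs: "N * M * D = D" "M * N * transpose_mat D = transpose_mat D"
      "M * D = transpose_mat D * U" "N * transpose_mat D = D * V"
    and DE: "D * E = 0\<^sub>m p n" "transpose_mat D * W = m \<cdot>\<^sub>m (1\<^sub>m n - transpose_mat E)"
    using torsion_transfer_matrices[OF D] by metis
  interpret kernel_lattice D E W p n m
    using D EW DE by unfold_locales
  have flow: "flow_lattice X = mat_kernel D" and cut: "cut_lattice X = mat_image (transpose_mat D)"
    by (simp_all add: flow_lattice_def cut_lattice_def D_def assms(2))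
  have hom: "reduced_cellular_homology X (d - 1) = vec_group p (mat_kernel (cell_boundary X (d - 1))) Mod mat_image D"
    by (simp add: reduced_cellular_homology_def D_def p_def)
  have "cocritical_group X Y \<cong> discriminant_group n FR" if Y: "acyclization Y X" for Y
  proof -
    have sk: "is_skeleton X Y d" and dimY: "cw_dim Y = d + 1"
      and triv1: "trivial_group (reduced_cellular_homology Y (d + 1))"
      and triv0: "trivial_group (reduced_cellular_homology Y d)"
      using Y assms(2) by (simp_all add: acyclization_def)
    interpret Y: finite_cw Y using Y by unfold_locales (simp add: acyclization_def)
    define k where "k = num_cells Y (d + 1)"
    define A where "A = cell_boundary Y (d + 1)"
    have nY: "num_cells Y d = n" using num_cells_skeleton[OF sk, of d] assms(3) by simp
    have DY: "cell_boundary Y d = D" using cell_boundary_skeleton[OF sk, of d] by (simp add: D_def)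
    have A: "A \<in> carrier_mat n k"
      using Y.cell_boundary_carrier[of "d + 1"] nY by (simp add: A_def k_def)
    have DA: "D * A = 0\<^sub>m p k"
      using Y.boundary_boundary[of "d + 1"] num_cells_skeleton[OF sk, of "d - 1"]
      by (simp add: DY A_def k_def p_def)
    have "mat_image A \<subseteq> F"
    proof
      fix x assume "x \<in> mat_image A"
      then obtain z where z: "z \<in> carrier_vec k" "x = A *\<^sub>v z" using mat_imageE[OF _ A] by blast
      have "D *\<^sub>v x = (D * A) *\<^sub>v z" using D A z by simp
      also have "\<dots> = 0\<^sub>v p" unfolding DA using zero_mat_mult_vec[OF z(1)] .
      finally show "x \<in> F" using A z by (intro mat_kernelI[OF D]) auto
    qed
    moreover have "trivial_group (vec_group n F Mod mat_image A)"
      using triv0 by (simp add: reduced_cellular_homology_def DY nY A_def)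
    \<comment> \<open>Vanishing homology in degree \<open>d\<close> says that every flow is a
      boundary.\<close>
    ultimately have im: "mat_image A = F"
      using trivial_vec_quotientD[OF _ F additive_set_image[OF A]] by simp
    \<comment> \<open>There are no cells in degree \<open>d + 2\<close>, so the homology in degree
      \<open>d + 1\<close> is the kernel of \<open>A\<close> divided by zero, and its vanishing
      makes \<open>A\<close> injective.\<close>
    have "d + 2 - 1 = d + 1" by simp
    then have "cell_boundary Y (d + 2) \<in> carrier_mat k 0"
      using Y.cell_boundary_carrier[of "d + 2"] Y.num_cells_above_dim[of "d + 2"] dimY by (simp only: k_def)
    then have "mat_image (cell_boundary Y (d + 2)) = {0\<^sub>v k}" by (rule mat_image_no_columns)
    then have "trivial_group (vec_group k (mat_kernel A) Mod {0\<^sub>v k})"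
      using triv1 by (simp add: reduced_cellular_homology_def A_def k_def add.commute)
    then have ker: "mat_kernel A = {0\<^sub>v k}"
    proof (rule trivial_vec_quotientD[OF _ additive_set_kernel[OF A]])
      have "- 0\<^sub>v k = (0\<^sub>v k :: int vec)" by (intro eq_vecI) auto
      then show "additive_set k {0\<^sub>v k :: int vec}" by (simp add: additive_set_def)
      show "{0\<^sub>v k} \<subseteq> mat_kernel A" using additive_setD(2)[OF additive_set_kernel[OF A]] by simp
    qed
    show ?thesis
      using cocritical_iso_discriminant[OF A im ker]
      by (simp add: cocritical_group_def Let_def assms(2) A_def k_def)
  qed
  then show ?thesis
    unfolding hom flow cut by (intro conjI discriminant_exact_sequence[OF D0 D0D MN eqs] allI impI)
qed

end
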